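(* Let $L$ be a (nonempty) oriented link in $S^3$. Then the graded Euler characteristic of $\ddot{\mathcal H}_*(L)$ equals the unnormalized Kauffman version of the Jones polynomial of $L$: $$\chi_A(\ddot{\mathcal H}_*(L))=\hat f_L .$$
   Context: Links are in $S^3$ and diagrams are planar. Graded abelian groups are $\mathbb Z$-graded, morphisms have degree $0$, and $G\{l\}$ is the shift $(G\{l\})_j=G_{j-l}$ (applied to a $2$-complex, both groups are shifted). The graded dimension is $q\dim G=\sum_j A^j\operatorname{rk}G_j$, and for a pair $(G_0,G_1)$ of finitely generated graded abelian groups (or a $2$-complex with these groups), $\chi_A=q\dim G_0-q\dim G_1\in\mathbb Z[A,A^{-1}]$. For $i\in\{0,1\}$ write $\underline i=1-i$. A $2$-complex of graded abelian groups is $(A_0,A_1,\partial_0,\partial_1)$ with $\partial_0:A_0\to A_1$, $\partial_1:A_1\to A_0$ degree-$0$ homomorphisms with $\partial_1\partial_0=0$ and $\partial_0\partial_1=0$. Its homology is $H_*(A)=(H_0(A),H_1(A))$ with $H_i(A)=\ker\partial_i/\operatorname{im}\partial_{\underline i}$. The reflexed $2$-complex is $A^\spadesuit=(A_1,A_0,\partial_1,\partial_0)$, and for an integer $n$, $A^{\spadesuit(n)}$ is $A$ if $n$ is even and $A^\spadesuit$ if $n$ is odd. Let $W$ be the free graded abelian group with basis $w_+$ in degree $2$ and $w_-$ in degree $-2$. Define degree-$2$ maps $\bar m:W\otimes W\to W$, $w_-\otimes w_-\mapsto w_-$, $w_+\otimes w_-\mapsto w_+$, $w_-\otimes w_+\mapsto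 w_+$, $w_+\otimes w_+\mapsto 0$; and $\bar\Delta:W\to W\otimes W$, $w_-\mapsto w_+\otimes w_-+w_-\otimes w_+$, $w_+\mapsto w_+\otimes w_+$. A Kauffman state $s$ of a diagram $D$ (orientation ignored) marks each crossing with $A$ (or $0$) or $B$ (or $1$). Splitting each crossing according to its mark (the $A$-splitting joins the two regions swept by the overcrossing strand when rotated counterclockwise towards the undercrossing strand, the $B$-splitting joins the other two) gives a collection $D_s$ of $|s|$ disjoint circles. $a(s)$, $b(s)$ are the numbers of crossings marked $A$, $B$; $s_A$ is the state with all marks $A$. The Kauffman bracket of a nonempty diagram is $\langle D\rangle=\sum_s A^{a(s)-b(s)}(-A^2-A^{-2})^{|s|-1}$. Put $W_s(D)=\big(\bigotimes_{\text{circles of }D_s}W\big)\{a(s)-b(s)\}$, and for $i\in\{0,1\}$ $$\langle\!\langle D\rangle\!\rangle_i=\bigoplus_{s:\ b(s)+|s_A|\in 2\mathbb Z+i}W_s(D).$$ An edge $\xi:s_0\to s_1$ is a pair of states differing at exactly one crossing, marked $A$ in $s_0$ and $B$ in $s_1$; $|\xi|=b(s_0)$. Passing from $D_{s_0}$ to $D_{s_1}$ either merges two circles into one or splits one circle into two; $\partial_\xi:W_{s_0}(D)\to W_{s_1}(D)$ (degree $0$ after the shifts) is $\bar m$, respectively $\bar\Delta$, on the factors of these circles and the identity on all other factors. Given an order of the crossings, $(-1)^\xi$ is $-1$ to the number of crossings marked $B$ in $s_0$ that precede the changing crossing. Set $\partial_i=\sum_{\xi:\ |\xi|+|s_A|\in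 2\mathbb Z+i}(-1)^\xi\partial_\xi:\langle\!\langle D\rangle\!\rangle_i\to\langle\!\langle D\rangle\!\rangle_{\underline i}$ and $\langle\!\langle D\rangle\!\rangle=(\langle\!\langle D\rangle\!\rangle_0,\langle\!\langle D\rangle\!\rangle_1,\partial_0,\partial_1)$, a $2$-complex of graded abelian groups. For an oriented diagram $D$, $w(D)$ is the writhe (number of positive minus number of negative crossings; for a positive crossing the $A$-splitting is the one compatible with the orientation), and $\ddot C(D)=\langle\!\langle D\rangle\!\rangle^{\spadesuit(w(D))}\{-3w(D)\}$. For an oriented link $L$, $\ddot{\mathcal H}_*(L)=H_*(\ddot C(D))$ for any diagram $D$ of $L$ (up to isomorphism independent of $D$ and of the order of crossings), and $\hat f_L=(-A^3)^{-w(D)}(-A^2-A^{-2})\langle D\rangle$, which does not depend on the diagram $D$ of $L$. *)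

theory Defs
  imports "HOL-Algebra.Algebra" "HOL-Library.Poly_Mapping" "HOL-Library.FuncSet"
    "HOL-Number_Theory.Cong"
begin

section \<open>Oriented planar link diagrams\<close>

text \<open>
  Diagrams are encoded in the style of planar diagram codes. Crossings cut the diagram into oriented
  arcs. A crossing records its sign and the arcs by which the over- and the undercrossing strand enter
  and leave it. An arc that occurs at no crossing is a closed component without crossings. What the
  code forgets (the regions of the plane in which split parts of the diagram lie) affects neither
  the oriented link, nor any of the constructions below.
\<close>

record 'a crossing =
  positive :: bool
  over_in :: 'a
  over_out :: 'a
  under_in :: 'a
  under_out :: 'a

text \<open>The order of the crossings used in the sign of an edge is the order of the list.\<close>

record 'a diagram =
  arcs :: "'a set"
  crossings :: "'a crossing list"

text \<open>
  The four ends of arcs at a crossing, in counterclockwise order and starting with an end of the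
  overcrossing strand; the Boolean is true for outgoing ends. At a positive crossing, turning the
  direction of the overcrossing strand counterclockwise by less than a half turn gives the
  direction of the undercrossing strand; at a negative crossing it gives the opposite direction.
\<close>

definition ends :: "'a crossing \<Rightarrow> ('a \<times> bool) list" where
  "ends c =
    (if positive c
     then [(over_out c, True), (under_out c, True), (over_in c, False), (under_in c, False)]
     else [(over_out c, True), (under_in c, False), (over_in c, False), (under_out c, True)])"

definition rel_classes :: "'b set \<Rightarrow> ('b \<times> 'b) set \<Rightarrow> 'b set set" where
  "rel_classes S R = S // {(x, y). x \<in> S \<and> y \<in> S \<and> (x, y) \<in> (R \<union> R\<inverse>)\<^sup>*}"

text \<open>
  The pair of an arc and a Boolean denotes the left (true) or right (false) side of the arc. Between
  two counterclockwise consecutive ends at a crossing, the same region lies on the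
  counterclockwise side of the first end and on the clockwise side of the second; the
  counterclockwise side is the left one for outgoing and the right one for incoming ends. So the
  classes of sides are the boundary curves of the regions, that is, the faces of the closed
  oriented surface determined by the code.
\<close>

definition corners :: "'a crossing \<Rightarrow> (('a \<times> bool) \<times> ('a \<times> bool)) set" where
  "corners c =
    {(ends c ! i, (fst (ends c ! j), \<not> snd (ends c ! j))) | i j. i < 4 \<and> j = (i + 1) mod 4}"

definition faces :: "'a diagram \<Rightarrow> ('a \<times> bool) set set" where
  "faces D = rel_classes (arcs D \<times> UNIV) (\<Union>c\<in>set (crossings D). corners c)"

text \<open>Connected components of the underlying planar graph (not of the link).\<close>

definition pieces :: "'a diagram \<Rightarrow> 'a set set" where
  "pieces D = rel_classes (arcs D)
     (\<Union>c\<in>set (crossings D). (fst ` set (ends c)) \<times> (fst ` set (ends c)))"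

text \<open>
  Planarity is Euler's formula: every connected piece lies on a sphere, i.e.\ \<open>V - E + F = 2 C\<close>.
  Since each vertex is 4-valent, \<open>E = 2 V\<close>, so this reads \<open>F = V + 2 C\<close>. A closed component without
  crossings has two sides and is one piece, so it contributes equally to both sides.
\<close>

definition planar :: "'a diagram \<Rightarrow> bool" where
  "planar D \<longleftrightarrow> card (faces D) = length (crossings D) + 2 * card (pieces D)"

definition oriented_link_diagram :: "'a diagram \<Rightarrow> bool" where
  "oriented_link_diagram D \<longleftrightarrow>
     finite (arcs D) \<and>
     (let ins = concat (map (\<lambda>c. [over_in c, under_in c]) (crossings D));
          outs = concat (map (\<lambda>c. [over_out c, under_out c]) (crossings D))
      in distinct ins \<and> distinct outs \<and> set ins = set outs \<and> set ins \<subseteq> arcs D) \<and>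
     planar D"

definition writhe :: "'a diagram \<Rightarrow> int" where
  "writhe D = (\<Sum>c\<leftarrow>crossings D. if positive c then 1 else -1)"


section \<open>Kauffman states and the Kauffman bracket\<close>

text \<open>A Kauffman state is given by the set of (indices of) crossings marked \<open>B\<close>.\<close>

type_synonym state = "nat set"

definition states :: "'a diagram \<Rightarrow> state set" where
  "states D = Pow {..<length (crossings D)}"

definition num_A :: "'a diagram \<Rightarrow> state \<Rightarrow> nat" where
  "num_A D s = card ({..<length (crossings D)} - s)"

definition num_B :: "'a diagram \<Rightarrow> state \<Rightarrow> nat" where
  "num_B D s = card s"

definition state_A :: state where
  "state_A = {}"

text \<open>
  Let the ends at a crossing be 0, 1, 2, 3 as in \<open>ends\<close>, where 0 and 2 belong to the overcrossing
  strand. Rotated counterclockwise, this strand sweeps the regions between 0 and 1 and between 2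
  and 3. The \<open>A\<close>-splitting joins these regions, so it connects 1 with 2 and 3 with 0.
\<close>

definition splitting :: "bool \<Rightarrow> 'a crossing \<Rightarrow> ('a \<times> 'a) set" where
  "splitting markedB c =
    (let x = (\<lambda>i. fst (ends c ! i))
     in if markedB then {(x 0, x 1), (x 2, x 3)} else {(x 1, x 2), (x 3, x 0)})"

text \<open>A circle of the split diagram is represented by the set of arcs of which it is composed.\<close>

definition circles :: "'a diagram \<Rightarrow> state \<Rightarrow> 'a set set" where
  "circles D s =
     rel_classes (arcs D) (\<Union>k<length (crossings D). splitting (k \<in> s) (crossings D ! k))"

text \<open>Laurent polynomials over the integers, as the group ring of the integers.\<close>

type_synonym laurent = "int \<Rightarrow>\<^sub>0 int"

definition A_pow :: "int \<Rightarrow> laurent" where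
  "A_pow k = Poly_Mapping.single k 1"

text \<open>For nonempty diagrams there is at least one circle, so the subtraction does not truncate.\<close>

definition bracket :: "'a diagram \<Rightarrow> laurent" where
  "bracket D = (\<Sum>s\<in>states D.
     A_pow (int (num_A D s) - int (num_B D s)) *
     (- A_pow 2 - A_pow (-2)) ^ (card (circles D s) - 1))"

text \<open>Integer powers of the unit \<open>- A\<^sup>3\<close>, whose inverse is the negative of \<open>A\<close> to the power -3.\<close>

definition minus_A_cubed_pow :: "int \<Rightarrow> laurent" where
  "minus_A_cubed_pow n =
     (if n \<ge> 0 then (- A_pow 3) ^ nat n else (- A_pow (-3)) ^ nat (- n))"

definition f_hat :: "'a diagram \<Rightarrow> laurent" where
  "f_hat D = minus_A_cubed_pow (- writhe D) * (- A_pow 2 - A_pow (-2)) * bracket D"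


section \<open>2-complexes of graded abelian groups\<close>

type_synonym 'b graded_group = "int \<Rightarrow> 'b monoid"

definition shift_group :: "int \<Rightarrow> 'b graded_group \<Rightarrow> 'b graded_group" where
  "shift_group l G = (\<lambda>j. G (j - l))"

text \<open>
  The rank of an abelian group, which HOL-Algebra writes multiplicatively: the maximal number of
  elements that are linearly independent over the integers.
\<close>

definition independent_in :: "('b, 'm) monoid_scheme \<Rightarrow> 'b set \<Rightarrow> bool" where
  "independent_in G S \<longleftrightarrow> finite S \<and> S \<subseteq> carrier G \<and>
     (\<forall>n :: 'b \<Rightarrow> int. finprod G (\<lambda>x. x [^]\<^bsub>G\<^esub> n x) S = \<one>\<^bsub>G\<^esub> \<longrightarrow> (\<forall>x\<in>S. n x = 0))"

definition rk :: "('b, 'm) monoid_scheme \<Rightarrow> nat" where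
  "rk G = Sup (card ` {S. independent_in G S})"

definition qdim :: "'b graded_group \<Rightarrow> laurent" where
  "qdim G = (\<Sum>j | rk (G j) \<noteq> 0. A_pow j * of_nat (rk (G j)))"

definition euler_char :: "'b graded_group \<times> 'b graded_group \<Rightarrow> laurent" where
  "euler_char G = qdim (fst G) - qdim (snd G)"

text \<open>
  The differentials are given degreewise. The record does not carry the laws of a 2-complex: that the
  differentials are homomorphisms whose two composites vanish. They hold for the complexes of
  planar diagrams below.
\<close>

record 'b two_complex =
  grp0 :: "'b graded_group"
  grp1 :: "'b graded_group"
  diff0 :: "int \<Rightarrow> 'b \<Rightarrow> 'b"
  diff1 :: "int \<Rightarrow> 'b \<Rightarrow> 'b"

definition homology :: "'b two_complex \<Rightarrow> 'b set graded_group \<times> 'b set graded_group" where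
  "homology C =
    ((\<lambda>j. (grp0 C j) \<lparr>carrier := kernel (grp0 C j) (grp1 C j) (diff0 C j)\<rparr>
            Mod (diff1 C j ` carrier (grp1 C j))),
     (\<lambda>j. (grp1 C j) \<lparr>carrier := kernel (grp1 C j) (grp0 C j) (diff1 C j)\<rparr>
            Mod (diff0 C j ` carrier (grp0 C j))))"

definition reflex :: "'b two_complex \<Rightarrow> 'b two_complex" where
  "reflex C = \<lparr>grp0 = grp1 C, grp1 = grp0 C, diff0 = diff1 C, diff1 = diff0 C\<rparr>"

definition reflex_pow :: "int \<Rightarrow> 'b two_complex \<Rightarrow> 'b two_complex" where
  "reflex_pow n C = (if even n then C else reflex C)"

definition shift :: "int \<Rightarrow> 'b two_complex \<Rightarrow> 'b two_complex" where
  "shift l C = \<lparr>grp0 = shift_group l (grp0 C), grp1 = shift_group l (grp1 C),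
                diff0 = (\<lambda>j. diff0 C (j - l)), diff1 = (\<lambda>j. diff1 C (j - l))\<rparr>"


section \<open>The 2-complex of a diagram\<close>

datatype w_basis = W_plus | W_minus

fun w_degree :: "w_basis \<Rightarrow> int" where
  "w_degree W_plus = 2"
| "w_degree W_minus = -2"

text \<open>
  A homomorphism out of a free abelian group is given by its values on basis elements, and
  \<open>W \<otimes> W\<close> is the free abelian group on pairs of basis elements of \<open>W\<close>.
\<close>

fun m_bar :: "w_basis \<times> w_basis \<Rightarrow> w_basis \<Rightarrow>\<^sub>0 int" where
  "m_bar (W_minus, W_minus) = frag_of W_minus"
| "m_bar (W_plus, W_minus) = frag_of W_plus"
| "m_bar (W_minus, W_plus) = frag_of W_plus"
| "m_bar (W_plus, W_plus) = 0"

fun Delta_bar :: "w_basis \<Rightarrow> w_basis \<times> w_basis \<Rightarrow>\<^sub>0 int" where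
  "Delta_bar W_minus = frag_of (W_plus, W_minus) + frag_of (W_minus, W_plus)"
| "Delta_bar W_plus = frag_of (W_plus, W_plus)"

text \<open>
  The tensor product of copies of \<open>W\<close> over the circles of a state is free on the labellings of the
  circles by basis elements of \<open>W\<close>. Hence the direct sum over states is free on pairs of a state
  and such a labelling.
\<close>

type_synonym 'a generator = "state \<times> ('a set \<Rightarrow> w_basis)"

definition labellings :: "'a diagram \<Rightarrow> state \<Rightarrow> ('a set \<Rightarrow> w_basis) set" where
  "labellings D s = circles D s \<rightarrow>\<^sub>E UNIV"

definition degree_of :: "'a diagram \<Rightarrow> 'a generator \<Rightarrow> int" where
  "degree_of D = (\<lambda>(s, v).
     (\<Sum>c\<in>circles D s. w_degree (v c)) + (int (num_A D s) - int (num_B D s)))"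

definition generators :: "'a diagram \<Rightarrow> nat \<Rightarrow> int \<Rightarrow> 'a generator set" where
  "generators D i j =
    {(s, v). s \<in> states D \<and> v \<in> labellings D s \<and>
       [num_B D s + card (circles D state_A) = i] (mod 2) \<and> degree_of D (s, v) = j}"

definition bracket_group :: "'a diagram \<Rightarrow> nat \<Rightarrow> ('a generator \<Rightarrow>\<^sub>0 int) graded_group" where
  "bracket_group D i = (\<lambda>j. free_Abelian_group (generators D i j))"

text \<open>
  The map of the edge that changes the marker of crossing \<open>k\<close> of the state \<open>s\<close> from \<open>A\<close> to \<open>B\<close>, on a
  generator. The circles of \<open>s\<close> that are not circles of the new state are the ones that get merged
  or split. In which order the two circles are listed is immaterial, because \<open>m_bar\<close> is commutative
  and \<open>Delta_bar\<close> cocommutative. For planar diagrams one of the first two cases always applies.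
\<close>

definition edge_map :: "'a diagram \<Rightarrow> nat \<Rightarrow> 'a generator \<Rightarrow> 'a generator \<Rightarrow>\<^sub>0 int" where
  "edge_map D k = (\<lambda>(s, v).
    let t = insert k s;
        old = circles D s - circles D t;
        new = circles D t - circles D s
    in if card old = 2 \<and> card new = 1 then
         (let (c1, c2) = (SOME (c1, c2). c1 \<noteq> c2 \<and> old = {c1, c2});
              c = the_elem new
          in frag_extend (\<lambda>x. frag_of (t, restrict (v(c := x)) (circles D t)))
               (m_bar (v c1, v c2)))
       else if card old = 1 \<and> card new = 2 then
         (let c = the_elem old;
              (c1, c2) = (SOME (c1, c2). c1 \<noteq> c2 \<and> new = {c1, c2})
          in frag_extend (\<lambda>(x, y). frag_of (t, restrict (v(c1 := x, c2 := y)) (circles D t)))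
               (Delta_bar (v c)))
       else 0)"

definition edge_sign :: "nat \<Rightarrow> state \<Rightarrow> int" where
  "edge_sign k s = (-1) ^ card {l \<in> s. l < k}"

text \<open>
  An edge starting at \<open>s\<close> contributes to the differential on the summand of \<open>s\<close> only, and the parity
  condition on it is the one that defines the group containing this summand. So both differentials
  are given by the same formula, and in every degree.
\<close>

definition bracket_diff ::
    "'a diagram \<Rightarrow> ('a generator \<Rightarrow>\<^sub>0 int) \<Rightarrow> ('a generator \<Rightarrow>\<^sub>0 int)" where
  "bracket_diff D = frag_extend (\<lambda>(s, v).
     \<Sum>k\<in>{..<length (crossings D)} - s. frag_cmul (edge_sign k s) (edge_map D k (s, v)))"

definition bracket_complex :: "'a diagram \<Rightarrow> ('a generator \<Rightarrow>\<^sub>0 int) two_complex" where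
  "bracket_complex D =
    \<lparr>grp0 = bracket_group D 0, grp1 = bracket_group D 1,
     diff0 = (\<lambda>j. bracket_diff D), diff1 = (\<lambda>j. bracket_diff D)\<rparr>"

definition C_ddot :: "'a diagram \<Rightarrow> ('a generator \<Rightarrow>\<^sub>0 int) two_complex" where
  "C_ddot D = shift (- 3 * writhe D) (reflex_pow (writhe D) (bracket_complex D))"

definition H_ddot ::
    "'a diagram \<Rightarrow> ('a generator \<Rightarrow>\<^sub>0 int) set graded_group \<times> ('a generator \<Rightarrow>\<^sub>0 int) set graded_group" where
  "H_ddot D = homology (C_ddot D)"

end

theory Submission
  imports Defs "HOL-Combinatorics.Orbits"
begin

text \<open>
  Rank is additive, so the Euler characteristic of the homology is that of the complex, and counting
  the labellings of each state gives the state sum of the bracket. This needs two facts about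
  planar diagrams: the composite of the differentials vanishes, and changing one marker changes the
  parity of the number of circles. For both, the point is that every edge of the cube of states is
  a merge or a split.

  Over the field with two elements, Euler's formula makes the first homology of the surface of the
  diagram vanish. Hence the sum of all arcs, a cycle since crossings are 4-valent, bounds, that is, the
  faces have a checkerboard colouring. With the arcs oriented along the colouring, the circles
  of a state are the orbits of a permutation of the arcs, and changing a marker composes this
  permutation with a transposition, which merges two orbits or splits one.
\<close>

section \<open>Checkerboard colourings\<close>

text \<open>On a surface of positive genus, changing a marker can turn one circle into one circle.
  Then the parity of the number of circles no longer follows the number of markers \<open>B\<close>,
  and no local argument excludes this. So planarity must be used first, although it is known only as
  one count of faces, crossings and pieces. To exploit a count, chains modulo 2 are treated as sets
  of arcs or of sides, and every cycle is shown to bound by comparing cardinalities: a lower bound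
  for the number of boundaries meets an upper bound for the number of cycles.

  For the squares of the cube of states, the usual comparison of many configurations of circles is
  avoided. A generator is named by arcs, one on each circle labelled \<open>W_plus\<close>; the
  names survive when the circles change, and the numbers of circles at the four corners leave only
  three types of squares.

  Kernels and images are never shown to be free. Their ranks are controlled through independent
  families alone, so torsion in the homology needs no separate treatment.\<close>

lemma card_rel_invariant_subsets:
  assumes "finite S" and R: "R \<subseteq> S \<times> S"
  shows "card {T. T \<subseteq> S \<and> (\<forall>(x, y)\<in>R. x \<in> T \<longleftrightarrow> y \<in> T)} = 2 ^ card (rel_classes S R)"
proof -
  define E where "E = {(x, y). x \<in> S \<and> y \<in> S \<and> (x, y) \<in> (R \<union> R\<inverse>)\<^sup>*}"
  have sub: "E \<subseteq> S \<times> S" by (auto simp: E_def)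
  have E: "equiv S E"
  proof (rule equivI)
    show "refl_on S E" by (auto simp: refl_on_def E_def)
    have "sym ((R \<union> R\<inverse>)\<^sup>*)" by (rule sym_rtrancl) (simp add: sym_Un_converse)
    then show "sym E" by (auto simp: sym_def E_def)
    show "trans E" unfolding trans_def E_def by (auto intro: rtrancl_trans)
    show "E \<subseteq> S \<times> S" by (auto simp: E_def)
  qed
  let ?I = "{T. T \<subseteq> S \<and> (\<forall>(x, y)\<in>R. x \<in> T \<longleftrightarrow> y \<in> T)}"
  have inv: "x \<in> T \<longleftrightarrow> y \<in> T" if "T \<in> ?I" "(x, y) \<in> E" for x y T
  proof -
    have "(x, y) \<in> (R \<union> R\<inverse>)\<^sup>*" using that by (simp add: E_def)
    then show ?thesis by induction (use that in auto)
  qed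
  \<comment> \<open>Classes are disjoint and nonempty, so a union determines which classes it uses,
    and an invariant set is the union of the classes of its elements. This turns numbers of faces
    and of pieces into cardinalities that can be compared with counts of chains.\<close>
  have "bij_betw Union (Pow (S // E)) ?I"
    unfolding bij_betw_def
  proof
    show "inj_on Union (Pow (S // E))"
    proof (rule inj_onI)
      fix P Q assume PQ: "P \<in> Pow (S // E)" "Q \<in> Pow (S // E)" "\<Union>P = \<Union>Q"
      have *: "Z \<in> Q'" if h: "P' \<subseteq> S // E" "Q' \<subseteq> S // E" "\<Union>P' = \<Union>Q'" "Z \<in> P'" for P' Q' Z
      proof -
        have Z: "Z \<in> S // E" using h by auto
        then obtain x where x: "x \<in> Z" using in_quotient_imp_non_empty[OF E] by fastforce
        then obtain Y where Y: "Y \<in> Q'" "x \<in> Y" using h by blast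
        then have "Z = Y" using quotient_disj[OF E Z] x h by blast
        with Y show ?thesis by simp
      qed
      show "P = Q" using * PQ by (metis Pow_iff subsetI subset_antisym)
    qed
    show "Union ` Pow (S // E) = ?I"
    proof
      show "?I \<subseteq> Union ` Pow (S // E)"
      proof
        fix T assume T: "T \<in> ?I"
        have "T = \<Union>{E `` {x} | x. x \<in> T}"
        proof
          show "T \<subseteq> \<Union>{E `` {x} | x. x \<in> T}" using T by (auto simp: E_def)
          show "\<Union>{E `` {x} | x. x \<in> T} \<subseteq> T" using inv[OF T] by blast
        qed
        moreover have "{E `` {x} | x. x \<in> T} \<in> Pow (S // E)"
          using T by (auto simp: quotient_def)
        ultimately show "T \<in> Union ` Pow (S // E)" by blast
      qed
      show "Union ` Pow (S // E) \<subseteq> ?I"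
      proof
        fix T assume "T \<in> Union ` Pow (S // E)"
        then obtain P where P: "P \<subseteq> S // E" "T = \<Union>P" by auto
        have "T \<subseteq> S" using P Union_quotient[OF E] by blast
        moreover have "y \<in> T" if h: "(x, y) \<in> E" "x \<in> T" for x y
        proof -
          obtain Z where Z: "Z \<in> P" "x \<in> Z" using h P by blast
          then have "Z = E `` {x}"
            using P E by (metis Image_singleton_iff equiv_class_eq_iff quotientE subset_iff)
          then show ?thesis using Z P h by blast
        qed
        moreover have "(x, y) \<in> E \<and> (y, x) \<in> E" if "(x, y) \<in> R" for x y
          using that R by (auto simp: E_def)
        ultimately show "T \<in> ?I" by blast
      qed
    qed
  qed
  then have "card ?I = card (Pow (S // E))" by (rule bij_betw_same_card[symmetric])
  also have "\<dots> = 2 ^ card (S // E)"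
    using card_Pow[OF finite_quotient[OF \<open>finite S\<close> sub]] .
  finally show ?thesis by (simp add: rel_classes_def E_def)
qed

section \<open>Character sums over the field with two elements\<close>

text \<open>Both sides are \<open>-1\<close> to the number of pairs in \<open>h \<times> y\<close>
  related by \<open>M\<close>, counted by columns and by rows.\<close>

lemma prod_power_neg_one_rectangle:
  assumes "finite A" "finite K" "h \<subseteq> A" "y \<subseteq> K"
  shows "(\<Prod>k\<in>y. (-1::int) ^ card {a \<in> h. M a k}) = (\<Prod>a\<in>h. (-1) ^ card {k \<in> y. M a k})"
proof -
  have fin: "finite h" "finite y" using assms by (auto intro: finite_subset)
  have *: "(-1::int) ^ card {x \<in> Z. P x} = (\<Prod>x\<in>Z. if P x then -1 else 1)" if "finite Z"
    for Z :: "'z set" and P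
    using that by (simp add: prod.If_cases Int_def)
  show ?thesis
    using fin by (simp add: * prod.swap[of _ y h])
qed

text \<open>Orthogonality of characters: the summand is a character of the group of subsets under
  symmetric difference, so its sum is the order of the group if it is trivial and 0
  otherwise.\<close>

lemma sum_Pow_prod_power_neg_one:
  assumes "finite K"
  shows "(\<Sum>y\<in>Pow K. \<Prod>k\<in>y. (-1::int) ^ n k) = (if \<forall>k\<in>K. even (n k) then 2 ^ card K else 0)"
proof -
  have "(\<Sum>y\<in>Pow K. \<Prod>k\<in>y. (-1::int) ^ n k) = (\<Prod>k\<in>K. (-1) ^ n k + 1)"
    using prod_add[OF assms, of "\<lambda>k. (-1::int) ^ n k" "\<lambda>_. 1"] by simp
  also have "\<dots> = (if \<forall>k\<in>K. even (n k) then 2 ^ card K else 0)"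
  proof (cases "\<forall>k\<in>K. even (n k)")
    case False
    then obtain k where "k \<in> K" "(-1::int) ^ n k + 1 = 0" by auto
    then show ?thesis using assms False by (auto simp: prod_zero_iff)
  qed simp
  finally show ?thesis .
qed

text \<open>This is the equality of row rank and column rank over the field with two elements.\<close>

lemma card_mod2_kernel_transpose:
  assumes A: "finite A" and K: "finite K"
  shows "card {h. h \<subseteq> A \<and> (\<forall>k\<in>K. even (card {a \<in> h. M a k}))} * 2 ^ card K
    = card {y. y \<subseteq> K \<and> (\<forall>a\<in>A. even (card {k \<in> y. M a k}))} * 2 ^ card A"
proof -
  \<comment> \<open>Summing over the inner variable first leaves exactly the sets in the kernel,
    each with weight \<open>2 ^ card L\<close>. The double sum itself is symmetric under transposing
    the matrix, so it compares the two kernels without bases.\<close>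
  have half: "int (card {h. h \<subseteq> B \<and> (\<forall>k\<in>L. even (card {a \<in> h. N a k}))} * 2 ^ card L)
    = (\<Sum>h\<in>Pow B. \<Sum>y\<in>Pow L. \<Prod>k\<in>y. (-1) ^ card {a \<in> h. N a k})"
    if "finite B" "finite L" for B :: "'x set" and L :: "'y set" and N
  proof -
    have "(\<Sum>h\<in>Pow B. \<Sum>y\<in>Pow L. \<Prod>k\<in>y. (-1) ^ card {a \<in> h. N a k})
      = (\<Sum>h\<in>Pow B. if \<forall>k\<in>L. even (card {a \<in> h. N a k}) then 2 ^ card L else (0::int))"
      using that by (simp add: sum_Pow_prod_power_neg_one)
    also have "\<dots> = (\<Sum>h\<in>{h \<in> Pow B. \<forall>k\<in>L. even (card {a \<in> h. N a k})}. 2 ^ card L)"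
      using that by (subst sum.inter_filter) auto
    finally show ?thesis by (simp add: Pow_def)
  qed
  have "int (card {h. h \<subseteq> A \<and> (\<forall>k\<in>K. even (card {a \<in> h. M a k}))} * 2 ^ card K)
    = (\<Sum>h\<in>Pow A. \<Sum>y\<in>Pow K. \<Prod>a\<in>h. (-1) ^ card {k \<in> y. M a k})"
    unfolding half[OF A K]
    by (intro sum.cong refl prod_power_neg_one_rectangle[OF A K]) auto
  also have "\<dots> = int (card {y. y \<subseteq> K \<and> (\<forall>a\<in>A. even (card {k \<in> y. M a k}))} * 2 ^ card A)"
    unfolding half[OF K A] by (rule sum.swap)
  finally show ?thesis using of_nat_eq_iff by blast
qed


section \<open>Arcs entering and leaving the crossings\<close>

definition out_arcs :: "'a diagram \<Rightarrow> nat \<Rightarrow> 'a set" where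
  "out_arcs D k = {over_out (crossings D ! k), under_out (crossings D ! k)}"

definition in_arcs :: "'a diagram \<Rightarrow> nat \<Rightarrow> 'a set" where
  "in_arcs D k = {over_in (crossings D ! k), under_in (crossings D ! k)}"

definition crossing_arcs :: "'a diagram \<Rightarrow> 'a set" where
  "crossing_arcs D = (\<Union>k<length (crossings D). out_arcs D k)"

lemma distinct_concat_pairs:
  assumes "distinct (concat (map (\<lambda>c. [f c, g c]) cs))"
  shows "k < length cs \<Longrightarrow> f (cs ! k) \<noteq> g (cs ! k)"
    and "k < length cs \<Longrightarrow> l < length cs \<Longrightarrow> k \<noteq> l \<Longrightarrow>
      {f (cs ! k), g (cs ! k)} \<inter> {f (cs ! l), g (cs ! l)} = {}"
proof -
  show "f (cs ! k) \<noteq> g (cs ! k)" if "k < length cs" for k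
    using assms that by (induction cs arbitrary: k) (auto simp: nth_Cons split: nat.splits)
  have less: "{f (cs ! k), g (cs ! k)} \<inter> {f (cs ! l), g (cs ! l)} = {}" if "k < l" "l < length cs" for k l
    using assms that
  proof (induction cs arbitrary: k l)
    case (Cons c cs)
    then obtain l' where "l = Suc l'" by (cases l) auto
    with Cons show ?case by (cases k) auto
  qed simp
  show "{f (cs ! k), g (cs ! k)} \<inter> {f (cs ! l), g (cs ! l)} = {}"
    if "k < length cs" "l < length cs" "k \<noteq> l"
    using less[of k l] less[of l k] that by (cases "k < l") auto
qed

locale link_diagram =
  fixes D :: "'a diagram"
  assumes oriented: "oriented_link_diagram D"
begin

abbreviation n_crossings :: nat where "n_crossings \<equiv> length (crossings D)"

lemma finite_arcs: "finite (arcs D)"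
  using oriented by (simp add: oriented_link_diagram_def)

lemma planar: "planar D"
  using oriented by (simp add: oriented_link_diagram_def Let_def)

lemma distinct_outs: "distinct (concat (map (\<lambda>c. [over_out c, under_out c]) (crossings D)))"
  and distinct_ins: "distinct (concat (map (\<lambda>c. [over_in c, under_in c]) (crossings D)))"
  using oriented by (simp_all add: oriented_link_diagram_def Let_def)

lemma out_arcs_neq: "k < n_crossings \<Longrightarrow> over_out (crossings D ! k) \<noteq> under_out (crossings D ! k)"
  using distinct_outs by (rule distinct_concat_pairs)

lemma in_arcs_neq: "k < n_crossings \<Longrightarrow> over_in (crossings D ! k) \<noteq> under_in (crossings D ! k)"
  using distinct_ins by (rule distinct_concat_pairs)

lemma out_arcs_disjoint: "k < n_crossings \<Longrightarrow> l < n_crossings \<Longrightarrow> k \<noteq> l \<Longrightarrow> out_arcs D k \<inter> out_arcs D l = {}"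
  unfolding out_arcs_def using distinct_outs by (rule distinct_concat_pairs)

lemma in_arcs_disjoint: "k < n_crossings \<Longrightarrow> l < n_crossings \<Longrightarrow> k \<noteq> l \<Longrightarrow> in_arcs D k \<inter> in_arcs D l = {}"
  unfolding in_arcs_def using distinct_ins by (rule distinct_concat_pairs)

lemma crossing_arcs_eq_in: "crossing_arcs D = (\<Union>k<n_crossings. in_arcs D k)"
proof -
  have "set (concat (map (\<lambda>c. [f c, g c]) (crossings D)))
    = (\<Union>k<n_crossings. {f (crossings D ! k), g (crossings D ! k)})" for f g :: "'a crossing \<Rightarrow> 'a"
  proof -
    have "set (concat (map (\<lambda>c. [f c, g c]) cs)) = (\<Union>k<length cs. {f (cs ! k), g (cs ! k)})" for cs
      by (induction cs) (auto simp: lessThan_Suc_eq_insert_0)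
    then show ?thesis .
  qed
  moreover have "set (concat (map (\<lambda>c. [over_in c, under_in c]) (crossings D)))
    = set (concat (map (\<lambda>c. [over_out c, under_out c]) (crossings D)))"
    using oriented by (simp add: oriented_link_diagram_def Let_def)
  ultimately show ?thesis by (simp only: crossing_arcs_def out_arcs_def in_arcs_def)
qed

lemma crossing_arcs_subset: "crossing_arcs D \<subseteq> arcs D"
proof -
  have "over_in c \<in> arcs D \<and> under_in c \<in> arcs D" if "c \<in> set (crossings D)" for c
    using oriented that by (auto simp: oriented_link_diagram_def Let_def)
  then show ?thesis unfolding crossing_arcs_eq_in in_arcs_def by auto
qed

lemma out_arcs_subset: "k < n_crossings \<Longrightarrow> out_arcs D k \<subseteq> crossing_arcs D"
  unfolding crossing_arcs_def by auto

lemma in_arcs_subset: "k < n_crossings \<Longrightarrow> in_arcs D k \<subseteq> crossing_arcs D"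
  unfolding crossing_arcs_eq_in by auto

lemma card_crossing_arcs: "card (crossing_arcs D) = 2 * n_crossings"
proof -
  have "card (crossing_arcs D) = (\<Sum>k<n_crossings. card (out_arcs D k))"
    unfolding crossing_arcs_def using out_arcs_disjoint
    by (intro card_UN_disjoint) (auto simp: out_arcs_def)
  also have "\<dots> = (\<Sum>k<n_crossings. 2)"
    using out_arcs_neq by (intro sum.cong) (auto simp: out_arcs_def)
  finally show ?thesis by simp
qed

lemma set_ends_nth:
  "set (ends (crossings D ! k)) = (\<lambda>a. (a, True)) ` out_arcs D k \<union> (\<lambda>a. (a, False)) ` in_arcs D k"
  by (auto simp: ends_def out_arcs_def in_arcs_def)

lemma fst_set_ends_nth: "fst ` set (ends (crossings D ! k)) = out_arcs D k \<union> in_arcs D k"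
  unfolding set_ends_nth by force

lemma length_ends: "length (ends c) = 4"
  by (simp add: ends_def)

lemma corners_subset: "c \<in> set (crossings D) \<Longrightarrow> corners c \<subseteq> (arcs D \<times> UNIV) \<times> (arcs D \<times> UNIV)"
proof -
  assume "c \<in> set (crossings D)"
  then obtain k where k: "k < n_crossings" "c = crossings D ! k" by (auto simp: in_set_conv_nth)
  then have sub: "fst ` set (ends c) \<subseteq> arcs D"
    using crossing_arcs_subset out_arcs_subset[of k] in_arcs_subset[of k] by (auto simp: fst_set_ends_nth)
  have "fst (ends c ! i) \<in> arcs D" if "i < 4" for i
    using sub that nth_mem[of i "ends c"] length_ends[of c] by auto
  then show ?thesis unfolding corners_def by (clarsimp simp: mem_Times_iff)
qed

text \<open>An arc with both ends at the same crossing is not incident to it modulo 2.\<close>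

definition incident_mod2 :: "'a \<Rightarrow> nat \<Rightarrow> bool" where
  "incident_mod2 a k \<longleftrightarrow> (a \<in> out_arcs D k) \<noteq> (a \<in> in_arcs D k)"

text \<open>Modulo 2, the size of a symmetric difference is the sum of the sizes. So an arc with
  both ends at the crossing cancels by itself, and the condition can be read off from the four ends
  separately, whether or not some of them belong to the same arc.\<close>

lemma even_card_incident_mod2:
  assumes "k < n_crossings"
  shows "even (card {a \<in> h. incident_mod2 a k}) \<longleftrightarrow>
    (((over_out (crossings D ! k) \<in> h) \<noteq> (under_out (crossings D ! k) \<in> h)) =
    ((over_in (crossings D ! k) \<in> h) \<noteq> (under_in (crossings D ! k) \<in> h)))"
proof -
  have two: "even (card (h \<inter> {a, b})) \<longleftrightarrow> (a \<in> h) = (b \<in> h)" if "a \<noteq> b" for a b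
    using that by (cases "a \<in> h"; cases "b \<in> h") auto
  have fin: "finite (h \<inter> out_arcs D k)" "finite (h \<inter> in_arcs D k)"
    by (auto simp: out_arcs_def in_arcs_def)
  have eq: "{a \<in> h. incident_mod2 a k}
    = (h \<inter> out_arcs D k - h \<inter> in_arcs D k) \<union> (h \<inter> in_arcs D k - h \<inter> out_arcs D k)"
    by (auto simp: incident_mod2_def)
  have symdiff: "card ((S - T) \<union> (T - S)) + 2 * card (S \<inter> T) = card S + card T"
    if "finite S" "finite T" for S T :: "'a set"
  proof -
    have "card ((S - T) \<union> (T - S)) = card (S - T) + card (T - S)"
      using that by (intro card_Un_disjoint) auto
    moreover have "card S = card (S - T) + card (S \<inter> T)" "card T = card (T - S) + card (S \<inter> T)"
      using that by (simp_all add: card_Diff_subset_Int Int_commute card_mono)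
    ultimately show ?thesis by simp
  qed
  from symdiff[OF fin] eq have "card {a \<in> h. incident_mod2 a k} + 2 * card ((h \<inter> out_arcs D k) \<inter> (h \<inter> in_arcs D k))
    = card (h \<inter> out_arcs D k) + card (h \<inter> in_arcs D k)"
    by simp
  then have "even (card {a \<in> h. incident_mod2 a k}) \<longleftrightarrow>
    (even (card (h \<inter> out_arcs D k)) = even (card (h \<inter> in_arcs D k)))"
    by presburger
  then show ?thesis
    using two[OF out_arcs_neq[OF assms]] two[OF in_arcs_neq[OF assms]]
    unfolding out_arcs_def in_arcs_def by blast
qed

section \<open>Cycles, boundaries and connected pieces modulo 2\<close>

text \<open>The zeroth cohomology modulo 2 of the underlying graph, written on arcs instead of
  crossings so that components without crossings are included.\<close>

definition piece_sets :: "'a set set" where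
  "piece_sets = {T. T \<subseteq> arcs D \<and> (\<forall>k<n_crossings. \<forall>a\<in>out_arcs D k \<union> in_arcs D k.
     \<forall>b\<in>out_arcs D k \<union> in_arcs D k. a \<in> T \<longleftrightarrow> b \<in> T)}"

lemma finite_piece_sets: "finite piece_sets"
  unfolding piece_sets_def by (rule finite_Collect_conjI) (simp add: finite_Collect_subsets finite_arcs)

lemma card_piece_sets: "card piece_sets = 2 ^ card (pieces D)"
proof -
  let ?R = "\<Union>c\<in>set (crossings D). (fst ` set (ends c)) \<times> (fst ` set (ends c))"
  have R: "?R = (\<Union>k<n_crossings. (out_arcs D k \<union> in_arcs D k) \<times> (out_arcs D k \<union> in_arcs D k))"
  proof -
    have "set (crossings D) = (!) (crossings D) ` {..<n_crossings}"
      by (simp add: nth_image lessThan_atLeast0)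
    then show ?thesis by (simp only: fst_set_ends_nth image_image UN_simps)
  qed
  have "?R \<subseteq> arcs D \<times> arcs D"
  proof -
    have "out_arcs D k \<union> in_arcs D k \<subseteq> arcs D" if "k < n_crossings" for k
      using out_arcs_subset[OF that] in_arcs_subset[OF that] crossing_arcs_subset by blast
    then show ?thesis unfolding R by blast
  qed
  then have "card {T. T \<subseteq> arcs D \<and> (\<forall>(x, y)\<in>?R. x \<in> T \<longleftrightarrow> y \<in> T)} = 2 ^ card (pieces D)"
    unfolding pieces_def by (rule card_rel_invariant_subsets[OF finite_arcs])
  moreover have "piece_sets = {T. T \<subseteq> arcs D \<and> (\<forall>(x, y)\<in>?R. x \<in> T \<longleftrightarrow> y \<in> T)}"
    unfolding piece_sets_def R by (rule Collect_cong) blast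
  ultimately show ?thesis by simp
qed

definition mod2_cycles :: "'a set set" where
  "mod2_cycles = {h. h \<subseteq> arcs D \<and> (\<forall>k\<in>{..<n_crossings}. even (card {a \<in> h. incident_mod2 a k}))}"

text \<open>The transposed kernel \<open>?Y\<close> consists of the sets of crossings that are
  constant along arcs. Together with a free choice \<open>?L\<close> among the arcs without
  crossings, it embeds into the unions of pieces, which bounds its size. As there are twice as many
  other arcs as crossings, transposing gives the bound for cycles.\<close>

lemma card_mod2_cycles: "card mod2_cycles \<le> 2 ^ (n_crossings + card (pieces D))"
proof -
  let ?Y = "{y. y \<subseteq> {..<n_crossings} \<and> (\<forall>a\<in>arcs D. even (card {k \<in> y. incident_mod2 a k}))}"
  let ?L = "Pow (arcs D - crossing_arcs D)"
  \<comment> \<open>Outgoing arcs suffice: each arc at a crossing leaves exactly one crossing, so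
    membership of the arc tells whether that crossing was chosen.\<close>
  define u where "u = (\<lambda>(y, l). (\<Union>k\<in>y. out_arcs D k) \<union> l)"
  have u_out: "a \<in> u (y, l) \<longleftrightarrow> k \<in> y"
    if "y \<subseteq> {..<n_crossings}" "l \<in> ?L" "k < n_crossings" "a \<in> out_arcs D k" for y l k a
    using that out_arcs_disjoint[of k] out_arcs_subset[of k] by (auto simp: u_def)
  have u_in: "a \<in> u (y, l) \<longleftrightarrow> k \<in> y"
    if y: "y \<in> ?Y" and l: "l \<in> ?L" and k: "k < n_crossings" and a: "a \<in> in_arcs D k" for y l k a
  proof -
    have "a \<in> crossing_arcs D" using in_arcs_subset k a by blast
    then obtain m where m: "m < n_crossings" "a \<in> out_arcs D m" by (auto simp: crossing_arcs_def)
    \<comment> \<open>The arc leaves \<open>m\<close> and enters \<open>k\<close>. If these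
      coincide, it is incident to no crossing modulo 2 and there is nothing to compare; otherwise
      evenness says that \<open>y\<close> contains both of them or neither.\<close>
    have "incident_mod2 a j \<longleftrightarrow> (j = m) \<noteq> (j = k)" if "j < n_crossings" for j
      using that m k a out_arcs_disjoint[of j m] in_arcs_disjoint[of j k] by (auto simp: incident_mod2_def)
    then have "{j \<in> y. incident_mod2 a j} = {j \<in> y. (j = m) \<noteq> (j = k)}" using y by auto
    also have "\<dots> = (if m = k then {} else y \<inter> {m, k})" by auto
    finally have eq: "{j \<in> y. incident_mod2 a j} = (if m = k then {} else y \<inter> {m, k})" .
    have "even (card {j \<in> y. incident_mod2 a j})"
      using y subsetD[OF crossing_arcs_subset \<open>a \<in> crossing_arcs D\<close>] by blast
    then have "m = k \<or> even (card (y \<inter> {m, k}))" unfolding eq by (simp split: if_splits)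
    then have "m \<in> y \<longleftrightarrow> k \<in> y"
      by (cases "m \<in> y"; cases "k \<in> y") auto
    then show ?thesis using u_out[of y l m a] y l m by auto
  qed
  have rest: "l = u (y, l) - crossing_arcs D" if "y \<subseteq> {..<n_crossings}" "l \<subseteq> arcs D - crossing_arcs D" for y l
  proof -
    have "(\<Union>k\<in>y. out_arcs D k) \<subseteq> crossing_arcs D" using out_arcs_subset that(1) by blast
    then show ?thesis using that(2) unfolding u_def by auto
  qed
  have "inj_on u (?Y \<times> ?L)"
  proof (rule inj_onI, clarify)
    fix y l y' l' assume *: "y \<subseteq> {..<n_crossings}" "y' \<subseteq> {..<n_crossings}"
      "l \<subseteq> arcs D - crossing_arcs D" "l' \<subseteq> arcs D - crossing_arcs D" "u (y, l) = u (y', l')"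
    have "k \<in> y \<longleftrightarrow> k \<in> y'" if "k < n_crossings" for k
      using * that u_out[of y l k "over_out (crossings D ! k)"] u_out[of y' l' k "over_out (crossings D ! k)"]
      by (auto simp: out_arcs_def)
    then have "y = y'" using * by auto
    moreover have "l = u (y, l) - crossing_arcs D" "l' = u (y', l') - crossing_arcs D"
      using * rest by blast+
    ultimately show "y = y' \<and> l = l'" using * by simp
  qed
  moreover have "u ` (?Y \<times> ?L) \<subseteq> piece_sets"
  proof
    fix T assume "T \<in> u ` (?Y \<times> ?L)"
    then obtain y l where yl: "y \<in> ?Y" "l \<in> ?L" "T = u (y, l)" by auto
    have "(\<Union>k\<in>y. out_arcs D k) \<subseteq> arcs D"
      using out_arcs_subset crossing_arcs_subset yl(1) by blast
    then have "T \<subseteq> arcs D" using yl(2,3) by (auto simp: u_def)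
    moreover have "a \<in> T \<longleftrightarrow> k \<in> y" if "k < n_crossings" "a \<in> out_arcs D k \<union> in_arcs D k" for k a
      using u_out[of y l k a] u_in[of y l k a] yl that by blast
    ultimately show "T \<in> piece_sets" unfolding piece_sets_def by simp
  qed
  ultimately have "card (?Y \<times> ?L) \<le> card piece_sets" using finite_piece_sets by (rule card_inj_on_le)
  also have "card piece_sets = 2 ^ card (pieces D)"
    by (rule card_piece_sets)
  also have "card (?Y \<times> ?L) = card ?Y * 2 ^ (card (arcs D) - 2 * n_crossings)"
    using finite_arcs crossing_arcs_subset
    by (simp add: card_cartesian_product card_Pow card_Diff_subset finite_subset card_crossing_arcs)
  finally have Y: "card ?Y * 2 ^ (card (arcs D) - 2 * n_crossings) \<le> 2 ^ card (pieces D)" .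
  \<comment> \<open>The exponent used above is a truncated difference; this bound makes it the true
    number of arcs without crossings.\<close>
  have E: "2 * n_crossings \<le> card (arcs D)"
    using card_mono[OF finite_arcs crossing_arcs_subset] by (simp add: card_crossing_arcs)
  have "card mod2_cycles * 2 ^ n_crossings = card ?Y * 2 ^ card (arcs D)"
    unfolding mod2_cycles_def
    using card_mod2_kernel_transpose[OF finite_arcs finite_lessThan, of n_crossings incident_mod2] by simp
  also have "\<dots> = card ?Y * 2 ^ (card (arcs D) - 2 * n_crossings) * 2 ^ (2 * n_crossings)"
    using E by (simp flip: power_add)
  also have "\<dots> \<le> 2 ^ card (pieces D) * 2 ^ (2 * n_crossings)"
    using Y by (rule mult_right_mono) simp
  also have "\<dots> = 2 ^ (n_crossings + card (pieces D)) * 2 ^ n_crossings"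
    by (simp flip: power_add add: mult_2 ac_simps)
  finally show ?thesis by simp
qed

text \<open>The 2-chains modulo 2 of the surface of the code, each written as the set of sides of
  its faces; \<open>boundary\<close> is the cellular boundary map on them.\<close>

definition face_sets :: "('a \<times> bool) set set" where
  "face_sets = {T. T \<subseteq> arcs D \<times> UNIV \<and>
     (\<forall>(x, y)\<in>(\<Union>c\<in>set (crossings D). corners c). x \<in> T \<longleftrightarrow> y \<in> T)}"

definition boundary :: "('a \<times> bool) set \<Rightarrow> 'a set" where
  "boundary T = {a. ((a, True) \<in> T) \<noteq> ((a, False) \<in> T)}"

lemma card_face_sets: "card face_sets = 2 ^ card (faces D)"
  unfolding face_sets_def faces_def
  by (rule card_rel_invariant_subsets) (use finite_arcs corners_subset in auto)

lemma face_sets_corner: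
  assumes "T \<in> face_sets" "k < n_crossings" "i < 4"
  shows "ends (crossings D ! k) ! i \<in> T \<longleftrightarrow>
    (fst (ends (crossings D ! k) ! ((i + 1) mod 4)), \<not> snd (ends (crossings D ! k) ! ((i + 1) mod 4))) \<in> T"
proof -
  have "(ends (crossings D ! k) ! i, fst (ends (crossings D ! k) ! ((i + 1) mod 4)),
      \<not> snd (ends (crossings D ! k) ! ((i + 1) mod 4))) \<in> (\<Union>c\<in>set (crossings D). corners c)"
    using assms(2,3) by (auto simp: corners_def intro!: bexI[of _ "crossings D ! k"])
  moreover have "\<forall>(x, y)\<in>(\<Union>c\<in>set (crossings D). corners c). x \<in> T \<longleftrightarrow> y \<in> T"
    using assms(1) by (simp add: face_sets_def)
  ultimately show ?thesis by (auto dest: bspec)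
qed

lemma face_sets_positive:
  assumes "T \<in> face_sets" "k < n_crossings" "positive (crossings D ! k)"
  shows "(over_out (crossings D ! k), True) \<in> T \<longleftrightarrow> (under_out (crossings D ! k), False) \<in> T"
    and "(under_out (crossings D ! k), True) \<in> T \<longleftrightarrow> (over_in (crossings D ! k), True) \<in> T"
    and "(over_in (crossings D ! k), False) \<in> T \<longleftrightarrow> (under_in (crossings D ! k), True) \<in> T"
    and "(under_in (crossings D ! k), False) \<in> T \<longleftrightarrow> (over_out (crossings D ! k), False) \<in> T"
  using face_sets_corner[OF assms(1,2), of 0] face_sets_corner[OF assms(1,2), of 1]
    face_sets_corner[OF assms(1,2), of 2] face_sets_corner[OF assms(1,2), of 3] assms(3)
  by (simp_all add: ends_def)

lemma face_sets_negative:
  assumes "T \<in> face_sets" "k < n_crossings" "\<not> positive (crossings D ! k)"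
  shows "(over_out (crossings D ! k), True) \<in> T \<longleftrightarrow> (under_in (crossings D ! k), True) \<in> T"
    and "(under_in (crossings D ! k), False) \<in> T \<longleftrightarrow> (over_in (crossings D ! k), True) \<in> T"
    and "(over_in (crossings D ! k), False) \<in> T \<longleftrightarrow> (under_out (crossings D ! k), False) \<in> T"
    and "(under_out (crossings D ! k), True) \<in> T \<longleftrightarrow> (over_out (crossings D ! k), False) \<in> T"
  using face_sets_corner[OF assms(1,2), of 0] face_sets_corner[OF assms(1,2), of 1]
    face_sets_corner[OF assms(1,2), of 2] face_sets_corner[OF assms(1,2), of 3] assms(3)
  by (simp_all add: ends_def)

text \<open>Going once round a crossing, one returns to the first region, so the colour changes an
  even number of times; the changes happen exactly at the ends of boundary arcs.\<close>

lemma boundary_mod2_cycle: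
  assumes "T \<in> face_sets"
  shows "boundary T \<in> mod2_cycles"
proof -
  have "even (card {a \<in> boundary T. incident_mod2 a k})" if k: "k < n_crossings" for k
  proof (cases "positive (crossings D ! k)")
    case True
    show ?thesis
      by (subst even_card_incident_mod2[OF k],
          unfold boundary_def mem_Collect_eq face_sets_positive[OF assms k True]) argo
  next
    case False
    show ?thesis
      by (subst even_card_incident_mod2[OF k],
          unfold boundary_def mem_Collect_eq face_sets_negative[OF assms k False]) argo
  qed
  moreover have "boundary T \<subseteq> arcs D"
    using assms by (auto simp: boundary_def face_sets_def)
  ultimately show ?thesis by (simp add: mod2_cycles_def)
qed

text \<open>Two colourings with the same boundary differ on both sides of an arc or on neither, and
  the corners carry this difference round every crossing. So it is a union of pieces, and each fibre
  of the boundary map has at most \<open>2 ^ card (pieces D)\<close> elements.\<close>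

lemma card_face_sets_le: "card face_sets \<le> card (boundary ` face_sets) * 2 ^ card (pieces D)"
proof -
  have fin: "finite face_sets"
    unfolding face_sets_def by (rule finite_Collect_conjI) (simp add: finite_Collect_subsets finite_arcs)
  have fibre: "card {T \<in> face_sets. boundary T = boundary T0} \<le> 2 ^ card (pieces D)" if T0: "T0 \<in> face_sets" for T0
  proof -
    define g where "g = (\<lambda>T. {a. ((a, True) \<in> T) \<noteq> ((a, True) \<in> T0)})"
    have both: "((a, b) \<in> T) \<noteq> ((a, b) \<in> T0) \<longleftrightarrow> a \<in> g T" if "boundary T = boundary T0" for T a b
      using that by (cases b) (auto simp: g_def boundary_def set_eq_iff)
    have "inj_on g {T \<in> face_sets. boundary T = boundary T0}"
    proof (intro inj_onI Set.set_eqI)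
      fix T T' x
      assume "T \<in> {T \<in> face_sets. boundary T = boundary T0}" "T' \<in> {T \<in> face_sets. boundary T = boundary T0}"
        "g T = g T'"
      then show "x \<in> T \<longleftrightarrow> x \<in> T'"
        using both[of T "fst x" "snd x"] both[of T' "fst x" "snd x"] by simp blast
    qed
    moreover have "g ` {T \<in> face_sets. boundary T = boundary T0} \<subseteq> piece_sets"
    proof
      fix S assume "S \<in> g ` {T \<in> face_sets. boundary T = boundary T0}"
      then obtain T where T: "T \<in> face_sets" "boundary T = boundary T0" "S = g T" by auto
      have "S \<subseteq> arcs D" using T T0 by (auto simp: g_def face_sets_def)
      moreover have "a \<in> S \<longleftrightarrow> fst (ends (crossings D ! k) ! 0) \<in> S"
        if k: "k < n_crossings" and a: "a \<in> out_arcs D k \<union> in_arcs D k" for k a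
      proof -
        let ?e = "\<lambda>i. fst (ends (crossings D ! k) ! i)"
        have step: "?e i \<in> S \<longleftrightarrow> ?e ((i + 1) mod 4) \<in> S" if "i < 4" for i
          using face_sets_corner[OF T(1) k that] face_sets_corner[OF T0 k that] T(3)
            both[OF T(2), of "?e i" "snd (ends (crossings D ! k) ! i)"]
            both[OF T(2), of "?e ((i + 1) mod 4)" "\<not> snd (ends (crossings D ! k) ! ((i + 1) mod 4))"]
          by (simp only: prod.collapse)
        have *: "?e i \<in> S \<longleftrightarrow> ?e 0 \<in> S" if "i < 4" for i
        proof -
          from that consider "i = 0" | "i = 1" | "i = 2" | "i = 3" by linarith
          moreover have m: "(0 + 1) mod 4 = (1::nat)" "(1 + 1) mod 4 = (2::nat)" "(2 + 1) mod 4 = (3::nat)"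
            by simp_all
          ultimately show ?thesis using step[of 0] step[of 1] step[of 2] unfolding m by cases simp_all
        qed
        have "a \<in> fst ` set (ends (crossings D ! k))" using a by (simp only: fst_set_ends_nth)
        then obtain i where i: "i < 4" "a = ?e i"
          using length_ends[of "crossings D ! k"] by (simp only: set_conv_nth) blast
        show ?thesis unfolding i(2) using i(1) by (rule *)
      qed
      ultimately show "S \<in> piece_sets" unfolding piece_sets_def by simp
    qed
    ultimately show ?thesis using card_inj_on_le[OF _ _ finite_piece_sets] by (simp only: card_piece_sets)
  qed
  have "card face_sets = (\<Sum>h\<in>boundary ` face_sets. card {T \<in> face_sets. boundary T = h})"
    using sum.image_gen[OF fin, of "\<lambda>_. 1::nat" boundary] by (simp only: card_eq_sum)
  also have "\<dots> \<le> (\<Sum>h\<in>boundary ` face_sets. 2 ^ card (pieces D))"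
    using fibre by (intro sum_mono) auto
  finally show ?thesis by simp
qed

text \<open>Planarity gives \<open>2 ^ (n_crossings + card (pieces D))\<close> as a lower bound for
  the number of boundaries. This is also the upper bound for the number of cycles, so the inclusion
  of boundaries in cycles is an equality.\<close>

theorem checkerboard:
  obtains T where "T \<in> face_sets" "boundary T = arcs D"
proof -
  have fin: "finite mod2_cycles"
    unfolding mod2_cycles_def by (rule finite_Collect_conjI) (simp add: finite_Collect_subsets finite_arcs)
  have "2 ^ (n_crossings + card (pieces D)) * 2 ^ card (pieces D)
    \<le> card (boundary ` face_sets) * 2 ^ card (pieces D)"
  proof -
    have "2 ^ (n_crossings + card (pieces D)) * 2 ^ card (pieces D) = (2::nat) ^ card (faces D)"
      using planar by (simp add: planar_def mult_2 add.assoc flip: power_add)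
    then show ?thesis using card_face_sets_le by (simp only: card_face_sets)
  qed
  then have "card mod2_cycles \<le> card (boundary ` face_sets)"
    using card_mod2_cycles by simp
  moreover have "boundary ` face_sets \<subseteq> mod2_cycles" using boundary_mod2_cycle by auto
  ultimately have "boundary ` face_sets = mod2_cycles" using fin by (simp add: card_seteq)
  moreover have "arcs D \<in> mod2_cycles"
  proof -
    have "out_arcs D k \<subseteq> arcs D \<and> in_arcs D k \<subseteq> arcs D" if "k < n_crossings" for k
      using out_arcs_subset[OF that] in_arcs_subset[OF that] crossing_arcs_subset by blast
    then have "even (card {a \<in> arcs D. incident_mod2 a k})" if "k < n_crossings" for k
      using that by (subst even_card_incident_mod2) (simp_all add: out_arcs_def in_arcs_def)
    then show ?thesis unfolding mod2_cycles_def by simp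
  qed
  ultimately have "arcs D \<in> boundary ` face_sets" by simp
  then show thesis using that by blast
qed

end

section \<open>Rank of abelian groups\<close>

definition lincomb :: "('b, 'm) monoid_scheme \<Rightarrow> ('i \<Rightarrow> 'b) \<Rightarrow> ('i \<Rightarrow> int) \<Rightarrow> 'i set \<Rightarrow> 'b" where
  "lincomb G x n I = finprod G (\<lambda>i. x i [^]\<^bsub>G\<^esub> n i) I"

text \<open>Families instead of sets, because a homomorphism may send two indices to the same
  element; this has to count as a dependence and not as a smaller set.\<close>

definition independent_family :: "('b, 'm) monoid_scheme \<Rightarrow> ('i \<Rightarrow> 'b) \<Rightarrow> 'i set \<Rightarrow> bool" where
  "independent_family G x I \<longleftrightarrow> finite I \<and> x ` I \<subseteq> carrier G \<and>
     (\<forall>n. lincomb G x n I = \<one>\<^bsub>G\<^esub> \<longrightarrow> (\<forall>i\<in>I. n i = 0))"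

context comm_group begin

lemma subgroup_is_comm_group:
  assumes "subgroup H G"
  shows "comm_group (G\<lparr>carrier := H\<rparr>)"
proof -
  interpret H: group "G\<lparr>carrier := H\<rparr>" using assms by (rule subgroup.subgroup_is_group) (rule is_group)
  show ?thesis
    by (rule H.group_comm_groupI) (use subgroup.subset[OF assms] in \<open>auto intro: m_comm\<close>)
qed

lemma lincomb_closed: "x ` I \<subseteq> carrier G \<Longrightarrow> lincomb G x n I \<in> carrier G"
  unfolding lincomb_def by (intro finprod_closed) auto

lemma lincomb_cong:
  assumes "\<And>i. i \<in> I \<Longrightarrow> x i = y i" "\<And>i. i \<in> I \<Longrightarrow> n i = m i" "y ` I \<subseteq> carrier G"
  shows "lincomb G x n I = lincomb G y m I"
  unfolding lincomb_def using assms by (intro finprod_cong') auto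

lemma lincomb_add:
  assumes "x ` I \<subseteq> carrier G"
  shows "lincomb G x (\<lambda>i. n i + m i) I = lincomb G x n I \<otimes> lincomb G x m I"
proof -
  have "lincomb G x (\<lambda>i. n i + m i) I = finprod G (\<lambda>i. x i [^] n i \<otimes> x i [^] m i) I"
    unfolding lincomb_def using assms by (intro finprod_cong') (auto simp: int_pow_mult)
  then show ?thesis
    unfolding lincomb_def using assms by (subst (asm) finprod_multf) auto
qed

lemma lincomb_zero: "x ` I \<subseteq> carrier G \<Longrightarrow> (\<And>i. i \<in> I \<Longrightarrow> n i = 0) \<Longrightarrow> lincomb G x n I = \<one>"
  unfolding lincomb_def by (intro finprod_one_eqI) auto

lemma lincomb_insert:
  "finite I \<Longrightarrow> i \<notin> I \<Longrightarrow> x ` insert i I \<subseteq> carrier G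
    \<Longrightarrow> lincomb G x n (insert i I) = x i [^] n i \<otimes> lincomb G x n I"
  unfolding lincomb_def by (subst finprod_insert) auto

lemma lincomb_singleton: "x i \<in> carrier G \<Longrightarrow> lincomb G x n {i} = x i [^] n i"
  using lincomb_insert[of "{}" i x n] lincomb_zero[of x "{}" n] by simp

lemma lincomb_Un:
  assumes "finite I" "finite J" "I \<inter> J = {}" "x ` (I \<union> J) \<subseteq> carrier G"
  shows "lincomb G x n (I \<union> J) = lincomb G x n I \<otimes> lincomb G x n J"
  unfolding lincomb_def using assms by (intro finprod_Un_disjoint) auto

lemma lincomb_mono:
  assumes "finite J" "I \<subseteq> J" "x ` J \<subseteq> carrier G" "\<And>i. i \<in> J - I \<Longrightarrow> n i = 0"
  shows "lincomb G x n I = lincomb G x n J"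
proof -
  have "lincomb G x n (I \<union> (J - I)) = lincomb G x n I \<otimes> lincomb G x n (J - I)"
    using assms by (intro lincomb_Un) (auto intro: finite_subset)
  moreover have "lincomb G x n (J - I) = \<one>"
    using assms by (intro lincomb_zero) auto
  moreover have "lincomb G x n I \<in> carrier G"
    using assms by (intro lincomb_closed) auto
  moreover have "I \<union> (J - I) = J" using assms by auto
  ultimately show ?thesis by simp
qed

lemma lincomb_pow:
  assumes "finite I" "x ` I \<subseteq> carrier G"
  shows "lincomb G x (\<lambda>i. n i * m) I = lincomb G x n I [^] (m::int)"
  using assms
proof (induction I)
  case empty
  then show ?case by (simp add: lincomb_def)
next
  case (insert i I)
  then have "lincomb G x n I \<in> carrier G" by (intro lincomb_closed) auto
  with insert show ?case
    by (simp add: lincomb_insert int_pow_distrib int_pow_pow)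
qed

lemma lincomb_lincomb:
  assumes "finite I" "finite J" "x ` J \<subseteq> carrier G"
  shows "lincomb G (\<lambda>i. lincomb G x (c i) J) m I = lincomb G x (\<lambda>j. \<Sum>i\<in>I. c i j * m i) J"
  using assms(1)
proof (induction I)
  case empty
  then show ?case using assms by (simp add: lincomb_zero) (simp add: lincomb_def)
next
  case (insert i I)
  have "lincomb G (\<lambda>i. lincomb G x (c i) J) m (insert i I)
    = lincomb G x (c i) J [^] m i \<otimes> lincomb G (\<lambda>i. lincomb G x (c i) J) m I"
    using insert assms by (intro lincomb_insert) (auto intro!: lincomb_closed)
  with insert assms show ?case by (simp add: lincomb_add lincomb_pow)
qed

lemma lincomb_reindex:
  assumes "inj_on f I" "x ` f ` I \<subseteq> carrier G"
  shows "lincomb G x n (f ` I) = lincomb G (x \<circ> f) (n \<circ> f) I"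
  unfolding lincomb_def using assms by (subst finprod_reindex) (auto simp: o_def)

lemma independent_family_inj_on:
  assumes "independent_family G x I"
  shows "inj_on x I"
proof (rule inj_onI, rule ccontr)
  fix i j assume ij: "i \<in> I" "j \<in> I" "x i = x j" "i \<noteq> j"
  have I: "finite I" "x ` I \<subseteq> carrier G" using assms by (auto simp: independent_family_def)
  define n where "n = (\<lambda>k. if k = i then 1 else if k = j then -1 else 0 :: int)"
  have "lincomb G x n I = lincomb G x n {i, j}"
    using I ij by (intro lincomb_mono[symmetric]) (auto simp: n_def)
  also have "\<dots> = x i [^] (1::int) \<otimes> (x j [^] (-1::int) \<otimes> \<one>)"
    using I ij lincomb_singleton[of x j n]
    by (subst lincomb_insert) (auto simp: n_def)
  also have "\<dots> = \<one>" using I ij by (auto simp: int_pow_neg)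
  finally have "n i = 0" using assms ij by (auto simp: independent_family_def)
  then show False by (simp add: n_def)
qed

text \<open>A repeated element would satisfy the relation with coefficients \<open>1\<close> and
  \<open>-1\<close>, so independence forces injectivity, and coefficients can be moved between
  indices and elements.\<close>

lemma independent_family_iff:
  "independent_family G x I \<longleftrightarrow> finite I \<and> inj_on x I \<and> independent_in G (x ` I)"
proof -
  have *: "independent_family G x I \<longleftrightarrow> independent_in G (x ` I)" if "inj_on x I" "finite I"
  proof -
    have eq: "lincomb G x n I = finprod G (\<lambda>y. y [^] n (the_inv_into I x y)) (x ` I)"
      if "x ` I \<subseteq> carrier G" for n
    proof -
      have "lincomb G x n I = lincomb G x (n \<circ> the_inv_into I x \<circ> x) I"
        using \<open>inj_on x I\<close> that by (intro lincomb_cong) (auto simp: the_inv_into_f_f)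
      also have "\<dots> = lincomb G id (n \<circ> the_inv_into I x) (x ` I)"
        using \<open>inj_on x I\<close> that by (subst lincomb_reindex) auto
      finally show ?thesis by (simp add: lincomb_def)
    qed
    have eq2: "lincomb G x (n \<circ> x) I = finprod G (\<lambda>y. y [^] n y) (x ` I)"
      if "x ` I \<subseteq> carrier G" for n
      using lincomb_reindex[OF \<open>inj_on x I\<close>, of id n] that by (simp add: lincomb_def o_def)
    show ?thesis
      unfolding independent_family_def independent_in_def
    proof (intro iffI conjI allI impI ballI; (elim conjE)?)
      show "finite (x ` I)" using \<open>finite I\<close> by simp
    next
      fix n :: "'a \<Rightarrow> int" and y
      assume "\<forall>n. lincomb G x n I = \<one> \<longrightarrow> (\<forall>i\<in>I. n i = 0)" "x ` I \<subseteq> carrier G"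
        "(\<Otimes>y\<in>x ` I. y [^] n y) = \<one>" "y \<in> x ` I"
      then show "n y = 0" using eq2[of n] by auto
    next
      fix n i
      assume h: "\<forall>n :: 'a \<Rightarrow> int. (\<Otimes>y\<in>x ` I. y [^] n y) = \<one> \<longrightarrow> (\<forall>y\<in>x ` I. n y = 0)" "x ` I \<subseteq> carrier G"
        "lincomb G x n I = \<one>" "i \<in> I"
      then have "n (the_inv_into I x (x i)) = 0"
        using eq[of n] h(1)[THEN spec, of "\<lambda>y. n (the_inv_into I x y)"] by simp
      then show "n i = 0" using \<open>inj_on x I\<close> \<open>i \<in> I\<close> by (simp add: the_inv_into_f_f)
    next
      show "finite I" by fact
    qed
  qed
  show ?thesis
  proof
    assume ind: "independent_family G x I"
    then have "inj_on x I" "finite I"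
      using independent_family_inj_on by (auto simp: independent_family_def)
    then show "finite I \<and> inj_on x I \<and> independent_in G (x ` I)"
      using * ind by simp
  qed (use * in simp)
qed

end

section \<open>Ranks of kernels and images\<close>

text \<open>A supremum of natural numbers is informative only for bounded sets, so the bound and its
  attainment are carried along instead of the bare value \<open>rk G\<close>.\<close>

definition has_rank :: "('b, 'm) monoid_scheme \<Rightarrow> nat \<Rightarrow> bool" where
  "has_rank G r \<longleftrightarrow> (\<exists>S. independent_in G S \<and> card S = r) \<and> (\<forall>S. independent_in G S \<longrightarrow> card S \<le> r)"

lemma has_rank_rk: "has_rank G r \<Longrightarrow> rk G = r"
  unfolding has_rank_def rk_def by (auto intro!: cSup_eq_maximum)

lemma has_rank_exists:
  assumes "\<And>S. independent_in G S \<Longrightarrow> card S \<le> b"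
  obtains r where "has_rank G r"
proof -
  let ?P = "\<lambda>r. \<exists>S. independent_in G S \<and> card S = r"
  have "?P 0" by (intro exI[of _ "{}"]) (simp add: independent_in_def)
  moreover have "\<forall>r. ?P r \<longrightarrow> r \<le> b" using assms by auto
  ultimately have "?P (Greatest ?P)" "\<forall>r. ?P r \<longrightarrow> r \<le> Greatest ?P"
    using GreatestI_nat[of ?P 0 b] Greatest_le_nat[of ?P _ b] by simp_all
  then have "has_rank G (Greatest ?P)" unfolding has_rank_def by blast
  then show thesis by (rule that)
qed

text \<open>
  The rank is bounded from below by lifting an independent set of the image, and from above by splitting
  an independent set into a part that stays independent in the image and elements that can be
  corrected to elements of the kernel.
\<close>

locale epimorphism = dom: comm_group G + cod: comm_group Q for G (structure) and Q (structure) +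
  fixes f N
  assumes f_hom: "f \<in> hom G Q" and f_surj: "f ` carrier G = carrier Q"
  defines "N \<equiv> G\<lparr>carrier := kernel G Q f\<rparr>"
begin

sublocale group_hom G Q f
  by unfold_locales (rule f_hom)

sublocale ker: comm_group N
  unfolding N_def by (rule dom.subgroup_is_comm_group) (rule subgroup_kernel)

lemma hom_lincomb:
  assumes "x ` I \<subseteq> carrier G" "finite I"
  shows "f (lincomb G x n I) = lincomb Q (f \<circ> x) n I"
  using assms(2,1)
proof (induction I)
  case empty
  then show ?case by (simp add: lincomb_def)
next
  case (insert i I)
  then have "lincomb G x n I \<in> carrier G" by (intro dom.lincomb_closed) auto
  with insert show ?case
    by (simp add: dom.lincomb_insert cod.lincomb_insert image_subset_iff hom_int_pow)
qed

lemma ker_lincomb: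
  assumes "x ` I \<subseteq> carrier N" "finite I"
  shows "lincomb N x n I = lincomb G x n I"
  using assms(2,1)
proof (induction I)
  case empty
  then show ?case using ker.lincomb_zero[of x "{}" n] dom.lincomb_zero[of x "{}" n] by (simp add: N_def)
next
  case (insert i I)
  have sub: "carrier N \<subseteq> carrier G" by (auto simp: N_def kernel_def)
  have "x i [^]\<^bsub>N\<^esub> n i = x i [^] n i"
    unfolding N_def
    by (rule dom.int_pow_consistent[symmetric]) (use insert subgroup_kernel in \<open>auto simp: N_def\<close>)
  moreover have "lincomb N x n (insert i I) = x i [^]\<^bsub>N\<^esub> n i \<otimes>\<^bsub>N\<^esub> lincomb N x n I"
    using insert by (intro ker.lincomb_insert) auto
  moreover have "lincomb G x n (insert i I) = x i [^] n i \<otimes> lincomb G x n I"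
    using insert sub by (intro dom.lincomb_insert) auto
  ultimately show ?case using insert by (simp add: N_def)
qed

text \<open>Applying \<open>f\<close> to a relation removes the part in the kernel, so the
  coefficients over \<open>J\<close> vanish; what remains is a relation inside the kernel.\<close>

lemma independent_family_lift:
  assumes I: "independent_family N x I" and J: "independent_family Q (f \<circ> y) J" "y ` J \<subseteq> carrier G"
  shows "independent_family G (case_sum x y) (I <+> J)"
proof -
  have sub: "carrier N \<subseteq> carrier G" by (auto simp: N_def kernel_def)
  have xI: "x ` I \<subseteq> carrier N" and fin: "finite I" "finite J"
    using I J by (auto simp: independent_family_def)
  have c: "case_sum x y ` Inl ` I \<subseteq> carrier G" "case_sum x y ` Inr ` J \<subseteq> carrier G"
    using subset_trans[OF xI sub] J(2) by (simp_all add: image_image)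
  have "n i = 0" if n: "lincomb G (case_sum x y) n (I <+> J) = \<one>" and i: "i \<in> I <+> J" for n i
  proof -
    let ?a = "lincomb G x (n \<circ> Inl) I" and ?b = "lincomb G y (n \<circ> Inr) J"
    have ab: "?a \<in> carrier N" "?b \<in> carrier G"
      using ker_lincomb[OF xI fin(1), of "n \<circ> Inl"] ker.lincomb_closed[OF xI, of "n \<circ> Inl"]
        dom.lincomb_closed[OF J(2)] by simp_all
    have "lincomb G (case_sum x y) n (I <+> J)
      = lincomb G (case_sum x y) n (Inl ` I) \<otimes> lincomb G (case_sum x y) n (Inr ` J)"
      unfolding Plus_def
      by (rule dom.lincomb_Un) (use fin c in \<open>simp_all add: image_Un Int_def\<close>, blast)
    also have "\<dots> = ?a \<otimes> ?b"
      using c by (simp add: dom.lincomb_reindex comp_def)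
    finally have ab1: "?a \<otimes> ?b = \<one>" using n by simp
    have "f (?a \<otimes> ?b) = f ?b" using ab by (auto simp: N_def kernel_def)
    with ab1 have "lincomb Q (f \<circ> y) (n \<circ> Inr) J = \<one>\<^bsub>Q\<^esub>"
      using hom_lincomb[OF J(2) fin(2)] by simp
    then have r: "\<forall>j\<in>J. n (Inr j) = 0" using J(1) by (auto simp: independent_family_def)
    then have "?b = \<one>" using J(2) by (intro dom.lincomb_zero) auto
    then have "?a = \<one>" using ab1 ab sub by auto
    then have "lincomb N x (n \<circ> Inl) I = \<one>\<^bsub>N\<^esub>"
      using ker_lincomb[OF xI fin(1)] by (simp add: N_def)
    then have "\<forall>i\<in>I. n (Inl i) = 0" using I by (auto simp: independent_family_def)
    with r i show ?thesis by auto
  qed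
  then show ?thesis
    unfolding independent_family_def Plus_def image_Un using fin Un_least[OF c] by blast
qed

text \<open>Take \<open>T1\<close> maximal with independent image. For every other \<open>t\<close>,
  maximality yields a relation between the images of \<open>t\<close> and \<open>T1\<close> with
  nonzero coefficient at \<open>t\<close>, and the same combination taken in \<open>G\<close> lies
  in the kernel. Over the integers only a multiple of \<open>t\<close> can be corrected in this way,
  so that coefficient is merely nonzero.\<close>

lemma independent_in_split:
  assumes T: "independent_in G T"
  obtains T1 u where "T1 \<subseteq> T" "independent_family Q f T1" "independent_family N u (T - T1)"
proof -
  have T': "finite T" "T \<subseteq> carrier G" "independent_family G id T"
    using T dom.independent_family_iff[of id T] by (auto simp: independent_in_def)
  let ?P = "\<lambda>S. S \<subseteq> T \<and> independent_family Q f S"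
  have "?P {}" by (simp add: independent_family_def)
  moreover have "finite {S. ?P S}" using T'(1) by (auto intro: finite_subset[of _ "Pow T"])
  ultimately obtain T1 where T1: "?P T1" and max: "\<And>S. ?P S \<Longrightarrow> T1 \<subseteq> S \<Longrightarrow> S = T1"
    using finite_has_maximal2[of "{S. ?P S}" "{}"] by (metis (mono_tags, lifting) mem_Collect_eq)
  have fin1: "finite T1" using T1 T'(1) finite_subset by blast
  have "\<exists>n. lincomb Q f n T = \<one>\<^bsub>Q\<^esub> \<and> n t \<noteq> 0 \<and> (\<forall>i\<in>T - insert t T1. n i = 0)" if t: "t \<in> T - T1" for t
  proof -
    have c: "f ` insert t T1 \<subseteq> carrier Q" "f ` T \<subseteq> carrier Q" using t T1 T' by auto
    have "\<not> independent_family Q f (insert t T1)" using max[of "insert t T1"] t T1 by auto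
    then obtain n i where n: "lincomb Q f n (insert t T1) = \<one>\<^bsub>Q\<^esub>" "i \<in> insert t T1" "n i \<noteq> 0"
      using c fin1 by (auto simp: independent_family_def)
    have "n t \<noteq> 0"
    proof
      assume "n t = 0"
      then have "lincomb Q f n T1 = \<one>\<^bsub>Q\<^esub>"
        using n(1) cod.lincomb_mono[of "insert t T1" T1 f n] c fin1 by auto
      then have "\<forall>i\<in>T1. n i = 0" using T1 by (auto simp: independent_family_def)
      with \<open>n t = 0\<close> n show False by auto
    qed
    define m where "m = (\<lambda>i. if i \<in> insert t T1 then n i else 0)"
    have "lincomb Q f m T = lincomb Q f m (insert t T1)"
      using T' T1 t c by (intro cod.lincomb_mono[symmetric]) (auto simp: m_def)
    also have "\<dots> = lincomb Q f n (insert t T1)"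
      using c by (intro cod.lincomb_cong) (auto simp: m_def)
    finally show ?thesis using n \<open>n t \<noteq> 0\<close> by (intro exI[of _ m]) (auto simp: m_def)
  qed
  then obtain n where n: "\<And>t. t \<in> T - T1 \<Longrightarrow> lincomb Q f (n t) T = \<one>\<^bsub>Q\<^esub>"
    "\<And>t. t \<in> T - T1 \<Longrightarrow> n t t \<noteq> 0" "\<And>t i. t \<in> T - T1 \<Longrightarrow> i \<in> T - insert t T1 \<Longrightarrow> n t i = 0"
    by metis
  define u where "u = (\<lambda>t. lincomb G id (n t) T)"
  have u: "u ` (T - T1) \<subseteq> carrier N"
  proof
    fix y assume "y \<in> u ` (T - T1)"
    then obtain t where "t \<in> T - T1" "y = u t" by auto
    then show "y \<in> carrier N"
      using n(1)[of t] hom_lincomb[of id T "n t"] T' dom.lincomb_closed[of id T "n t"]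
      by (auto simp: u_def N_def kernel_def)
  qed
  have "m i = 0" if m: "lincomb N u m (T - T1) = \<one>\<^bsub>N\<^esub>" and i: "i \<in> T - T1" for m i
  proof -
    have "lincomb N u m (T - T1) = lincomb G u m (T - T1)" using u T' by (intro ker_lincomb) auto
    also have "\<dots> = lincomb G id (\<lambda>j. \<Sum>t\<in>T - T1. n t j * m t) T"
      unfolding u_def using T' by (intro dom.lincomb_lincomb) auto
    finally have "lincomb G id (\<lambda>j. \<Sum>t\<in>T - T1. n t j * m t) T = \<one>" using m by (simp add: N_def)
    then have "(\<Sum>t\<in>T - T1. n t i * m t) = 0"
      using T'(3) i unfolding independent_family_def by blast
    \<comment> \<open>The corrected elements are triangular: outside \<open>T1\<close>, the element
      \<open>u t\<close> involves \<open>t\<close> alone. So the coefficient at \<open>i\<close>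
      comes from \<open>u i\<close> only.\<close>
    moreover have "(\<Sum>t\<in>T - T1. n t i * m t) = (\<Sum>t\<in>{i}. n t i * m t)"
      using i T' n(3) by (intro sum.mono_neutral_right) auto
    ultimately show ?thesis using n(2)[OF i] by simp
  qed
  then have "independent_family N u (T - T1)" using u T' by (auto simp: independent_family_def)
  with T1 that show thesis by blast
qed

lemma has_rank_kernel_image:
  assumes "has_rank N a" "has_rank Q b"
  shows "has_rank G (a + b)"
  unfolding has_rank_def
proof (intro conjI allI impI)
  obtain S R where S: "independent_in N S" "card S = a" and R: "independent_in Q R" "card R = b"
    using assms by (auto simp: has_rank_def)
  have "R \<subseteq> f ` carrier G" using R by (simp add: f_surj independent_in_def)
  then have "\<forall>r\<in>R. \<exists>x. x \<in> carrier G \<and> f x = r" by blast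
  then obtain g where g: "\<And>r. r \<in> R \<Longrightarrow> g r \<in> carrier G \<and> f (g r) = r" by metis
  have "independent_family Q id R"
    using cod.independent_family_iff[of id R] R by (auto simp: independent_in_def)
  then have "independent_family Q (f \<circ> g) R"
    using g cod.lincomb_cong[of R "f \<circ> g" id] by (auto simp: independent_family_def)
  moreover have "independent_family N id S"
    using ker.independent_family_iff[of id S] S by (auto simp: independent_in_def)
  ultimately have *: "independent_family G (case_sum id g) (S <+> R)"
    using g by (intro independent_family_lift) auto
  then have "inj_on (case_sum id g) (S <+> R)" "independent_in G (case_sum id g ` (S <+> R))"
    using dom.independent_family_iff by auto
  moreover have "finite S" "finite R" using S R by (auto simp: independent_in_def)
  ultimately show "\<exists>T. independent_in G T \<and> card T = a + b"
    using S R by (intro exI[of _ "case_sum id g ` (S <+> R)"]) (simp add: card_image card_Plus)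
next
  fix T assume "independent_in G T"
  then obtain T1 u where T1: "T1 \<subseteq> T" "independent_family Q f T1" "independent_family N u (T - T1)"
    by (rule independent_in_split)
  have "finite T" using \<open>independent_in G T\<close> by (auto simp: independent_in_def)
  have "card T1 \<le> b" "card (T - T1) \<le> a"
    using T1 assms cod.independent_family_iff[of f T1] ker.independent_family_iff[of u "T - T1"]
    by (auto simp: has_rank_def dest!: card_image)
  then show "card T \<le> a + b"
    using T1 \<open>finite T\<close> by (simp add: card_Diff_subset finite_subset)
qed

text \<open>Lifting with an empty family on one side shows that independent sets of the kernel and
  of the image are no larger than \<open>r\<close>, so both ranks exist. The type
  \<open>unit\<close> merely gives the empty index set a type.\<close>

lemma has_rank_kernel_image_exist:
  assumes "has_rank G r"
  obtains a b where "has_rank N a" "has_rank Q b" "r = a + b"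
proof -
  have e: "independent_family N (\<lambda>_. undefined) ({} :: unit set)"
    "independent_family Q (f \<circ> (\<lambda>_. undefined)) ({} :: unit set)"
    by (auto simp: independent_family_def)
  have N: "card S \<le> r" if "independent_in N S" for S
  proof -
    have S: "independent_family N id S"
      using ker.independent_family_iff[of id S] that by (auto simp: independent_in_def)
    have "independent_family G (case_sum id (\<lambda>_. undefined)) (S <+> ({} :: unit set))"
      using S e by (intro independent_family_lift) auto
    then have "inj_on (case_sum id (\<lambda>_. undefined)) (S <+> ({} :: unit set))"
      "independent_in G (case_sum id (\<lambda>_. undefined) ` (S <+> ({} :: unit set)))"
      using dom.independent_family_iff by blast+
    then have "card (S <+> ({} :: unit set)) \<le> r"
      using assms by (metis card_image has_rank_def)
    then show ?thesis using that by (simp add: card_Plus independent_in_def)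
  qed
  have Q: "card R \<le> r" if R: "independent_in Q R" for R
  proof -
    have "R \<subseteq> f ` carrier G" using R by (simp add: f_surj independent_in_def)
    then have "\<forall>r\<in>R. \<exists>x. x \<in> carrier G \<and> f x = r" by blast
    then obtain g where g: "\<And>r. r \<in> R \<Longrightarrow> g r \<in> carrier G \<and> f (g r) = r" by metis
    have "independent_family Q id R"
      using cod.independent_family_iff[of id R] R by (auto simp: independent_in_def)
    then have "independent_family Q (f \<circ> g) R"
      using g cod.lincomb_cong[of R "f \<circ> g" id] by (auto simp: independent_family_def)
    then have "independent_family G (case_sum (\<lambda>_. undefined) g) (({} :: unit set) <+> R)"
      using g e by (intro independent_family_lift) auto
    then have "inj_on (case_sum (\<lambda>_. undefined) g) (({} :: unit set) <+> R)"
      "independent_in G (case_sum (\<lambda>_. undefined) g ` (({} :: unit set) <+> R))"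
      using dom.independent_family_iff by blast+
    then have "card (({} :: unit set) <+> R) \<le> r"
      using assms by (metis card_image has_rank_def)
    then show ?thesis using that by (simp add: card_Plus independent_in_def)
  qed
  obtain a b where ab: "has_rank N a" "has_rank Q b"
    using has_rank_exists[of N r] has_rank_exists[of Q r] N Q by metis
  then have "r = a + b" using has_rank_kernel_image assms has_rank_rk by metis
  with ab that show thesis by blast
qed

end

section \<open>Ranks of free groups and of homology groups\<close>

lemma frag_eq_singleton:
  assumes "Poly_Mapping.keys z \<subseteq> {a}"
  shows "z = frag_cmul (Poly_Mapping.lookup z a) (frag_of a)"
proof (rule poly_mapping_eqI)
  fix b
  show "Poly_Mapping.lookup z b = Poly_Mapping.lookup (frag_cmul (Poly_Mapping.lookup z a) (frag_of a)) b"
  proof (cases "b = a")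
    case False
    then have "b \<notin> Poly_Mapping.keys z" using assms by auto
    then show ?thesis using False by (simp add: in_keys_iff)
  qed simp
qed

text \<open>Induction on the generators: the coefficient of the new generator maps onto an infinite
  cyclic group, and the kernel is free on the old generators.\<close>

lemma has_rank_free_Abelian_group:
  assumes "finite S"
  shows "has_rank (free_Abelian_group S) (card S)"
  using assms
proof (induction S)
  case empty
  interpret comm_group "free_Abelian_group {}" by (rule abelian_free_Abelian_group)
  have "T = {}" if T: "independent_in (free_Abelian_group {}) T" for T :: "('a \<Rightarrow>\<^sub>0 int) set"
  proof (rule ccontr)
    assume "T \<noteq> {}"
    have z: "x = 0" if "x \<in> T" for x using T that by (auto simp: independent_in_def)
    have "finprod (free_Abelian_group {}) (\<lambda>x. x [^]\<^bsub>free_Abelian_group {}\<^esub> (1::int)) T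
      = \<one>\<^bsub>free_Abelian_group {}\<^esub>"
      by (intro finprod_one_eqI) (auto dest: z)
    then show False using T \<open>T \<noteq> {}\<close> by (force simp: independent_in_def)
  qed
  moreover have "independent_in (free_Abelian_group {}) {}" by (simp add: independent_in_def)
  ultimately show ?case unfolding has_rank_def by (metis card.empty order_refl)
next
  case (insert a S)
  let ?Z = "free_Abelian_group {a}"
  interpret Z: comm_group ?Z by (rule abelian_free_Abelian_group)
  have rank1: "has_rank ?Z 1"
    unfolding has_rank_def
  proof (intro conjI allI impI)
    have "lincomb ?Z id n {frag_of a} = frag_cmul (n (frag_of a)) (frag_of a)" for n
      by (subst Z.lincomb_singleton) simp_all
    then have "independent_family ?Z id {frag_of a}" by (simp add: independent_family_def)
    then show "\<exists>T. independent_in ?Z T \<and> card T = 1"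
      using Z.independent_family_iff[of id] by (intro exI[of _ "{frag_of a}"]) auto
  next
    fix T assume T: "independent_in ?Z T"
    then have T': "finite T" "T \<subseteq> carrier ?Z" by (simp_all add: independent_in_def)
    then have keys: "Poly_Mapping.keys x \<subseteq> {a}" if "x \<in> T" for x
      using subsetD[OF T'(2) that] by simp
    have ind: "independent_family ?Z id T"
      using T T' by (simp add: Z.independent_family_iff)
    have "x = y" if xy: "x \<in> T" "y \<in> T" for x y
    proof (rule ccontr)
      assume ne: "x \<noteq> y"
      let ?l = "\<lambda>x. Poly_Mapping.lookup x a"
      \<comment> \<open>Multiples \<open>p a\<close> and \<open>q a\<close> of one generator satisfy
        \<open>q (p a) - p (q a) = 0\<close>. Independence then gives \<open>p = q = 0\<close>, so
        the two elements would be equal.\<close>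
      define n where "n = (\<lambda>z. if z = x then ?l y else if z = y then - ?l x else 0)"
      have "lincomb ?Z id n T = lincomb ?Z id n {x, y}"
        using xy T' by (intro Z.lincomb_mono[symmetric]) (simp_all add: n_def)
      also have "\<dots> = frag_cmul (?l y) x + frag_cmul (- ?l x) y"
        using keys[OF xy(1)] keys[OF xy(2)] ne
        by (subst Z.lincomb_insert) (simp_all add: Z.lincomb_singleton n_def)
      also have "\<dots> = frag_cmul (?l y) (frag_cmul (?l x) (frag_of a))
          + frag_cmul (- ?l x) (frag_cmul (?l y) (frag_of a))"
        using frag_eq_singleton[OF keys[OF xy(1)]] frag_eq_singleton[OF keys[OF xy(2)]] by metis
      also have "\<dots> = 0" by (simp flip: frag_cmul_distrib)
      finally have "lincomb ?Z id n T = \<one>\<^bsub>?Z\<^esub>" by simp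
      then have "n x = 0" "n y = 0" using ind xy unfolding independent_family_def by blast+
      then have l: "?l x = 0" "?l y = 0" using ne by (simp_all add: n_def)
      have "x = y"
        using frag_eq_singleton[OF keys[OF xy(1)]] frag_eq_singleton[OF keys[OF xy(2)]] l by metis
      with ne show False ..
    qed
    then show "card T \<le> 1" using T'(1) card_le_Suc0_iff_eq[of T] by simp
  qed
  let ?f = "\<lambda>z. frag_cmul (Poly_Mapping.lookup z a) (frag_of a)"
  interpret epimorphism "free_Abelian_group (insert a S)" ?Z ?f
    "free_Abelian_group (insert a S)\<lparr>carrier := kernel (free_Abelian_group (insert a S)) ?Z ?f\<rparr>"
  proof (intro epimorphism.intro epimorphism_axioms.intro abelian_free_Abelian_group)
    show "?f \<in> hom (free_Abelian_group (insert a S)) ?Z"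
      by (intro homI) (simp_all add: lookup_add frag_cmul_distrib subset_iff)
    show "?f ` carrier (free_Abelian_group (insert a S)) = carrier ?Z"
    proof
      show "carrier ?Z \<subseteq> ?f ` carrier (free_Abelian_group (insert a S))"
      proof
        fix z assume "z \<in> carrier ?Z"
        then have z: "Poly_Mapping.keys z \<subseteq> {a}" by simp
        then have "Poly_Mapping.keys z \<subseteq> insert a S" by blast
        then show "z \<in> ?f ` carrier (free_Abelian_group (insert a S))"
          using frag_eq_singleton[OF z] by (intro image_eqI[of _ _ z]) simp_all
      qed
      have "Poly_Mapping.keys (?f z) \<subseteq> {a}" for z
        using keys_cmul[of "Poly_Mapping.lookup z a" "frag_of a"] by (simp only: keys_frag_of)
      then show "?f ` carrier (free_Abelian_group (insert a S)) \<subseteq> carrier ?Z"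
        unfolding image_subset_iff carrier_free_Abelian_group_iff by blast
    qed
  qed
  have "kernel (free_Abelian_group (insert a S)) ?Z ?f = {z. Poly_Mapping.keys z \<subseteq> S}"
  proof -
    have "Poly_Mapping.keys z \<subseteq> S \<longleftrightarrow> Poly_Mapping.keys z \<subseteq> insert a S \<and> Poly_Mapping.lookup z a = 0" for z :: "'a \<Rightarrow>\<^sub>0 int"
      using insert(2) unfolding not_in_keys_iff_lookup_eq_zero[symmetric] by blast
    then show ?thesis by (simp add: kernel_def)
  qed
  then have "free_Abelian_group (insert a S)\<lparr>carrier := kernel (free_Abelian_group (insert a S)) ?Z ?f\<rparr>
    = free_Abelian_group S"
    by (simp add: free_Abelian_group_def)
  then have "has_rank (free_Abelian_group (insert a S)) (card S + 1)"
    using has_rank_kernel_image[OF _ rank1] insert(3) by metis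
  then show ?case using insert(1,2) by simp
qed

text \<open>The projection onto the cosets has kernel \<open>I\<close>, so the rank of
  \<open>K\<close> splits; torsion in the quotient does not disturb this.\<close>

lemma (in comm_group) has_rank_subquotient:
  assumes "subgroup K G" "subgroup I G" "I \<subseteq> K" "has_rank (G\<lparr>carrier := K\<rparr>) r"
  obtains b h where "has_rank (G\<lparr>carrier := I\<rparr>) b" "has_rank (G\<lparr>carrier := K\<rparr> Mod I) h" "r = b + h"
proof -
  let ?K = "G\<lparr>carrier := K\<rparr>"
  interpret K: comm_group ?K using assms(1) by (rule subgroup_is_comm_group)
  have I: "subgroup I ?K" using assms by (simp add: subgroup_incl)
  then interpret I: normal I ?K by (rule K.subgroup_imp_normal)
  interpret Q: comm_group "?K Mod I" using I by (rule K.abelian_FactGroup)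
  interpret epimorphism ?K "?K Mod I" "(#>\<^bsub>?K\<^esub>) I" "?K\<lparr>carrier := kernel ?K (?K Mod I) ((#>\<^bsub>?K\<^esub>) I)\<rparr>"
  proof (intro epimorphism.intro epimorphism_axioms.intro K.comm_group_axioms Q.comm_group_axioms)
    show "(#>\<^bsub>?K\<^esub>) I \<in> hom ?K (?K Mod I)" by (rule I.r_coset_hom_Mod)
    show "(#>\<^bsub>?K\<^esub>) I ` carrier ?K = carrier (?K Mod I)"
      by (auto simp: FactGroup_def RCOSETS_def)
  qed
  have "kernel ?K (?K Mod I) ((#>\<^bsub>?K\<^esub>) I) = I"
    using K.coset_join1[OF _ _ I] K.coset_join2[OF _ I] subgroup.subset[OF I]
    by (auto simp: kernel_def FactGroup_def)
  then show thesis using has_rank_kernel_image_exist[OF assms(4)] that by auto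
qed

lemma rank_nullity:
  assumes "comm_group G" "comm_group Q" "d \<in> hom G Q" "has_rank G s"
  obtains a b where "has_rank (G\<lparr>carrier := kernel G Q d\<rparr>) a" "has_rank (Q\<lparr>carrier := d ` carrier G\<rparr>) b" "s = a + b"
proof -
  interpret dQ: group_hom G Q d
    using assms by (auto simp: group_hom_def group_hom_axioms_def comm_group_def)
  let ?I = "Q\<lparr>carrier := d ` carrier G\<rparr>"
  interpret epimorphism G ?I d "G\<lparr>carrier := kernel G ?I d\<rparr>"
    using assms comm_group.subgroup_is_comm_group[OF assms(2) dQ.img_is_subgroup]
    by (intro epimorphism.intro epimorphism_axioms.intro) (auto simp: hom_def)
  have "kernel G ?I d = kernel G Q d" by (simp add: kernel_def)
  then show ?thesis using has_rank_kernel_image_exist[OF assms(4)] that by metis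
qed

text \<open>Let \<open>a\<close> denote ranks of cycles and \<open>b\<close> ranks of boundaries.
  Then \<open>r0 = a0 + b1\<close> and \<open>r1 = a1 + b0\<close>, while the homology has ranks
  \<open>a0 - b0\<close> and \<open>a1 - b1\<close>; each boundary rank enters both differences with
  the same sign. The inequalities serve to keep the homology in finitely many degrees.\<close>

lemma rk_homology:
  fixes G0 :: "('b, 'm) monoid_scheme" and G1 :: "('c, 'n) monoid_scheme"
  assumes G0: "comm_group G0" and G1: "comm_group G1"
    and d0: "d0 \<in> hom G0 G1" and d1: "d1 \<in> hom G1 G0"
    and d10: "\<And>x. x \<in> carrier G0 \<Longrightarrow> d1 (d0 x) = \<one>\<^bsub>G0\<^esub>"
    and d01: "\<And>x. x \<in> carrier G1 \<Longrightarrow> d0 (d1 x) = \<one>\<^bsub>G1\<^esub>"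
    and r: "has_rank G0 r0" "has_rank G1 r1"
  shows "rk (G0\<lparr>carrier := kernel G0 G1 d0\<rparr> Mod d1 ` carrier G1) \<le> r0"
    and "rk (G1\<lparr>carrier := kernel G1 G0 d1\<rparr> Mod d0 ` carrier G0) \<le> r1"
    and "int (rk (G0\<lparr>carrier := kernel G0 G1 d0\<rparr> Mod d1 ` carrier G1))
      - int (rk (G1\<lparr>carrier := kernel G1 G0 d1\<rparr> Mod d0 ` carrier G0)) = int r0 - int r1"
proof -
  interpret h0: group_hom G0 G1 d0
    using assms by (auto simp: group_hom_def group_hom_axioms_def comm_group_def)
  interpret h1: group_hom G1 G0 d1
    using assms by (auto simp: group_hom_def group_hom_axioms_def comm_group_def)
  obtain a0 b1 where 0: "has_rank (G0\<lparr>carrier := kernel G0 G1 d0\<rparr>) a0"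
      "has_rank (G1\<lparr>carrier := d0 ` carrier G0\<rparr>) b1" "r0 = a0 + b1"
    by (rule rank_nullity[OF G0 G1 d0 r(1)])
  obtain a1 b0 where 1: "has_rank (G1\<lparr>carrier := kernel G1 G0 d1\<rparr>) a1"
      "has_rank (G0\<lparr>carrier := d1 ` carrier G1\<rparr>) b0" "r1 = a1 + b0"
    by (rule rank_nullity[OF G1 G0 d1 r(2)])
  obtain b0' c0 where 2: "has_rank (G0\<lparr>carrier := d1 ` carrier G1\<rparr>) b0'"
      "has_rank (G0\<lparr>carrier := kernel G0 G1 d0\<rparr> Mod d1 ` carrier G1) c0" "a0 = b0' + c0"
    by (rule comm_group.has_rank_subquotient[OF G0 h0.subgroup_kernel h1.img_is_subgroup _ 0(1)])
      (use d01 in \<open>auto simp: kernel_def\<close>)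
  obtain b1' c1 where 3: "has_rank (G1\<lparr>carrier := d0 ` carrier G0\<rparr>) b1'"
      "has_rank (G1\<lparr>carrier := kernel G1 G0 d1\<rparr> Mod d0 ` carrier G0) c1" "a1 = b1' + c1"
    by (rule comm_group.has_rank_subquotient[OF G1 h1.subgroup_kernel h0.img_is_subgroup _ 1(1)])
      (use d10 in \<open>auto simp: kernel_def\<close>)
  have "b0' = b0" "b1' = b1" using 0 1 2 3 has_rank_rk by metis+
  then show "rk (G0\<lparr>carrier := kernel G0 G1 d0\<rparr> Mod d1 ` carrier G1) \<le> r0"
    "rk (G1\<lparr>carrier := kernel G1 G0 d1\<rparr> Mod d0 ` carrier G0) \<le> r1"
    "int (rk (G0\<lparr>carrier := kernel G0 G1 d0\<rparr> Mod d1 ` carrier G1))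
      - int (rk (G1\<lparr>carrier := kernel G1 G0 d1\<rparr> Mod d0 ` carrier G0)) = int r0 - int r1"
    using 0(3) 1(3) 2(3) 3(3) has_rank_rk[OF 2(2)] has_rank_rk[OF 3(2)] by simp_all
qed



section \<open>Circles as orbits\<close>

definition graph_of :: "('a \<Rightarrow> 'a) \<Rightarrow> ('a \<times> 'a) set" where
  "graph_of f = {(x, f x) | x. True}"

lemma permutation_funpow_self:
  assumes "permutation f"
  obtains n where "0 < n" "(f ^^ n) a = a"
proof -
  have "a \<in> {(f ^^ n) a | n. 0 < n}"
    using permutation_self_in_orbit[OF assms, of a] by (simp only: orbit_altdef)
  then obtain n where "a = (f ^^ n) a" "0 < n" by blast
  then show thesis by (metis that)
qed

text \<open>Orbits are finite cycles, so a step backwards can be replaced by steps forwards, and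
  undirected connection is the same as directed connection.\<close>

lemma connected_iff_funpow:
  assumes "permutation f"
  shows "(a, b) \<in> (graph_of f \<union> (graph_of f)\<inverse>)\<^sup>* \<longleftrightarrow> (\<exists>n. (f ^^ n) a = b)"
proof
  assume "\<exists>n. (f ^^ n) a = b"
  then obtain n where "(f ^^ n) a = b" ..
  then show "(a, b) \<in> (graph_of f \<union> (graph_of f)\<inverse>)\<^sup>*"
  proof (induction n arbitrary: b)
    case (Suc n)
    then have "(a, (f ^^ n) a) \<in> (graph_of f \<union> (graph_of f)\<inverse>)\<^sup>*" by simp
    moreover have "((f ^^ n) a, b) \<in> graph_of f" using Suc(2) by (auto simp: graph_of_def)
    ultimately show ?case by (meson UnI1 rtrancl.rtrancl_into_rtrancl)
  qed simp
next
  assume "(a, b) \<in> (graph_of f \<union> (graph_of f)\<inverse>)\<^sup>*"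
  then show "\<exists>n. (f ^^ n) a = b"
  proof induction
    case base
    show ?case by (rule exI[of _ 0]) simp
  next
    case (step y z)
    then obtain n where n: "(f ^^ n) a = y" by blast
    from step(2) consider "z = f y" | "y = f z" by (auto simp: graph_of_def)
    then show ?case
    proof cases
      case 1
      then show ?thesis using n by (intro exI[of _ "Suc n"]) simp
    next
      case 2
      have inj: "inj f" using assms by (simp add: permutation_bijective bij_is_inj)
      \<comment> \<open>Going back from \<open>y\<close> requires a positive number of steps; if
        \<open>y\<close> is \<open>a\<close> itself, a full period supplies them.\<close>
      obtain m where m: "(f ^^ Suc m) a = y"
      proof (cases n)
        case 0
        obtain j where "0 < j" "(f ^^ j) a = a" using assms by (rule permutation_funpow_self)
        then show thesis using that[of "j - 1"] n 0 by simp
      qed (use n that in simp)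
      then have "f ((f ^^ m) a) = f z" using 2 by simp
      then show ?thesis using inj by (auto dest: injD)
    qed
  qed
qed

text \<open>The new permutation leaves \<open>a\<close> along the old orbit of \<open>b\<close>. If
  \<open>a\<close> is not on this orbit, the walk runs through it and arrives at \<open>b\<close>;
  if \<open>a\<close> is on it, the walk comes back to \<open>a\<close> first and closes up without
  meeting \<open>b\<close>.\<close>

lemma transposition_connects:
  assumes f: "permutation f" and ab: "a \<noteq> b"
    and f': "f' = f \<circ> transpose a b"
  shows "(a, b) \<in> (graph_of f \<union> (graph_of f)\<inverse>)\<^sup>* \<longleftrightarrow> (a, b) \<notin> (graph_of f' \<union> (graph_of f')\<inverse>)\<^sup>*"
proof -
  have "permutation f'" unfolding f' using f permutation_swap_id by (rule permutation_compose)
  note iff = connected_iff_funpow[OF f] connected_iff_funpow[OF this]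
  have f'_simps: "f' a = f b" "\<And>x. x \<noteq> a \<Longrightarrow> x \<noteq> b \<Longrightarrow> f' x = f x"
    by (auto simp: f' transpose_def)
  have sym: "(x, y) \<in> (graph_of f \<union> (graph_of f)\<inverse>)\<^sup>* \<Longrightarrow> (y, x) \<in> (graph_of f \<union> (graph_of f)\<inverse>)\<^sup>*" for x y
    by (rule symD[OF sym_rtrancl[OF sym_Un_converse]])
  show ?thesis
  proof (cases "(a, b) \<in> (graph_of f \<union> (graph_of f)\<inverse>)\<^sup>*")
    case False
    obtain n where "0 < n" "(f ^^ n) b = b" using f by (rule permutation_funpow_self)
    then have n: "0 < n \<and> (f ^^ n) b = b" ..
    \<comment> \<open>The first return time of \<open>b\<close>: before it, the walk meets neither
      \<open>a\<close> nor \<open>b\<close>, so old and new permutation agree along it.\<close>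
    define m where "m = (LEAST n. 0 < n \<and> (f ^^ n) b = b)"
    have m: "0 < m \<and> (f ^^ m) b = b" unfolding m_def by (rule LeastI) (rule n)
    have min: "\<not> (0 < j \<and> (f ^^ j) b = b)" if "j < m" for j
      using that unfolding m_def by (rule not_less_Least)
    have nota: "(f ^^ j) b \<noteq> a" for j
      using False sym[of b a] iff(1)[of b a] by blast
    have "(f' ^^ Suc j) a = (f ^^ Suc j) b" if "j < m" for j
      using that
    proof (induction j)
      case (Suc j)
      then have "(f' ^^ Suc j) a = (f ^^ Suc j) b" "(f ^^ Suc j) b \<noteq> b" using min[of "Suc j"] by auto
      then show ?case using f'_simps(2)[of "(f ^^ Suc j) b"] nota[of "Suc j"] by simp
    qed (simp add: f'_simps)
    from this[of "m - 1"] have "(f' ^^ m) a = b" using m by simp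
    then show ?thesis using False iff(2) by blast
  next
    case True
    then obtain n where n: "(f ^^ n) b = a" using sym iff(1) by blast
    define m where "m = (LEAST n. (f ^^ n) b = a)"
    have m: "(f ^^ m) b = a" unfolding m_def by (rule LeastI) (rule n)
    have min: "(f ^^ j) b \<noteq> a" if "j < m" for j
      using that unfolding m_def by (rule not_less_Least)
    have "0 < m" using m ab by (cases m) auto
    have notb: "(f ^^ j) b \<noteq> b" if "0 < j" "j \<le> m" for j
    proof
      assume j: "(f ^^ j) b = b"
      have "(f ^^ m) b = (f ^^ (m - j)) ((f ^^ j) b)"
        using that funpow_add[of "m - j" j f] by simp
      then have "(f ^^ (m - j)) b = a" unfolding j m by simp
      then show False using min[of "m - j"] that by simp
    qed
    \<comment> \<open>Invariant: the new orbit of \<open>a\<close> stays on the old path from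
      \<open>f b\<close> to the first visit of \<open>a\<close>. At the end of this path,
      \<open>j = m\<close>, the walk is at \<open>a\<close> and jumps back to
      \<open>j = 1\<close>.\<close>
    have steps: "\<exists>j. 0 < j \<and> j \<le> m \<and> (f' ^^ i) a = (f ^^ j) b" for i
    proof (induction i)
      case 0
      then show ?case using m \<open>0 < m\<close> by auto
    next
      case (Suc i)
      then obtain j where j: "0 < j" "j \<le> m" "(f' ^^ i) a = (f ^^ j) b" by blast
      show ?case
      proof (cases "j = m")
        case True
        then show ?thesis using j m f'_simps(1) \<open>0 < m\<close> by (intro exI[of _ 1]) simp
      next
        case False
        then have "f' ((f ^^ j) b) = f ((f ^^ j) b)"
          using j min[of j] notb[of j] by (intro f'_simps) auto
        then show ?thesis using j False by (intro exI[of _ "Suc j"]) simp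
      qed
    qed
    have "(f' ^^ i) a \<noteq> b" for i
    proof -
      obtain j where "0 < j" "j \<le> m" "(f' ^^ i) a = (f ^^ j) b" using steps[of i] by blast
      then show ?thesis using notb by simp
    qed
    then show ?thesis using True iff(2) by blast
  qed
qed

section \<open>The flow along the circles of a coloured diagram\<close>

definition sim :: "'a diagram \<Rightarrow> state \<Rightarrow> ('a \<times> 'a) set" where
  "sim D s = {(x, y). x \<in> arcs D \<and> y \<in> arcs D \<and>
     (x, y) \<in> ((\<Union>k<length (crossings D). splitting (k \<in> s) (crossings D ! k)) \<union>
       (\<Union>k<length (crossings D). splitting (k \<in> s) (crossings D ! k))\<inverse>)\<^sup>*}"

lemma circles_eq_quotient: "circles D s = arcs D // sim D s"
  by (simp add: circles_def rel_classes_def sim_def)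

lemma equiv_sim: "equiv (arcs D) (sim D s)"
proof (rule equivI)
  show "refl_on (arcs D) (sim D s)" by (auto simp: refl_on_def sim_def)
  show "sym (sim D s)"
    using symD[OF sym_rtrancl[OF sym_Un_converse]] by (auto simp: sym_def sim_def)
  show "trans (sim D s)" unfolding trans_def sim_def by (auto intro: rtrancl_trans)
  show "sim D s \<subseteq> arcs D \<times> arcs D" by (auto simp: sim_def)
qed

abbreviation end_arc :: "'a diagram \<Rightarrow> nat \<Rightarrow> nat \<Rightarrow> 'a" where
  "end_arc D k i \<equiv> fst (ends (crossings D ! k) ! i)"

locale coloured_diagram = link_diagram D for D :: "'a diagram" +
  fixes T
  assumes face_set: "T \<in> face_sets" and boundary: "boundary T = arcs D"
begin

lemma side_colours: "a \<in> arcs D \<Longrightarrow> (a, True) \<in> T \<longleftrightarrow> (a, False) \<notin> T"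
  using boundary unfolding boundary_def by blast

text \<open>
  Orienting every arc so that a coloured face is on its left makes the ends at a crossing
  alternate between outgoing and incoming ones, so both splittings respect this orientation.
\<close>

definition colour :: "nat \<Rightarrow> bool" where
  "colour k \<longleftrightarrow> (over_out (crossings D ! k), True) \<in> T"

text \<open>A source is an end at which the recoloured orientation enters the crossing, a target one
  at which it leaves. The Booleans are chosen so that the \<open>A\<close>-splitting joins equal
  ones and the \<open>B\<close>-splitting opposite ones, whatever \<open>colour k\<close>
  is.\<close>

definition source :: "nat \<times> bool \<Rightarrow> 'a" where
  "source = (\<lambda>(k, b). end_arc D k (if colour k then if b then 1 else 3 else if b then 2 else 0))"

definition target :: "nat \<times> bool \<Rightarrow> 'a" where
  "target = (\<lambda>(k, b). end_arc D k (if colour k then if b then 2 else 0 else if b then 1 else 3))"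

text \<open>A corner passes the colour of an end to the far side of the next arc, and the two sides
  of an arc have different colours; hence the alternation in \<open>i\<close>. Membership of an end
  in \<open>T\<close> means that its arc leaves the crossing in the orientation by colours.\<close>

lemma ends_coloured:
  assumes "k < n_crossings" "i < 4"
  shows "ends (crossings D ! k) ! i \<in> T \<longleftrightarrow> (colour k \<longleftrightarrow> even i)"
proof -
  have mem: "over_out (crossings D ! k) \<in> arcs D" "under_out (crossings D ! k) \<in> arcs D"
    "over_in (crossings D ! k) \<in> arcs D" "under_in (crossings D ! k) \<in> arcs D"
    using out_arcs_subset[OF assms(1)] in_arcs_subset[OF assms(1)] crossing_arcs_subset
    by (auto simp: out_arcs_def in_arcs_def)
  note sides = side_colours[OF mem(1)] side_colours[OF mem(2)] side_colours[OF mem(3)] side_colours[OF mem(4)]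
  consider "i = 0" | "i = 1" | "i = 2" | "i = 3" using assms(2) by linarith
  note i = this
  show ?thesis
  proof (cases "positive (crossings D ! k)")
    case True
    show ?thesis
      using i face_sets_positive[OF face_set assms(1) True] sides True
      by cases (simp_all add: ends_def colour_def, argo?)
  next
    case False
    show ?thesis
      using i face_sets_negative[OF face_set assms(1) False] sides False
      by cases (simp_all add: ends_def colour_def, argo?)
  qed
qed

lemma source_target_end:
  assumes "k < n_crossings"
  shows "\<exists>d. (source (k, b), d) \<in> set (ends (crossings D ! k)) - T"
    and "\<exists>d. (target (k, b), d) \<in> set (ends (crossings D ! k)) \<inter> T"
proof -
  have *: "\<exists>d. (end_arc D k i, d) \<in> set (ends (crossings D ! k)) \<and> ((end_arc D k i, d) \<in> T \<longleftrightarrow> (colour k \<longleftrightarrow> even i))"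
    if "i < 4" for i
    using ends_coloured[OF assms that] nth_mem[of i "ends (crossings D ! k)"] that length_ends[of "crossings D ! k"]
    by (intro exI[of _ "snd (ends (crossings D ! k) ! i)"]) simp
  show "\<exists>d. (source (k, b), d) \<in> set (ends (crossings D ! k)) - T"
    using *[of 0] *[of 1] *[of 2] *[of 3] by (cases "colour k"; cases b) (simp_all add: source_def)
  show "\<exists>d. (target (k, b), d) \<in> set (ends (crossings D ! k)) \<inter> T"
    using *[of 0] *[of 1] *[of 2] *[of 3] by (cases "colour k"; cases b) (simp_all add: target_def)
qed

lemma end_mem_arcs: "k < n_crossings \<Longrightarrow> (a, d) \<in> set (ends (crossings D ! k)) \<Longrightarrow> a \<in> crossing_arcs D \<and> a \<in> arcs D"
  using out_arcs_subset[of k] in_arcs_subset[of k] crossing_arcs_subset by (auto simp: set_ends_nth)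

lemma end_crossing_unique:
  assumes "k < n_crossings" "l < n_crossings"
    "(a, d) \<in> set (ends (crossings D ! k))" "(a, d) \<in> set (ends (crossings D ! l))"
  shows "k = l"
  using assms out_arcs_disjoint[of k l] in_arcs_disjoint[of k l] unfolding set_ends_nth by blast

lemma colour_unique:
  assumes "a \<in> arcs D" "((a, d) \<in> T) = ((a, d') \<in> T)"
  shows "d = d'"
  using side_colours[OF assms(1)] assms(2) by (cases d; cases d') auto

text \<open>Opposite ends belong to one strand, one incoming and one outgoing, and have equal
  colour. If they lay on the same arc, both sides of this arc would have the same colour.\<close>

lemma opposite_ends_neq:
  assumes "k < n_crossings"
  shows "source (k, True) \<noteq> source (k, False)" "target (k, True) \<noteq> target (k, False)"
proof -
  have *: "end_arc D k i \<noteq> end_arc D k (i + 2)" if "i < 2" for i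
  proof
    assume eq: "end_arc D k i = end_arc D k (i + 2)"
    let ?e = "ends (crossings D ! k)"
    have "?e ! i \<in> set ?e" using that length_ends[of "crossings D ! k"] by simp
    then have "end_arc D k i \<in> arcs D" using end_mem_arcs[OF assms] by (metis prod.collapse)
    moreover have "?e ! i \<in> T \<longleftrightarrow> ?e ! (i + 2) \<in> T"
      using ends_coloured[OF assms, of i] ends_coloured[OF assms, of "i + 2"] that by simp
    ultimately have "snd (?e ! i) = snd (?e ! (i + 2))"
      using colour_unique[of "end_arc D k i" "snd (?e ! i)" "snd (?e ! (i + 2))"] eq by (metis prod.collapse)
    moreover have "snd (?e ! i) \<noteq> snd (?e ! (i + 2))"
      using that by (auto simp: ends_def less_2_cases_iff)
    ultimately show False by simp
  qed
  have "end_arc D k 0 \<noteq> end_arc D k 2" using *[of 0] by (simp add: numeral_2_eq_2)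
  moreover have "end_arc D k 1 \<noteq> end_arc D k 3" using *[of 1] by (simp add: numeral_3_eq_3)
  ultimately show "source (k, True) \<noteq> source (k, False)" "target (k, True) \<noteq> target (k, False)"
    by (simp_all add: source_def target_def not_sym)
qed

abbreviation markings :: "(nat \<times> bool) set" where
  "markings \<equiv> {..<n_crossings} \<times> UNIV"

text \<open>An arc and a colour determine which end of the arc is meant, and an end determines its
  crossing; this is injectivity. Surjectivity follows by counting, since two arcs leave each
  crossing.\<close>

lemma bij_source: "bij_betw source markings (crossing_arcs D)"
  and bij_target: "bij_betw target markings (crossing_arcs D)"
proof -
  have inj: "inj_on g markings" and sub: "g ` markings \<subseteq> crossing_arcs D"
    if g: "\<And>k b. k < n_crossings \<Longrightarrow> \<exists>d. (g (k, b), d) \<in> set (ends (crossings D ! k)) \<and> (((g (k, b), d) \<in> T) = u)"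
      and neq: "\<And>k. k < n_crossings \<Longrightarrow> g (k, True) \<noteq> g (k, False)" for g u
  proof -
    show "inj_on g markings"
    proof (rule inj_onI)
      fix x y assume "x \<in> markings" "y \<in> markings" "g x = g y"
      moreover obtain k b l b' where xy: "x = (k, b)" "y = (l, b')" by (cases x; cases y)
      ultimately have kl: "k \<in> {..<n_crossings}" "l \<in> {..<n_crossings}" "g (k, b) = g (l, b')" by auto
      obtain d where d: "(g (k, b), d) \<in> set (ends (crossings D ! k))" "((g (k, b), d) \<in> T) = u"
        using g[of k b] kl by auto
      obtain d' where d': "(g (l, b'), d') \<in> set (ends (crossings D ! l))" "((g (l, b'), d') \<in> T) = u"
        using g[of l b'] kl by auto
      have "g (k, b) \<in> arcs D" using end_mem_arcs d(1) kl(1) by blast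
      then have "d = d'" using colour_unique[of "g (k, b)" d d'] d(2) d'(2) kl(3) by simp
      then have "k = l" using end_crossing_unique[of k l] d(1) d'(1) kl by simp
      moreover from this have "b = b'" using neq[of k] kl by (cases b; cases b') auto
      ultimately show "x = y" using xy by simp
    qed
    show "g ` markings \<subseteq> crossing_arcs D"
    proof
      fix y assume "y \<in> g ` markings"
      then obtain k b where k: "k < n_crossings" "y = g (k, b)" by auto
      then obtain d where "(g (k, b), d) \<in> set (ends (crossings D ! k))" using g[of k b] by auto
      then show "y \<in> crossing_arcs D" using end_mem_arcs k by blast
    qed
  qed
  have bij: "bij_betw g markings (crossing_arcs D)" if "inj_on g markings" "g ` markings \<subseteq> crossing_arcs D" for g
  proof -
    have "finite (crossing_arcs D)" using crossing_arcs_subset finite_arcs by (rule finite_subset)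
    moreover have "card (g ` markings) = card (crossing_arcs D)"
      using that(1) by (simp add: card_image card_crossing_arcs card_cartesian_product)
    ultimately show ?thesis using that card_subset_eq unfolding bij_betw_def by blast
  qed
  have src: "\<exists>d. (source (k, b), d) \<in> set (ends (crossings D ! k)) \<and> (((source (k, b), d) \<in> T) = False)"
    and trg: "\<exists>d. (target (k, b), d) \<in> set (ends (crossings D ! k)) \<and> (((target (k, b), d) \<in> T) = True)"
    if "k < n_crossings" for k b
    using source_target_end[OF that, of b] by simp_all
  show "bij_betw source markings (crossing_arcs D)"
    by (rule bij[OF inj[OF src] sub[OF src]]) (auto dest: opposite_ends_neq)
  show "bij_betw target markings (crossing_arcs D)"
    by (rule bij[OF inj[OF trg] sub[OF trg]]) (auto dest: opposite_ends_neq)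
qed

lemma source_cases:
  assumes "a \<in> crossing_arcs D"
  obtains k b where "k < n_crossings" "a = source (k, b)"
proof -
  have "a \<in> source ` markings" using assms bij_source by (simp add: bij_betw_def)
  then show thesis using that by (elim imageE SigmaE) simp
qed

text \<open>Walks along the circles, from each arc to the next one through a crossing; a marker
  \<open>B\<close> exchanges the two exits. Arcs without crossings are fixed points and so form
  circles of their own.\<close>

definition flow :: "state \<Rightarrow> 'a \<Rightarrow> 'a" where
  "flow s a = (if a \<in> crossing_arcs D
     then case the_inv_into markings source a of (k, b) \<Rightarrow> target (k, b \<noteq> (k \<in> s)) else a)"

lemma flow_source: "k < n_crossings \<Longrightarrow> flow s (source (k, b)) = target (k, b \<noteq> (k \<in> s))"
  using bij_source by (auto simp: flow_def bij_betw_def the_inv_into_f_f)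

lemma permutation_flow: "permutation (flow s)"
proof -
  define h where "h = (\<lambda>(k, b). (k, b \<noteq> (k \<in> s)))"
  have "bij_betw h markings markings"
    by (rule bij_betw_byWitness[of _ h]) (auto simp: h_def)
  moreover have "bij_betw (the_inv_into markings source) (crossing_arcs D) markings"
    using bij_source by (rule bij_betw_the_inv_into)
  ultimately have "bij_betw (target \<circ> (h \<circ> the_inv_into markings source)) (crossing_arcs D) (crossing_arcs D)"
    using bij_target by (blast intro: bij_betw_trans)
  then have "bij_betw (flow s) (crossing_arcs D) (crossing_arcs D)"
    by (rule bij_betw_cong[THEN iffD1, rotated]) (auto simp: flow_def h_def split: prod.splits)
  then have "flow s permutes crossing_arcs D"
    by (intro bij_imp_permutes) (simp_all add: flow_def)
  moreover have "finite (crossing_arcs D)" using crossing_arcs_subset finite_arcs by (rule finite_subset)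
  ultimately show ?thesis unfolding permutation_permutes by blast
qed

lemma flow_insert:
  assumes "k < n_crossings" "k \<notin> s"
  shows "flow (insert k s) = flow s \<circ> transpose (source (k, True)) (source (k, False))"
proof
  fix a
  show "flow (insert k s) a = (flow s \<circ> transpose (source (k, True)) (source (k, False))) a"
  proof (cases "a \<in> crossing_arcs D")
    case True
    then obtain l b where l: "l < n_crossings" "a = source (l, b)" by (rule source_cases)
    show ?thesis
    proof (cases "l = k")
      case True
      then show ?thesis using l assms by (cases b) (simp_all add: flow_source)
    next
      case False
      then have "source (l, b) \<noteq> source (k, c)" for c
        using bij_source l(1) assms(1) by (auto simp: bij_betw_def inj_on_def)
      then show ?thesis using l False by (simp add: flow_source transpose_def)
    qed
  next
    case False
    moreover have "source (k, c) \<in> crossing_arcs D" for c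
      using bij_source assms(1) by (auto simp: bij_betw_def)
    ultimately have "a \<noteq> source (k, c)" for c by blast
    then have "transpose (source (k, True)) (source (k, False)) a = a"
      by (intro transpose_apply_other)
    then show ?thesis using False by (simp add: flow_def)
  qed
qed

lemma splitting_source_target:
  "splitting m (crossings D ! k) \<union> (splitting m (crossings D ! k))\<inverse>
    = {(source (k, b), target (k, b \<noteq> m)) | b. True} \<union> {(source (k, b), target (k, b \<noteq> m)) | b. True}\<inverse>"
proof -
  have ex: "{f b | b :: bool. True} = {f True, f False}" for f :: "bool \<Rightarrow> 'x" by (auto simp: ex_bool_eq)
  show ?thesis unfolding ex
    by (cases "colour k"; cases m) (auto simp: splitting_def Let_def source_def target_def)
qed

lemma sim_iff_flow:
  "sim D s = {(x, y). x \<in> arcs D \<and> y \<in> arcs D \<and> (x, y) \<in> (graph_of (flow s) \<union> (graph_of (flow s))\<inverse>)\<^sup>*}"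
proof -
  let ?S = "\<lambda>k. splitting (k \<in> s) (crossings D ! k)"
  let ?R = "\<Union>k<n_crossings. ?S k" and ?G = "graph_of (flow s)"
  let ?F = "\<lambda>k. {(source (k, b), target (k, b \<noteq> (k \<in> s))) | b. True}"
  have R: "?R \<union> ?R\<inverse> = (\<Union>k<n_crossings. ?F k) \<union> (\<Union>k<n_crossings. ?F k)\<inverse>"
  proof -
    have "?R \<union> ?R\<inverse> = (\<Union>k<n_crossings. ?S k \<union> (?S k)\<inverse>)" by auto
    also have "\<dots> = (\<Union>k<n_crossings. ?F k \<union> (?F k)\<inverse>)" by (simp only: splitting_source_target)
    also have "\<dots> = (\<Union>k<n_crossings. ?F k) \<union> (\<Union>k<n_crossings. ?F k)\<inverse>" by auto
    finally show ?thesis .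
  qed
  have 1: "(\<Union>k<n_crossings. ?F k) \<subseteq> ?G" by (auto simp: graph_of_def flow_source)
  \<comment> \<open>Fixed points of the flow add only loops, which the reflexive closure
    absorbs.\<close>
  have 2: "?G \<subseteq> (\<Union>k<n_crossings. ?F k) \<union> Id"
  proof
    fix x assume "x \<in> ?G"
    then obtain a where x: "x = (a, flow s a)" by (auto simp: graph_of_def)
    show "x \<in> (\<Union>k<n_crossings. ?F k) \<union> Id"
    proof (cases "a \<in> crossing_arcs D")
      case True
      then obtain k c where "k < n_crossings" "a = source (k, c)" by (rule source_cases)
      then show ?thesis unfolding x by (auto simp: flow_source)
    next
      case False
      then have "flow s a = a" by (simp add: flow_def)
      then show ?thesis unfolding x by simp
    qed
  qed
  have "(?G \<union> ?G\<inverse>)\<^sup>* = (?R \<union> ?R\<inverse>)\<^sup>*"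
  proof (rule rtrancl_subset)
    show "?R \<union> ?R\<inverse> \<subseteq> ?G \<union> ?G\<inverse>" unfolding R using 1 by blast
    show "?G \<union> ?G\<inverse> \<subseteq> (?R \<union> ?R\<inverse>)\<^sup>*" unfolding R using 2 by blast
  qed
  then show ?thesis by (simp add: sim_def)
qed

lemma sim_split_pairs:
  assumes "k < n_crossings"
  shows "k \<notin> s \<Longrightarrow> (end_arc D k 1, end_arc D k 2) \<in> sim D s \<and> (end_arc D k 3, end_arc D k 0) \<in> sim D s"
    and "k \<in> s \<Longrightarrow> (end_arc D k 0, end_arc D k 1) \<in> sim D s \<and> (end_arc D k 2, end_arc D k 3) \<in> sim D s"
proof -
  have mem: "end_arc D k i \<in> arcs D" if "i < 4" for i
    using nth_mem[of i "ends (crossings D ! k)"] that length_ends[of "crossings D ! k"] end_mem_arcs[OF assms]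
    by (metis prod.collapse)
  have sub: "(x, y) \<in> sim D s" if "(x, y) \<in> splitting (k \<in> s) (crossings D ! k)" "x \<in> arcs D" "y \<in> arcs D" for x y
    using that assms unfolding sim_def by blast
  show "k \<notin> s \<Longrightarrow> (end_arc D k 1, end_arc D k 2) \<in> sim D s \<and> (end_arc D k 3, end_arc D k 0) \<in> sim D s"
    by (intro conjI sub mem) (simp_all add: splitting_def Let_def)
  show "k \<in> s \<Longrightarrow> (end_arc D k 0, end_arc D k 1) \<in> sim D s \<and> (end_arc D k 2, end_arc D k 3) \<in> sim D s"
    by (intro conjI sub mem) (simp_all add: splitting_def Let_def)
qed

text \<open>Which ends are sources depends on the colouring. Either splitting identifies the ends 0
  and 2 with the ends 1 and 3 in some order, so one pair of opposite ends is connected iff the other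
  is, and the colouring can be eliminated.\<close>

lemma source_connected_iff:
  assumes "k < n_crossings"
  shows "(source (k, True), source (k, False)) \<in> sim D s \<longleftrightarrow> (end_arc D k 0, end_arc D k 2) \<in> sim D s"
proof -
  note eqv = equiv_sim[of D s]
  have s: "(x, y) \<in> sim D s \<Longrightarrow> (y, x) \<in> sim D s" for x y using eqv by (auto simp: equiv_def dest: symD)
  have t: "(x, y) \<in> sim D s \<Longrightarrow> (y, z) \<in> sim D s \<Longrightarrow> (x, z) \<in> sim D s" for x y z
    using eqv by (auto simp: equiv_def dest: transD)
  show ?thesis
  proof (cases "colour k")
    case True
    have "(end_arc D k 1, end_arc D k 3) \<in> sim D s \<longleftrightarrow> (end_arc D k 0, end_arc D k 2) \<in> sim D s"
    proof (cases "k \<in> s")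
      case True
      then have "(end_arc D k 0, end_arc D k 1) \<in> sim D s" "(end_arc D k 2, end_arc D k 3) \<in> sim D s"
        using sim_split_pairs(2)[OF assms] by simp_all
      then show ?thesis using s t by blast
    next
      case False
      then have "(end_arc D k 1, end_arc D k 2) \<in> sim D s" "(end_arc D k 3, end_arc D k 0) \<in> sim D s"
        using sim_split_pairs(1)[OF assms] by simp_all
      then show ?thesis using s t by blast
    qed
    then show ?thesis using True by (simp add: source_def)
  next
    case False
    then show ?thesis using s[of "end_arc D k 0" "end_arc D k 2"] s[of "end_arc D k 2" "end_arc D k 0"]
      by (auto simp: source_def)
  qed
qed

lemma exactly_one_connected_coloured:
  assumes "k < n_crossings" "k \<notin> s"
  shows "(end_arc D k 0, end_arc D k 2) \<in> sim D s \<longleftrightarrow> (end_arc D k 0, end_arc D k 2) \<notin> sim D (insert k s)"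
proof -
  have "source (k, c) \<in> arcs D" for c
    using bij_source assms(1) crossing_arcs_subset by (auto simp: bij_betw_def)
  then show ?thesis
    using transposition_connects[OF permutation_flow opposite_ends_neq(1)[OF assms(1)] flow_insert[OF assms]]
    unfolding source_connected_iff[OF assms(1), symmetric] by (simp add: sim_iff_flow)
qed

end

context link_diagram begin

text \<open>The ends 0 and 2 are those of the overcrossing strand. Being connected in exactly one of
  the two states is the dichotomy between split and merge, now free of the auxiliary
  colouring.\<close>

lemma exactly_one_connected:
  assumes "k < n_crossings" "k \<notin> s"
  shows "(end_arc D k 0, end_arc D k 2) \<in> sim D s \<longleftrightarrow> (end_arc D k 0, end_arc D k 2) \<notin> sim D (insert k s)"
proof -
  obtain T where "T \<in> face_sets" "boundary T = arcs D" by (rule checkerboard)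
  then interpret coloured_diagram D T by unfold_locales
  show ?thesis using assms by (rule exactly_one_connected_coloured)
qed

end

section \<open>Merging and splitting circles\<close>

text \<open>One notion serves both kinds of edges: a split is a merge read backwards.\<close>

definition merges :: "('a \<times> 'a) set \<Rightarrow> ('a \<times> 'a) set \<Rightarrow> 'a \<Rightarrow> 'a \<Rightarrow> bool" where
  "merges E F x y \<longleftrightarrow> (x, y) \<notin> E \<and> F = E \<union> (E `` {x} \<union> E `` {y}) \<times> (E `` {x} \<union> E `` {y})"

lemma insert_diff_pair:
  assumes "P = insert u (Q - {c, d})" "u \<notin> Q" "c \<in> Q" "d \<in> Q"
  shows "Q - P = {c, d}" "P - Q = {u}"
  using assms by auto

lemma sim_sym: "(a, b) \<in> sim D s \<Longrightarrow> (b, a) \<in> sim D s"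
  using equiv_sim[of D s] unfolding equiv_def by (blast dest: symD)

lemma sim_trans: "(a, b) \<in> sim D s \<Longrightarrow> (b, c) \<in> sim D s \<Longrightarrow> (a, c) \<in> sim D s"
  using equiv_sim[of D s] unfolding equiv_def by (blast dest: transD)

lemma sim_refl: "a \<in> arcs D \<Longrightarrow> (a, a) \<in> sim D s"
  using equiv_sim[of D s] unfolding equiv_def by (blast dest: refl_onD)

locale merging =
  fixes A :: "'a set" and E F x y
  assumes E: "equiv A E" and F: "equiv A F" and xy: "x \<in> A" "y \<in> A" and merges: "merges E F x y"
begin

lemma E_iff: "(a, b) \<in> E \<longleftrightarrow> a \<in> A \<and> b \<in> A \<and> E `` {a} = E `` {b}"
  using equiv_class_eq_iff[OF E] by blast

lemma classes_neq: "E `` {x} \<noteq> E `` {y}"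
  using merges xy by (simp add: merges_def E_iff)

lemma class_self: "a \<in> A \<Longrightarrow> a \<in> E `` {a}"
  using E by (rule equiv_class_self)

lemma mem_class: "a \<in> E `` {b} \<longleftrightarrow> a \<in> A \<and> b \<in> A \<and> E `` {a} = E `` {b}"
  using E_iff[of b a] by auto

lemma F_class:
  assumes "a \<in> A"
  shows "F `` {a} = (if a \<in> E `` {x} \<union> E `` {y} then E `` {x} \<union> E `` {y} else E `` {a})"
proof -
  have "F `` {a} = E `` {a} \<union> (if a \<in> E `` {x} \<union> E `` {y} then E `` {x} \<union> E `` {y} else {})"
    using merges by (auto simp: merges_def)
  moreover have "E `` {a} \<subseteq> E `` {x} \<union> E `` {y}" if "a \<in> E `` {x} \<union> E `` {y}"
    using that mem_class[of a x] mem_class[of a y] by blast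
  ultimately show ?thesis by auto
qed

lemma quotient_F: "A // F = insert (E `` {x} \<union> E `` {y}) (A // E - {E `` {x}, E `` {y}})"
proof (intro subset_antisym subsetI)
  fix C assume "C \<in> A // F"
  then obtain a where a: "a \<in> A" "C = F `` {a}" by (rule quotientE)
  show "C \<in> insert (E `` {x} \<union> E `` {y}) (A // E - {E `` {x}, E `` {y}})"
  proof (cases "a \<in> E `` {x} \<union> E `` {y}")
    case False
    then have "E `` {a} \<noteq> E `` {x}" "E `` {a} \<noteq> E `` {y}" using class_self[OF a(1)] by auto
    then show ?thesis using a False by (simp add: F_class quotientI)
  qed (use a in \<open>simp add: F_class\<close>)
next
  fix C assume "C \<in> insert (E `` {x} \<union> E `` {y}) (A // E - {E `` {x}, E `` {y}})"
  then consider "C = E `` {x} \<union> E `` {y}" | "C \<in> A // E" "C \<noteq> E `` {x}" "C \<noteq> E `` {y}" by blast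
  then show "C \<in> A // F"
  proof cases
    case 1
    then have "C = F `` {x}" using class_self[OF xy(1)] by (simp add: F_class[OF xy(1)])
    then show ?thesis using xy(1) by (simp add: quotientI)
  next
    case 2
    then obtain a where a: "a \<in> A" "C = E `` {a}" by (auto elim: quotientE)
    then have "a \<notin> E `` {x} \<union> E `` {y}" using 2(2,3) mem_class[of a x] mem_class[of a y] by blast
    then have "C = F `` {a}" using a by (simp add: F_class)
    then show ?thesis using a by (simp add: quotientI)
  qed
qed

lemma union_notin: "E `` {x} \<union> E `` {y} \<notin> A // E"
proof
  assume "E `` {x} \<union> E `` {y} \<in> A // E"
  then obtain a where a: "a \<in> A" "E `` {x} \<union> E `` {y} = E `` {a}" by (auto elim: quotientE)
  then have "x \<in> E `` {a}" "y \<in> E `` {a}" using class_self xy by blast+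
  then show False using classes_neq by (simp only: mem_class)
qed

lemma classes_in: "E `` {x} \<in> A // E" "E `` {y} \<in> A // E"
  using xy by (auto intro: quotientI)

lemma old: "A // E - A // F = {E `` {x}, E `` {y}}"
  using quotient_F union_notin classes_in by (rule insert_diff_pair)

lemma new: "A // F - A // E = {E `` {x} \<union> E `` {y}}"
  using quotient_F union_notin classes_in by (rule insert_diff_pair)

lemma card_quotient:
  assumes "finite A"
  shows "card (A // E) = card (A // F) + 1"
proof -
  have "E \<subseteq> A \<times> A" using E by (simp add: equiv_def)
  with assms have fin: "finite (A // E)" by (rule finite_quotient)
  have "card (A // F) = card (A // E - {E `` {x}, E `` {y}}) + 1"
    unfolding quotient_F using fin union_notin by simp
  also have "card (A // E - {E `` {x}, E `` {y}}) = card (A // E) - 2"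
    using classes_in classes_neq by (subst card_Diff_subset) simp_all
  finally have "card (A // F) = card (A // E) - 2 + 1" .
  moreover have "card (A // E) \<ge> 2"
    using card_mono[OF fin, of "{E `` {x}, E `` {y}}"] classes_in classes_neq by simp
  ultimately show ?thesis by simp
qed

end

context link_diagram begin

lemma end_arc_mem: "k < n_crossings \<Longrightarrow> i < 4 \<Longrightarrow> end_arc D k i \<in> arcs D"
proof -
  assume k: "k < n_crossings" and i: "i < 4"
  have "end_arc D k i \<in> fst ` set (ends (crossings D ! k))"
    using i length_ends[of "crossings D ! k"] by simp
  then show ?thesis
    using out_arcs_subset[OF k] in_arcs_subset[OF k] crossing_arcs_subset unfolding fst_set_ends_nth by blast
qed

lemma splitting_subset_sim: "k < n_crossings \<Longrightarrow> splitting (k \<in> s) (crossings D ! k) \<subseteq> sim D s"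
  using end_arc_mem[of k 0] end_arc_mem[of k 1] end_arc_mem[of k 2] end_arc_mem[of k 3]
  by (auto simp: sim_def splitting_def Let_def)

lemma sim_least:
  assumes G: "equiv (arcs D) G" and sub: "\<And>k. k < n_crossings \<Longrightarrow> splitting (k \<in> s) (crossings D ! k) \<subseteq> G"
  shows "sim D s \<subseteq> G"
proof
  let ?R = "\<Union>k<n_crossings. splitting (k \<in> s) (crossings D ! k)"
  have symG: "sym G" and transG: "trans G" and reflG: "refl_on (arcs D) G" using G by (auto simp: equiv_def)
  have sub': "?R \<union> ?R\<inverse> \<subseteq> G" using sub symD[OF symG] by blast
  fix p assume "p \<in> sim D s"
  then obtain a b where p: "p = (a, b)" "a \<in> arcs D" "(a, b) \<in> (?R \<union> ?R\<inverse>)\<^sup>*" by (auto simp: sim_def)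
  from p(3) have "(a, b) \<in> G"
  proof induction
    case base
    show ?case using reflG p(2) by (rule refl_onD)
  next
    case (step b c)
    then show ?case using sub' transD[OF transG] by blast
  qed
  then show "p \<in> G" using p by simp
qed

text \<open>In \<open>t\<close> the four ends at \<open>k\<close> are all equivalent, since a
  splitting joins them in pairs and 0 and 2 connect the pairs. So the marker of \<open>k\<close> in
  \<open>t\<close> is immaterial, and passing from \<open>s\<close> to \<open>t\<close> only glues
  the circles through \<open>k\<close>. Nothing is assumed about which state has marker
  \<open>B\<close> there.\<close>

lemma merges_sim:
  assumes k: "k < n_crossings" and st: "\<And>l. l \<noteq> k \<Longrightarrow> l \<in> s \<longleftrightarrow> l \<in> t"
    and s: "(end_arc D k 0, end_arc D k 2) \<notin> sim D s" and t: "(end_arc D k 0, end_arc D k 2) \<in> sim D t"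
  shows "merges (sim D s) (sim D t) (end_arc D k 0) (end_arc D k 2)"
proof -
  let ?e = "end_arc D k"
  let ?Z = "{?e 0, ?e 1, ?e 2, ?e 3}"
  have mem: "?e i \<in> arcs D" if "i < 4" for i using end_arc_mem[OF k that] .
  have pairs: "({(?e 1, ?e 2), (?e 3, ?e 0)} \<subseteq> sim D u) \<or> ({(?e 0, ?e 1), (?e 2, ?e 3)} \<subseteq> sim D u)" for u
    using splitting_subset_sim[OF k, of u] by (cases "k \<in> u") (simp_all add: splitting_def Let_def)
  have split_sub: "splitting m (crossings D ! k) \<subseteq> ?Z \<times> ?Z" for m
    by (cases m) (simp_all add: splitting_def Let_def)
  have "(?e 0, ?e 1) \<in> sim D t" "(?e 0, ?e 3) \<in> sim D t"
    using pairs[of t] t by (auto intro: sim_sym sim_trans)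
  then have star: "(?e 0, a) \<in> sim D t" if "a \<in> ?Z" for a
    using that t sim_refl[OF mem[of 0]] by auto
  have all_t: "?Z \<times> ?Z \<subseteq> sim D t"
  proof
    fix p assume "p \<in> ?Z \<times> ?Z"
    then obtain a b where ab: "p = (a, b)" "a \<in> ?Z" "b \<in> ?Z" by (rule SigmaE)
    show "p \<in> sim D t" unfolding ab(1) using sim_sym[OF star[OF ab(2)]] star[OF ab(3)] by (rule sim_trans)
  qed
  have sub: "sim D s \<subseteq> sim D t"
  proof (rule sim_least[OF equiv_sim])
    fix l assume l: "l < n_crossings"
    show "splitting (l \<in> s) (crossings D ! l) \<subseteq> sim D t"
      using split_sub all_t splitting_subset_sim[OF l, of t] st[of l] by (cases "l = k") (blast, simp)
  qed
  \<comment> \<open>\<open>?G\<close> is the relation of \<open>s\<close> with the two circles at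
    \<open>k\<close> glued. It is an equivalence relation containing all splittings of
    \<open>t\<close>, hence it contains the relation of \<open>t\<close>, which is the least
    one.\<close>
  let ?J = "sim D s `` {?e 0} \<union> sim D s `` {?e 2}"
  let ?G = "sim D s \<union> ?J \<times> ?J"
  have J_closed: "b \<in> ?J" if "a \<in> ?J" "(a, b) \<in> sim D s" for a b
    using that by (auto intro: sim_trans)
  have G: "equiv (arcs D) ?G"
  proof (rule equivI)
    show "?G \<subseteq> arcs D \<times> arcs D" by (auto simp: sim_def)
    show "refl_on (arcs D) ?G" by (intro refl_onI UnI1 sim_refl)
    show "sym ?G" by (rule symI) (auto intro: sim_sym)
    show "trans ?G"
    proof (rule transI)
      fix a b c assume "(a, b) \<in> ?G" "(b, c) \<in> ?G"
      then consider "(a, b) \<in> sim D s" "(b, c) \<in> sim D s" | "(a, b) \<in> sim D s" "b \<in> ?J" "c \<in> ?J"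
        | "a \<in> ?J" "b \<in> ?J" "(b, c) \<in> sim D s" | "a \<in> ?J" "c \<in> ?J"
        by (elim UnE SigmaE) simp_all
      then show "(a, c) \<in> ?G"
      proof cases
        case 1
        then show ?thesis using sim_trans by (intro UnI1)
      next
        case 2
        then show ?thesis using J_closed[of b a] sim_sym[of a b D s] by simp
      next
        case 3
        then show ?thesis using J_closed[of b c] by simp
      qed simp
    qed
  qed
  have "?e 1 \<in> ?J" "?e 3 \<in> ?J" "?e 0 \<in> ?J" "?e 2 \<in> ?J"
    using pairs[of s] sim_refl[OF mem[of 0], of s] sim_refl[OF mem[of 2], of s] by (auto dest: sim_sym)
  then have split_G: "splitting m (crossings D ! k) \<subseteq> ?G" for m
    using split_sub[of m] by blast
  have "sim D t \<subseteq> ?G"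
  proof (rule sim_least[OF G])
    fix l assume l: "l < n_crossings"
    show "splitting (l \<in> t) (crossings D ! l) \<subseteq> ?G"
    proof (cases "l = k")
      case False
      then have "splitting (l \<in> t) (crossings D ! l) \<subseteq> sim D s"
        using splitting_subset_sim[OF l, of s] st by simp
      then show ?thesis by (rule le_supI1)
    qed (simp only: split_G)
  qed
  moreover have "?J \<times> ?J \<subseteq> sim D t"
  proof
    have J: "(?e 0, a) \<in> sim D t" if "a \<in> ?J" for a
      using that sub sim_trans[OF t, of a] by auto
    fix p assume "p \<in> ?J \<times> ?J"
    then obtain a b where ab: "p = (a, b)" "a \<in> ?J" "b \<in> ?J" by (rule SigmaE)
    show "p \<in> sim D t" unfolding ab(1) using sim_sym[OF J[OF ab(2)]] J[OF ab(3)] by (rule sim_trans)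
  qed
  ultimately show ?thesis using s sub unfolding merges_def by blast
qed

lemma edge_merging:
  assumes "k < n_crossings" "k \<notin> s" "(end_arc D k 0, end_arc D k 2) \<notin> sim D s"
  shows "merging (arcs D) (sim D s) (sim D (insert k s)) (end_arc D k 0) (end_arc D k 2)"
  using assms exactly_one_connected[OF assms(1,2)]
  by (intro merging.intro equiv_sim end_arc_mem merges_sim) auto

lemma edge_splitting:
  assumes "k < n_crossings" "k \<notin> s" "(end_arc D k 0, end_arc D k 2) \<in> sim D s"
  shows "merging (arcs D) (sim D (insert k s)) (sim D s) (end_arc D k 0) (end_arc D k 2)"
  using assms exactly_one_connected[OF assms(1,2)]
  by (intro merging.intro equiv_sim end_arc_mem merges_sim) auto

lemma card_circles_merge:
  assumes "k < n_crossings" "k \<notin> s" "(end_arc D k 0, end_arc D k 2) \<notin> sim D s"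
  shows "card (circles D s) = card (circles D (insert k s)) + 1"
  using merging.card_quotient[OF edge_merging[OF assms] finite_arcs] by (simp add: circles_eq_quotient)

lemma card_circles_split:
  assumes "k < n_crossings" "k \<notin> s" "(end_arc D k 0, end_arc D k 2) \<in> sim D s"
  shows "card (circles D (insert k s)) = card (circles D s) + 1"
  using merging.card_quotient[OF edge_splitting[OF assms] finite_arcs] by (simp add: circles_eq_quotient)

end

section \<open>Generators as monomials in the arcs\<close>

definition circ :: "'a diagram \<Rightarrow> state \<Rightarrow> 'a \<Rightarrow> 'a set" where
  "circ D s a = sim D s `` {a}"

definition labelling_of :: "'a diagram \<Rightarrow> state \<Rightarrow> 'a list \<Rightarrow> 'a set \<Rightarrow> w_basis" where
  "labelling_of D s xs =
     (\<lambda>c\<in>circles D s. if c \<in> circ D s ` set xs then W_plus else W_minus)"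

text \<open>
  With \<open>w\<^sub>-\<close> as unit and \<open>w\<^sub>+\<close> as a generator of square zero, \<open>W\<close> is the ring \<open>\<int>[x]/(x\<^sup>2)\<close>. So the
  group of a state is a quotient of the polynomial ring with one variable for each arc, and the
  following is the image of a monomial. A merge is induced by the identity of the polynomial
  ring, and a split by multiplication with the sum of the variables of two arcs.
\<close>

definition arc_monomial :: "'a diagram \<Rightarrow> state \<Rightarrow> 'a list \<Rightarrow> 'a generator \<Rightarrow>\<^sub>0 int" where
  "arc_monomial D s xs = (if distinct (map (circ D s) xs) then frag_of (s, labelling_of D s xs) else 0)"

lemma arc_monomial_swap: "arc_monomial D s (x # y # xs) = arc_monomial D s (y # x # xs)"
proof -
  have "labelling_of D s (x # y # xs) = labelling_of D s (y # x # xs)"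
    by (simp add: labelling_of_def insert_commute)
  then show ?thesis by (auto simp: arc_monomial_def)
qed

lemma arc_monomial_cong_Cons: "circ D s x = circ D s y \<Longrightarrow> arc_monomial D s (x # xs) = arc_monomial D s (y # xs)"
  by (simp add: arc_monomial_def labelling_of_def)

lemma labelling_of_in: "labelling_of D s xs \<in> labellings D s"
  by (simp add: labelling_of_def labellings_def PiE_def)

lemma edge_map_mergeI:
  assumes "circles D s - circles D (insert k s) = {C1, C2}" "C1 \<noteq> C2"
    "circles D (insert k s) - circles D s = {C}"
  shows "edge_map D k (s, v) = frag_extend
     (\<lambda>x. frag_of (insert k s, restrict (v(C := x)) (circles D (insert k s)))) (m_bar (v C1, v C2))"
proof -
  define p where "p = (SOME (c1, c2). c1 \<noteq> c2 \<and> {C1, C2} = {c1, c2})"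
  have "case p of (c1, c2) \<Rightarrow> c1 \<noteq> c2 \<and> {C1, C2} = {c1, c2}"
    unfolding p_def by (rule someI[of _ "(C1, C2)"]) (use assms(2) in simp)
  then have "p = (C1, C2) \<or> p = (C2, C1)" by (auto simp: doubleton_eq_iff)
  moreover have "m_bar (x, y) = m_bar (y, x)" for x y by (cases x; cases y) simp_all
  moreover have "card {C1, C2} = 2" using assms(2) by simp
  ultimately show ?thesis
    unfolding edge_map_def Let_def prod.case assms(1,3) p_def[symmetric] by auto
qed

lemma edge_map_splitI:
  assumes "circles D s - circles D (insert k s) = {C}" "C1 \<noteq> C2"
    "circles D (insert k s) - circles D s = {C1, C2}"
  shows "edge_map D k (s, v) = frag_extend
     (\<lambda>(x, y). frag_of (insert k s, restrict (v(C1 := x, C2 := y)) (circles D (insert k s)))) (Delta_bar (v C))"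
proof -
  let ?h = "\<lambda>c1 c2. frag_extend
     (\<lambda>(x, y). frag_of (insert k s, restrict (v(c1 := x, c2 := y)) (circles D (insert k s)))) (Delta_bar (v C))"
  define p where "p = (SOME (c1, c2). c1 \<noteq> c2 \<and> {C1, C2} = {c1, c2})"
  have "case p of (c1, c2) \<Rightarrow> c1 \<noteq> c2 \<and> {C1, C2} = {c1, c2}"
    unfolding p_def by (rule someI[of _ "(C1, C2)"]) (use assms(2) in simp)
  then have "p = (C1, C2) \<or> p = (C2, C1)" by (auto simp: doubleton_eq_iff)
  moreover have "?h C1 C2 = ?h C2 C1"
    using assms(2) by (cases "v C") (simp_all add: frag_extend_add fun_upd_twist[of C1 C2] add.commute)
  moreover have "card {C1, C2} = 2" using assms(2) by simp
  ultimately show ?thesis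
    unfolding edge_map_def Let_def prod.case assms(1,3) p_def[symmetric] by auto
qed

context link_diagram begin

lemma circ_in_circles: "a \<in> arcs D \<Longrightarrow> circ D s a \<in> circles D s"
  unfolding circ_def circles_eq_quotient by (rule quotientI)

text \<open>A label \<open>W_plus\<close> on one of the merged circles passes to their union. If
  both carry it, two variables become equal, and \<open>m_bar\<close> agrees with the rule that
  squares vanish.\<close>

lemma edge_map_merge:
  assumes k: "k < n_crossings" "k \<notin> s" and merge: "(end_arc D k 0, end_arc D k 2) \<notin> sim D s"
    and xs: "set xs \<subseteq> arcs D" "distinct (map (circ D s) xs)"
  shows "edge_map D k (s, labelling_of D s xs) = arc_monomial D (insert k s) xs"
proof -
  let ?t = "insert k s" and ?v = "labelling_of D s xs"
  interpret merging "arcs D" "sim D s" "sim D ?t" "end_arc D k 0" "end_arc D k 2"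
    using k merge by (rule edge_merging)
  define C1 C2 where "C1 = circ D s (end_arc D k 0)" and "C2 = circ D s (end_arc D k 2)"
  note defs = C1_def[unfolded circ_def] C2_def[unfolded circ_def]
  have neq: "C1 \<noteq> C2" using classes_neq by (simp add: defs)
  have old': "circles D s - circles D ?t = {C1, C2}" and new': "circles D ?t - circles D s = {C1 \<union> C2}"
    using old new by (simp_all add: defs circles_eq_quotient)
  have circ_t: "circ D ?t a = (if circ D s a \<in> {C1, C2} then C1 \<union> C2 else circ D s a)" if "a \<in> arcs D" for a
    using F_class[OF that] mem_class[of a "end_arc D k 0"] mem_class[of a "end_arc D k 2"] that xy
    by (auto simp: defs circ_def)
  have not_s: "circ D s a \<noteq> C1 \<union> C2" if "a \<in> arcs D" for a
    using new' circ_in_circles[OF that, of s] by auto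
  have C12: "C1 \<in> circles D s" "C2 \<in> circles D s" using old' by auto
  let ?I = "circ D s ` set xs"
  have I_t: "c \<in> circ D ?t ` set xs \<longleftrightarrow> c \<in> ?I" if "c \<in> circles D s - {C1, C2}" for c
  proof -
    have "c = circ D ?t a \<longleftrightarrow> c = circ D s a" if a: "a \<in> set xs" for a
    proof -
      have "c \<noteq> C1 \<union> C2" using \<open>c \<in> circles D s - {C1, C2}\<close> new' by blast
      then show ?thesis using \<open>c \<in> circles D s - {C1, C2}\<close> circ_t[OF subsetD[OF xs(1) a]] by auto
    qed
    then show ?thesis unfolding image_iff by (intro bex_cong refl)
  qed
  have I_C: "C1 \<union> C2 \<in> circ D ?t ` set xs \<longleftrightarrow> C1 \<in> ?I \<or> C2 \<in> ?I"
  proof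
    assume "C1 \<union> C2 \<in> circ D ?t ` set xs"
    then obtain a where a: "a \<in> set xs" "C1 \<union> C2 = circ D ?t a" by auto
    then have "circ D s a \<in> {C1, C2}" using circ_t[of a] not_s[of a] subsetD[OF xs(1)] by metis
    then show "C1 \<in> ?I \<or> C2 \<in> ?I" using a(1) by auto
  next
    assume "C1 \<in> ?I \<or> C2 \<in> ?I"
    then obtain a where "a \<in> set xs" "circ D s a \<in> {C1, C2}" by auto
    then have "C1 \<union> C2 = circ D ?t a" using circ_t[of a] subsetD[OF xs(1)] by simp
    then show "C1 \<union> C2 \<in> circ D ?t ` set xs" using \<open>a \<in> set xs\<close> by (rule image_eqI)
  qed
  have eq: "edge_map D k (s, ?v) = frag_extend
     (\<lambda>x. frag_of (?t, restrict (?v(C1 \<union> C2 := x)) (circles D ?t))) (m_bar (?v C1, ?v C2))"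
    using old' neq new' by (rule edge_map_mergeI)
  have v: "?v C1 = (if C1 \<in> ?I then W_plus else W_minus)" "?v C2 = (if C2 \<in> ?I then W_plus else W_minus)"
    using C12 by (simp_all add: labelling_of_def)
  show ?thesis
  proof (cases "C1 \<in> ?I \<and> C2 \<in> ?I")
    case True
    then obtain a b where ab: "a \<in> set xs" "b \<in> set xs" "circ D s a = C1" "circ D s b = C2" by auto
    then have "circ D ?t a = circ D ?t b" "a \<noteq> b"
      using circ_t[of a] circ_t[of b] subsetD[OF xs(1)] neq by auto
    then have "\<not> inj_on (circ D ?t) (set xs)" using ab by (auto simp: inj_on_def)
    then show ?thesis unfolding eq v using True by (simp add: arc_monomial_def distinct_map)
  next
    case False
    have m: "m_bar (?v C1, ?v C2) = frag_of (if C1 \<in> ?I \<or> C2 \<in> ?I then W_plus else W_minus)"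
      using False unfolding v by auto
    have "inj_on (circ D ?t) (set xs)"
    proof (rule inj_onI)
      fix a b assume ab: "a \<in> set xs" "b \<in> set xs" "circ D ?t a = circ D ?t b"
      then have mem: "a \<in> arcs D" "b \<in> arcs D" using xs(1) by auto
      have "circ D s a = circ D s b"
        using ab(3) circ_t[OF mem(1)] circ_t[OF mem(2)] not_s[OF mem(1)] not_s[OF mem(2)] False
          imageI[OF ab(1), of "circ D s"] imageI[OF ab(2), of "circ D s"]
        by (auto split: if_splits)
      then show "a = b" using xs(2) ab(1,2) by (auto simp: distinct_map inj_on_def)
    qed
    then have d: "distinct (map (circ D ?t) xs)" using xs(2) by (simp add: distinct_map)
    have "restrict (?v(C1 \<union> C2 := (if C1 \<in> ?I \<or> C2 \<in> ?I then W_plus else W_minus))) (circles D ?t)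
      = labelling_of D ?t xs"
    proof
      fix c
      have "c \<in> circles D s - {C1, C2}" if "c \<in> circles D ?t" "c \<noteq> C1 \<union> C2"
        using that old' new' by blast
      then show "restrict (?v(C1 \<union> C2 := (if C1 \<in> ?I \<or> C2 \<in> ?I then W_plus else W_minus))) (circles D ?t) c
        = labelling_of D ?t xs c"
        using I_t[of c] I_C by (cases "c \<in> circles D ?t"; cases "c = C1 \<union> C2") (simp_all add: labelling_of_def)
    qed
    then show ?thesis unfolding eq m using d by (simp add: arc_monomial_def)
  qed
qed

text \<open>If the old circle is labelled \<open>W_minus\<close>, the two monomials are the two
  terms of \<open>Delta_bar\<close>. If it is labelled \<open>W_plus\<close>, its arc lies on one of
  the new circles; the monomial repeating that circle vanishes, and the other one labels both
  circles \<open>W_plus\<close>.\<close>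

lemma edge_map_split:
  assumes k: "k < n_crossings" "k \<notin> s" and split: "(end_arc D k 0, end_arc D k 2) \<in> sim D s"
    and xs: "set xs \<subseteq> arcs D" "distinct (map (circ D s) xs)"
  shows "edge_map D k (s, labelling_of D s xs)
    = arc_monomial D (insert k s) (end_arc D k 0 # xs) + arc_monomial D (insert k s) (end_arc D k 2 # xs)"
proof -
  let ?t = "insert k s" and ?v = "labelling_of D s xs"
  interpret merging "arcs D" "sim D ?t" "sim D s" "end_arc D k 0" "end_arc D k 2"
    using k split by (rule edge_splitting)
  define C1 C2 where "C1 = circ D ?t (end_arc D k 0)" and "C2 = circ D ?t (end_arc D k 2)"
  note defs = C1_def[unfolded circ_def] C2_def[unfolded circ_def]
  have neq: "C1 \<noteq> C2" using classes_neq by (simp add: defs)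
  have new': "circles D ?t - circles D s = {C1, C2}" and old': "circles D s - circles D ?t = {C1 \<union> C2}"
    using old new by (simp_all add: defs circles_eq_quotient)
  have circ_s: "circ D s a = (if circ D ?t a \<in> {C1, C2} then C1 \<union> C2 else circ D ?t a)" if "a \<in> arcs D" for a
    using F_class[OF that] mem_class[of a "end_arc D k 0"] mem_class[of a "end_arc D k 2"] that xy
    by (auto simp: defs circ_def)
  have not_t: "circ D ?t a \<noteq> C1 \<union> C2" if "a \<in> arcs D" for a
    using old' circ_in_circles[OF that, of ?t] by auto
  have C12: "C1 \<in> circles D ?t" "C2 \<in> circles D ?t" "C1 \<union> C2 \<in> circles D s" using old' new' by auto
  let ?I = "circ D s ` set xs" and ?It = "circ D ?t ` set xs"
  have inj_s: "a = b" if "a \<in> set xs" "b \<in> set xs" "circ D s a = circ D s b" for a b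
    using that xs(2) by (auto simp: distinct_map inj_on_def)
  have "a = b" if "a \<in> set xs" "b \<in> set xs" "circ D ?t a = circ D ?t b" for a b
    using that inj_s[of a b] circ_s[of a] circ_s[of b] subsetD[OF xs(1)] by simp
  then have d: "distinct (map (circ D ?t) xs)" using xs(2) by (auto simp: distinct_map inj_on_def)
  have I_t: "c \<in> ?It \<longleftrightarrow> c \<in> ?I" if "c \<in> circles D ?t - {C1, C2}" for c
  proof -
    have "c = circ D ?t a \<longleftrightarrow> c = circ D s a" if a: "a \<in> set xs" for a
    proof -
      have "c \<noteq> C1 \<union> C2" using \<open>c \<in> circles D ?t - {C1, C2}\<close> old' by blast
      then show ?thesis using \<open>c \<in> circles D ?t - {C1, C2}\<close> circ_s[OF subsetD[OF xs(1) a]] by auto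
    qed
    then show ?thesis unfolding image_iff by (intro bex_cong refl)
  qed
  have I_C: "C1 \<union> C2 \<in> ?I \<longleftrightarrow> C1 \<in> ?It \<or> C2 \<in> ?It"
  proof
    assume "C1 \<union> C2 \<in> ?I"
    then obtain a where a: "a \<in> set xs" "C1 \<union> C2 = circ D s a" by auto
    then have "circ D ?t a \<in> {C1, C2}" using circ_s[of a] not_t[of a] subsetD[OF xs(1)] by metis
    then show "C1 \<in> ?It \<or> C2 \<in> ?It" using a(1) by auto
  next
    assume "C1 \<in> ?It \<or> C2 \<in> ?It"
    then obtain a where "a \<in> set xs" "circ D ?t a \<in> {C1, C2}" by auto
    then have "C1 \<union> C2 = circ D s a" using circ_s[of a] subsetD[OF xs(1)] by simp
    then show "C1 \<union> C2 \<in> ?I" using \<open>a \<in> set xs\<close> by (rule image_eqI)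
  qed
  have not_both: "\<not> (C1 \<in> ?It \<and> C2 \<in> ?It)"
  proof
    assume "C1 \<in> ?It \<and> C2 \<in> ?It"
    then obtain a b where ab: "a \<in> set xs" "b \<in> set xs" "circ D ?t a = C1" "circ D ?t b = C2" by auto
    then have "circ D s a = circ D s b" using circ_s[of a] circ_s[of b] subsetD[OF xs(1)] by simp
    then show False using inj_s ab neq by auto
  qed
  have eq: "edge_map D k (s, ?v) = frag_extend
     (\<lambda>(x, y). frag_of (?t, restrict (?v(C1 := x, C2 := y)) (circles D ?t))) (Delta_bar (?v (C1 \<union> C2)))"
    using old' neq new' by (rule edge_map_splitI)
  have v: "?v (C1 \<union> C2) = (if C1 \<union> C2 \<in> ?I then W_plus else W_minus)"
    using C12 by (simp add: labelling_of_def)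
  have lab: "restrict (?v(C1 := x, C2 := y)) (circles D ?t) = labelling_of D ?t (z # xs)"
    if "z = end_arc D k 0 \<or> z = end_arc D k 2"
      and "x = (if C1 = circ D ?t z \<or> C1 \<in> ?It then W_plus else W_minus)"
      and "y = (if C2 = circ D ?t z \<or> C2 \<in> ?It then W_plus else W_minus)" for x y z
  proof
    fix c
    have "c \<in> circles D s" if "c \<in> circles D ?t" "c \<noteq> C1" "c \<noteq> C2"
      using that new' by blast
    moreover have "circ D ?t z = C1 \<or> circ D ?t z = C2" using that(1) by (auto simp: C1_def C2_def)
    ultimately show "restrict (?v(C1 := x, C2 := y)) (circles D ?t) c = labelling_of D ?t (z # xs) c"
      using I_t[of c] that(2,3) neq
      by (cases "c \<in> circles D ?t"; cases "c = C1"; cases "c = C2") (auto simp: labelling_of_def)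
  qed
  have mono0: "arc_monomial D ?t (end_arc D k 0 # xs) = (if C1 \<in> ?It then 0 else frag_of (?t, labelling_of D ?t (end_arc D k 0 # xs)))"
    and mono2: "arc_monomial D ?t (end_arc D k 2 # xs) = (if C2 \<in> ?It then 0 else frag_of (?t, labelling_of D ?t (end_arc D k 2 # xs)))"
    using d by (simp_all add: arc_monomial_def C1_def C2_def)
  note lab0 = lab[of "end_arc D k 0", folded C1_def C2_def] and lab2 = lab[of "end_arc D k 2", folded C1_def C2_def]
  consider "C1 \<notin> ?It" "C2 \<notin> ?It" | "C1 \<in> ?It" "C2 \<notin> ?It" | "C1 \<notin> ?It" "C2 \<in> ?It"
    using not_both by blast
  then show ?thesis
  proof cases
    case 1
    then have "C1 \<union> C2 \<notin> ?I" using I_C by simp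
    then show ?thesis
      unfolding eq v mono0 mono2 using 1 neq lab0[of W_plus W_minus] lab2[of W_minus W_plus]
      by (simp add: frag_extend_add)
  next
    case 2
    then have "C1 \<union> C2 \<in> ?I" using I_C by simp
    then show ?thesis
      unfolding eq v mono0 mono2 using 2 neq lab2[of W_plus W_plus] by simp
  next
    case 3
    then have "C1 \<union> C2 \<in> ?I" using I_C by simp
    then show ?thesis
      unfolding eq v mono0 mono2 using 3 neq lab0[of W_plus W_plus] by simp
  qed
qed

end

section \<open>The differential\<close>

context merging begin

lemma F_class_cases:
  assumes "a \<in> A"
  shows "F `` {a} = (if E `` {a} \<in> {E `` {x}, E `` {y}} then E `` {x} \<union> E `` {y} else E `` {a})"
proof -
  have "a \<in> E `` {x} \<union> E `` {y} \<longleftrightarrow> E `` {a} \<in> {E `` {x}, E `` {y}}"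
    using mem_class[of a x] mem_class[of a y] assms xy by simp
  then show ?thesis using F_class[OF assms] by simp
qed

lemma F_class_eq_cases:
  assumes "a \<in> A" "b \<in> A" "F `` {a} = F `` {b}"
  shows "E `` {a} = E `` {b} \<or> E `` {a} \<in> {E `` {x}, E `` {y}} \<and> E `` {b} \<in> {E `` {x}, E `` {y}}"
proof -
  have ne: "E `` {x} \<union> E `` {y} \<noteq> E `` {c}" if "c \<in> A" for c
    using union_notin quotientI[OF that, of E] by auto
  show ?thesis
    using assms(3) ne[OF assms(1)] ne[OF assms(2)]
    unfolding F_class_cases[OF assms(1)] F_class_cases[OF assms(2)]
    by (cases "E `` {a} \<in> {E `` {x}, E `` {y}}"; cases "E `` {b} \<in> {E `` {x}, E `` {y}}") simp_all
qed

end

context link_diagram begin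

definition edge :: "nat \<Rightarrow> ('a generator \<Rightarrow>\<^sub>0 int) \<Rightarrow> ('a generator \<Rightarrow>\<^sub>0 int)" where
  "edge k = frag_extend (edge_map D k)"

lemma edge_add: "edge k (a + b) = edge k a + edge k b"
  by (simp add: edge_def frag_extend_add)

text \<open>Two arcs on one circle stay on one circle after a merge, so the formula persists for
  vanishing monomials. Edges can therefore be iterated without checking distinctness.\<close>

lemma edge_mono_merge:
  assumes k: "k < n_crossings" "k \<notin> s" "(end_arc D k 0, end_arc D k 2) \<notin> sim D s" and xs: "set xs \<subseteq> arcs D"
  shows "edge k (arc_monomial D s xs) = arc_monomial D (insert k s) xs"
proof (cases "distinct (map (circ D s) xs)")
  case True
  then show ?thesis using edge_map_merge[OF k xs] by (simp add: edge_def arc_monomial_def[of D s])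
next
  case False
  interpret merging "arcs D" "sim D s" "sim D (insert k s)" "end_arc D k 0" "end_arc D k 2"
    using k by (rule edge_merging)
  have coarser: "circ D (insert k s) a = circ D (insert k s) b"
    if "a \<in> set xs" "b \<in> set xs" "circ D s a = circ D s b" for a b
    using that(3) F_class_cases[OF subsetD[OF xs that(1)]] F_class_cases[OF subsetD[OF xs that(2)]]
    by (simp only: circ_def)
  have "\<not> distinct (map (circ D (insert k s)) xs)"
  proof
    assume d: "distinct (map (circ D (insert k s)) xs)"
    then have inj: "inj_on (circ D (insert k s)) (set xs)" by (simp add: distinct_map)
    have "inj_on (circ D s) (set xs)" by (intro inj_onI inj_onD[OF inj] coarser)
    then show False using False d by (simp add: distinct_map)
  qed
  then show ?thesis using False by (simp add: edge_def arc_monomial_def)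
qed

text \<open>Two listed arcs on one circle may be separated by the split, but then they occupy both
  new circles, and the additional variable repeats one of them. So both summands vanish together
  with the monomial.\<close>

lemma edge_mono_split:
  assumes k: "k < n_crossings" "k \<notin> s" "(end_arc D k 0, end_arc D k 2) \<in> sim D s" and xs: "set xs \<subseteq> arcs D"
  shows "edge k (arc_monomial D s xs) = arc_monomial D (insert k s) (end_arc D k 0 # xs) + arc_monomial D (insert k s) (end_arc D k 2 # xs)"
proof (cases "distinct (map (circ D s) xs)")
  case True
  then show ?thesis using edge_map_split[OF k xs] by (simp add: edge_def arc_monomial_def[of D s])
next
  case False
  let ?t = "insert k s"
  interpret merging "arcs D" "sim D ?t" "sim D s" "end_arc D k 0" "end_arc D k 2"
    using k by (rule edge_splitting)
  have "\<not> distinct (map (circ D ?t) (z # xs))" if z: "z \<in> {end_arc D k 0, end_arc D k 2}" for z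
  proof
    assume d: "distinct (map (circ D ?t) (z # xs))"
    have "a = b" if ab: "a \<in> set xs" "b \<in> set xs" "circ D s a = circ D s b" for a b
    proof -
      have mem: "a \<in> arcs D" "b \<in> arcs D" using ab xs by auto
      have ne: "circ D ?t a \<noteq> circ D ?t z" "circ D ?t b \<noteq> circ D ?t z"
        using d ab by (auto simp: image_iff)
      have "circ D ?t a = circ D ?t b"
        using F_class_eq_cases[OF mem] ab(3) ne z by (auto simp: circ_def)
      then show ?thesis using d ab by (simp add: distinct_map inj_on_def)
    qed
    then show False using d False by (simp add: distinct_map inj_on_def)
  qed
  then have "arc_monomial D ?t (end_arc D k 0 # xs) = 0" "arc_monomial D ?t (end_arc D k 2 # xs) = 0"
    unfolding arc_monomial_def by (metis insertI1, metis insertI1 insertI2)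
  then show ?thesis using False by (simp add: edge_def arc_monomial_def[of D s])
qed

text \<open>Each step changes the number of circles by one, and both ways round the square have the
  same total. So either each crossing acts alike on both ways, or both ways first split and then
  merge, or both first merge and then split.\<close>

lemma edge_commute:
  assumes k: "k < n_crossings" "k \<notin> s" and l: "l < n_crossings" "l \<notin> s" and "k \<noteq> l" and xs: "set xs \<subseteq> arcs D"
  shows "edge l (edge k (arc_monomial D s xs)) = edge k (edge l (arc_monomial D s xs))"
proof -
  define p0 p2 q0 q2 where "p0 = end_arc D k 0" "p2 = end_arc D k 2" "q0 = end_arc D l 0" "q2 = end_arc D l 2"
  note defs = this
  have mem: "p0 \<in> arcs D" "p2 \<in> arcs D" "q0 \<in> arcs D" "q2 \<in> arcs D"
    using end_arc_mem[OF k(1)] end_arc_mem[OF l(1)] by (simp_all add: defs)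
  let ?sk = "insert k s" and ?sl = "insert l s" and ?u = "insert l (insert k s)"
  have u: "insert k ?sl = ?u" by (rule insert_commute)
  have kl: "l \<notin> ?sk" "k \<notin> ?sl" using k l \<open>k \<noteq> l\<close> by auto
  define a b c d where "a = ((p0, p2) \<in> sim D s)" "b = ((q0, q2) \<in> sim D ?sk)"
    "c = ((q0, q2) \<in> sim D s)" "d = ((p0, p2) \<in> sim D ?sl)"
  note abcd = this
  have K: "edge k (arc_monomial D s ys) = (if a then arc_monomial D ?sk (p0 # ys) + arc_monomial D ?sk (p2 # ys) else arc_monomial D ?sk ys)"
    if "set ys \<subseteq> arcs D" for ys
    using edge_mono_merge[OF k _ that] edge_mono_split[OF k _ that] by (simp add: abcd defs)
  have L: "edge l (arc_monomial D s ys) = (if c then arc_monomial D ?sl (q0 # ys) + arc_monomial D ?sl (q2 # ys) else arc_monomial D ?sl ys)"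
    if "set ys \<subseteq> arcs D" for ys
    using edge_mono_merge[OF l _ that] edge_mono_split[OF l _ that] by (simp add: abcd defs)
  have LK: "edge l (arc_monomial D ?sk ys) = (if b then arc_monomial D ?u (q0 # ys) + arc_monomial D ?u (q2 # ys) else arc_monomial D ?u ys)"
    if "set ys \<subseteq> arcs D" for ys
    using edge_mono_merge[OF l(1) kl(1) _ that] edge_mono_split[OF l(1) kl(1) _ that] by (simp add: abcd defs)
  have KL: "edge k (arc_monomial D ?sl ys) = (if d then arc_monomial D ?u (p0 # ys) + arc_monomial D ?u (p2 # ys) else arc_monomial D ?u ys)"
    if "set ys \<subseteq> arcs D" for ys
    using edge_mono_merge[OF k(1) kl(2) _ that] edge_mono_split[OF k(1) kl(2) _ that] by (simp add: abcd defs u)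
  have step: "int (card (circles D ?sk)) = int (card (circles D s)) + (if a then 1 else -1)"
    "int (card (circles D ?sl)) = int (card (circles D s)) + (if c then 1 else -1)"
    "int (card (circles D ?u)) = int (card (circles D ?sk)) + (if b then 1 else -1)"
    "int (card (circles D ?u)) = int (card (circles D ?sl)) + (if d then 1 else -1)"
    using card_circles_merge[OF k] card_circles_split[OF k] card_circles_merge[OF l] card_circles_split[OF l]
      card_circles_merge[OF l(1) kl(1)] card_circles_split[OF l(1) kl(1)]
      card_circles_merge[OF k(1) kl(2)] card_circles_split[OF k(1) kl(2)]
    by (simp_all add: abcd defs u)
  then have "(if a then 1 else -1) + (if b then 1 else -1) = (if c then 1 else -1) + (if d then 1 else -1 :: int)"
    by linarith
  then consider "a = d" "b = c" | "a" "\<not> b" "c" "\<not> d" | "\<not> a" "b" "\<not> c" "d"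
    by (cases a; cases b; cases c; cases d) simp_all
  then show ?thesis
  proof cases
    case 1
    \<comment> \<open>Each crossing contributes the same factor on both ways; only the order of the
      variables differs.\<close>
    have sw: "arc_monomial D ?u (q # p # xs) = arc_monomial D ?u (p # q # xs)" for p q by (rule arc_monomial_swap)
    show ?thesis
      using 1 xs mem K[OF xs] L[OF xs] LK[OF xs] KL[OF xs] LK[of "p0 # xs"] LK[of "p2 # xs"] KL[of "q0 # xs"] KL[of "q2 # xs"]
        sw[of q0 p0] sw[of q2 p0] sw[of q0 p2] sw[of q2 p2]
      by (simp add: edge_add add_ac)
  next
    case 2
    interpret sp: merging "arcs D" "sim D ?sk" "sim D s" p0 p2
      using edge_splitting[OF k] 2 by (simp add: abcd defs)
    interpret mg: merging "arcs D" "sim D ?sk" "sim D ?u" q0 q2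
      using edge_merging[OF l(1) kl(1)] 2 by (simp add: abcd defs)
    \<comment> \<open>The split at \<open>k\<close> separates \<open>q0\<close> from
      \<open>q2\<close>, so its two new circles are theirs, and merging at \<open>l\<close> glues
      exactly these. In \<open>?u\<close> all four arcs lie on one circle, and the two factors
      agree.\<close>
    have "sim D s `` {q0} = sim D s `` {q2}"
      using 2 mem by (simp add: abcd eq_equiv_class_iff[OF equiv_sim])
    then have eq: "{sim D ?sk `` {q0}, sim D ?sk `` {q2}} = {sim D ?sk `` {p0}, sim D ?sk `` {p2}}"
      using sp.F_class_eq_cases[of q0 q2] mem mg.classes_neq by auto
    have "sim D ?sk `` {p0} \<in> {sim D ?sk `` {q0}, sim D ?sk `` {q2}}"
      "sim D ?sk `` {p2} \<in> {sim D ?sk `` {q0}, sim D ?sk `` {q2}}"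
      unfolding eq by simp_all
    note classes = this
    have "circ D ?u p0 = sim D ?sk `` {q0} \<union> sim D ?sk `` {q2}" "circ D ?u p2 = sim D ?sk `` {q0} \<union> sim D ?sk `` {q2}"
      using mg.F_class_cases[OF mem(1)] mg.F_class_cases[OF mem(2)] classes by (simp_all only: circ_def if_True)
    moreover have "circ D ?u q0 = sim D ?sk `` {q0} \<union> sim D ?sk `` {q2}" "circ D ?u q2 = sim D ?sk `` {q0} \<union> sim D ?sk `` {q2}"
      using mg.F_class_cases[OF mem(3)] mg.F_class_cases[OF mem(4)] by (simp_all add: circ_def)
    ultimately have eqs: "circ D ?u p0 = circ D ?u q0" "circ D ?u p2 = circ D ?u q2" by (simp_all only:)
    have "arc_monomial D ?u (p0 # xs) = arc_monomial D ?u (q0 # xs)" "arc_monomial D ?u (p2 # xs) = arc_monomial D ?u (q2 # xs)"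
      using arc_monomial_cong_Cons[OF eqs(1)] arc_monomial_cong_Cons[OF eqs(2)] by simp_all
    then show ?thesis
      using 2 xs mem K[OF xs] L[OF xs] LK[of "p0 # xs"] LK[of "p2 # xs"] KL[of "q0 # xs"] KL[of "q2 # xs"]
      by (simp add: edge_add)
  next
    case 3
    interpret mg: merging "arcs D" "sim D s" "sim D ?sk" p0 p2
      using edge_merging[OF k] 3 by (simp add: abcd defs)
    interpret sp: merging "arcs D" "sim D ?u" "sim D ?sk" q0 q2
      using edge_splitting[OF l(1) kl(1)] 3 by (simp add: abcd defs)
    interpret sp': merging "arcs D" "sim D ?u" "sim D ?sl" p0 p2
      using edge_splitting[OF k(1) kl(2)] 3 by (simp add: abcd defs u)
    \<comment> \<open>In \<open>?sk\<close> the arcs \<open>p0\<close> and \<open>p2\<close> share a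
      circle, in \<open>?u\<close> they do not. So they sit on the two circles created by the split
      at \<open>l\<close>; they match \<open>q0\<close> and \<open>q2\<close> in one of two orders,
      which the sum does not see.\<close>
    have "sim D ?sk `` {p0} = sim D ?sk `` {p2}"
      using mg.F_class_cases[of p0] mg.F_class_cases[of p2] mem by simp
    then have "circ D ?u p0 \<in> {circ D ?u q0, circ D ?u q2}" "circ D ?u p2 \<in> {circ D ?u q0, circ D ?u q2}"
      using sp.F_class_eq_cases[of p0 p2] mem sp'.classes_neq by (simp_all add: circ_def)
    moreover have "circ D ?u p0 \<noteq> circ D ?u p2" using sp'.classes_neq by (simp add: circ_def)
    ultimately consider "circ D ?u p0 = circ D ?u q0" "circ D ?u p2 = circ D ?u q2"
      | "circ D ?u p0 = circ D ?u q2" "circ D ?u p2 = circ D ?u q0"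
      by auto
    then have "arc_monomial D ?u (p0 # xs) + arc_monomial D ?u (p2 # xs) = arc_monomial D ?u (q0 # xs) + arc_monomial D ?u (q2 # xs)"
    proof cases
      case 1
      then show ?thesis using arc_monomial_cong_Cons[OF 1(1)] arc_monomial_cong_Cons[OF 1(2)] by simp
    next
      case 2
      then show ?thesis using arc_monomial_cong_Cons[OF 2(1)] arc_monomial_cong_Cons[OF 2(2)] by (simp add: add.commute)
    qed
    then show ?thesis using 3 K[OF xs] L[OF xs] LK[OF xs] KL[OF xs] by simp
  qed
qed

lemma bracket_diff_mono:
  "bracket_diff D (arc_monomial D s xs)
    = (\<Sum>k\<in>{..<n_crossings} - s. frag_cmul (edge_sign k s) (edge k (arc_monomial D s xs)))"
  by (simp add: bracket_diff_def edge_def arc_monomial_def)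

lemma bracket_diff_edge:
  assumes "k < n_crossings" "k \<notin> s" "set xs \<subseteq> arcs D"
  shows "bracket_diff D (edge k (arc_monomial D s xs)) = (\<Sum>l\<in>{..<n_crossings} - insert k s.
    frag_cmul (edge_sign l (insert k s)) (edge l (edge k (arc_monomial D s xs))))"
proof (cases "(end_arc D k 0, end_arc D k 2) \<in> sim D s")
  case True
  have add: "bracket_diff D (a + b) = bracket_diff D a + bracket_diff D b" for a b
    by (simp add: bracket_diff_def frag_extend_add)
  show ?thesis
    unfolding edge_mono_split[OF assms(1,2) True assms(3)]
    by (simp add: add bracket_diff_mono edge_add frag_cmul_distrib2 sum.distrib)
next
  case False
  show ?thesis
    unfolding edge_mono_merge[OF assms(1,2) False assms(3)] by (rule bracket_diff_mono)
qed

text \<open>Exchanging the indices shows that the sum equals its negative, and free abelian groups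
  have no 2-torsion. The diagonal is filled with zeros to make the range a square.\<close>

lemma sum_antisym_zero:
  fixes g :: "'i \<Rightarrow> 'i \<Rightarrow> ('b \<Rightarrow>\<^sub>0 int)"
  assumes "finite S" and anti: "\<And>k l. k \<in> S \<Longrightarrow> l \<in> S \<Longrightarrow> k \<noteq> l \<Longrightarrow> g k l = - g l k"
  shows "(\<Sum>k\<in>S. \<Sum>l\<in>S - {k}. g k l) = 0"
proof -
  define h where "h = (\<lambda>k l. if k = l then 0 else g k l)"
  have "(\<Sum>l\<in>S - {k}. g k l) = (\<Sum>l\<in>S. h k l)" if "k \<in> S" for k
  proof -
    have "(\<Sum>l\<in>S. h k l) = h k k + (\<Sum>l\<in>S - {k}. h k l)" using assms(1) that by (rule sum.remove)
    also have "(\<Sum>l\<in>S - {k}. h k l) = (\<Sum>l\<in>S - {k}. g k l)"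
      by (intro sum.cong) (auto simp: h_def)
    also have "h k k = 0" by (simp add: h_def)
    finally show ?thesis by simp
  qed
  then have eq: "(\<Sum>k\<in>S. \<Sum>l\<in>S - {k}. g k l) = (\<Sum>k\<in>S. \<Sum>l\<in>S. h k l)" (is "?x = _") by (rule sum.cong[OF refl])
  also have "\<dots> = (\<Sum>l\<in>S. \<Sum>k\<in>S. h k l)" by (rule sum.swap)
  also have "\<dots> = (\<Sum>l\<in>S. \<Sum>k\<in>S. - h l k)"
  proof (intro sum.cong refl)
    fix l k assume lk: "l \<in> S" "k \<in> S"
    show "h k l = - h l k"
    proof (cases "k = l")
      case False
      then have "g k l = - g l k" using lk by (intro anti)
      moreover have "h k l = g k l" "h l k = g l k" using False by (simp_all add: h_def)
      ultimately show ?thesis by (simp only:)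
    qed (simp add: h_def)
  qed
  also have "\<dots> = - ?x" unfolding eq by (simp add: sum_negf)
  finally have x: "?x = - ?x" .
  show ?thesis
  proof (rule poly_mapping_eqI)
    fix i
    have "Poly_Mapping.lookup ?x i = - Poly_Mapping.lookup ?x i" using arg_cong[OF x, of "\<lambda>z. Poly_Mapping.lookup z i"] by simp
    then show "Poly_Mapping.lookup ?x i = Poly_Mapping.lookup 0 i" by simp
  qed
qed

text \<open>Of two crossings only the later one sees the marker of the earlier, so exactly one of
  the signs flips.\<close>

lemma edge_sign_anticommute:
  assumes "finite s" "k \<notin> s" "l \<notin> s" "k \<noteq> l"
  shows "edge_sign k s * edge_sign l (insert k s) = - (edge_sign l s * edge_sign k (insert l s))"
proof -
  have *: "edge_sign j (insert i s) = (if i < j then - edge_sign j s else edge_sign j s)" if "i \<notin> s" for i j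
  proof -
    have "{m \<in> insert i s. m < j} = (if i < j then insert i {m \<in> s. m < j} else {m \<in> s. m < j})" by auto
    then show ?thesis using assms(1) that by (simp add: edge_sign_def)
  qed
  show ?thesis using assms *[of k l] *[of l k] by (cases "k < l") auto
qed

lemma bracket_diff_squared_mono:
  assumes s: "s \<subseteq> {..<n_crossings}" and xs: "set xs \<subseteq> arcs D"
  shows "bracket_diff D (bracket_diff D (arc_monomial D s xs)) = 0"
proof -
  let ?S = "{..<n_crossings} - s" and ?m = "arc_monomial D s xs"
  define g where "g = (\<lambda>k l. frag_cmul (edge_sign k s * edge_sign l (insert k s)) (edge l (edge k ?m)))"
  have "bracket_diff D (bracket_diff D ?m)
    = (\<Sum>k\<in>?S. frag_cmul (edge_sign k s) (bracket_diff D (edge k ?m)))"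
    unfolding bracket_diff_mono[of s xs]
    unfolding bracket_diff_def by (simp add: frag_extend_sum frag_extend_cmul)
  also have "\<dots> = (\<Sum>k\<in>?S. \<Sum>l\<in>?S - {k}. g k l)"
  proof (rule sum.cong[OF refl])
    fix k assume k: "k \<in> ?S"
    have "{..<n_crossings} - insert k s = ?S - {k}" by auto
    then show "frag_cmul (edge_sign k s) (bracket_diff D (edge k ?m)) = (\<Sum>l\<in>?S - {k}. g k l)"
      using bracket_diff_edge[OF _ _ xs, of k s] k by (simp add: g_def frag_cmul_sum)
  qed
  also have "\<dots> = 0"
  proof (rule sum_antisym_zero)
    fix k l assume kl: "k \<in> ?S" "l \<in> ?S" "k \<noteq> l"
    have "finite s" using s finite_subset by blast
    then show "g k l = - g l k"
      unfolding g_def using kl xs by (subst edge_sign_anticommute, simp_all, subst edge_commute, simp_all)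
  qed simp
  finally show ?thesis .
qed

section \<open>Monomials as generators, their degrees and parities\<close>

text \<open>One arc is picked on each circle labelled \<open>W_plus\<close>. So every generator is a
  monomial, and identities checked on monomials hold on the whole complex.\<close>

lemma labelling_obtain:
  assumes "v \<in> labellings D s"
  obtains xs where "set xs \<subseteq> arcs D" "distinct (map (circ D s) xs)" "v = labelling_of D s xs"
proof -
  have "finite (circles D s)"
    unfolding circles_eq_quotient using finite_arcs by (rule finite_quotient) (auto simp: sim_def)
  then obtain Cs where Cs: "set Cs = {c \<in> circles D s. v c = W_plus}" "distinct Cs"
    using finite_distinct_list[of "{c \<in> circles D s. v c = W_plus}"] by auto
  have "\<forall>c\<in>set Cs. \<exists>a. a \<in> arcs D \<and> circ D s a = c"
    using Cs(1) by (auto simp: circles_eq_quotient circ_def elim!: quotientE)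
  then obtain r where r: "\<And>c. c \<in> set Cs \<Longrightarrow> r c \<in> arcs D \<and> circ D s (r c) = c" by metis
  have map: "map (circ D s) (map r Cs) = Cs" using r by (simp add: map_idI)
  then have img: "circ D s ` set (map r Cs) = set Cs" by (metis list.set_map)
  have "v = labelling_of D s (map r Cs)"
  proof
    fix c
    show "v c = labelling_of D s (map r Cs) c"
    proof (cases "c \<in> circles D s")
      case True
      then show ?thesis unfolding labelling_of_def img Cs(1) by (cases "v c") simp_all
    next
      case False
      have "v c = undefined" using assms False unfolding labellings_def by (rule PiE_arb)
      then show ?thesis using False by (simp add: labelling_of_def)
    qed
  qed
  moreover have "set (map r Cs) \<subseteq> arcs D" using r by auto
  moreover have "distinct (map (circ D s) (map r Cs))" unfolding map by (rule Cs(2))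
  ultimately show thesis by (intro that)
qed

text \<open>In this form the degree is visibly constant along edges: a merge loses a circle and
  gains a marker \<open>B\<close>, with changes \<open>2 - 2\<close>; a split gains a variable, a
  circle and a marker \<open>B\<close>, with changes \<open>4 - 2 - 2\<close>.\<close>

lemma degree_labelling_of:
  assumes "s \<subseteq> {..<n_crossings}" "set xs \<subseteq> arcs D" "distinct (map (circ D s) xs)"
  shows "degree_of D (s, labelling_of D s xs)
    = 4 * int (length xs) - 2 * int (card (circles D s)) + int n_crossings - 2 * int (card s)"
proof -
  have fin: "finite (circles D s)"
    unfolding circles_eq_quotient using finite_arcs by (rule finite_quotient) (auto simp: sim_def)
  let ?I = "circ D s ` set xs"
  have I: "?I \<subseteq> circles D s" using assms(2) circ_in_circles by auto
  have card_I: "card ?I = length xs"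
    using distinct_card[OF assms(3)] by simp
  have "(\<Sum>c\<in>circles D s. w_degree (labelling_of D s xs c)) = (\<Sum>c\<in>circles D s. 4 * of_bool (c \<in> ?I) - 2)"
    by (intro sum.cong refl) (simp add: labelling_of_def)
  also have "\<dots> = 4 * (\<Sum>c\<in>circles D s. of_bool (c \<in> ?I)) - 2 * int (card (circles D s))"
    by (simp add: sum_subtractf sum_distrib_left)
  also have "(\<Sum>c\<in>circles D s. of_bool (c \<in> ?I)) = int (card ?I)"
    using fin I by (simp add: sum_of_bool_eq Int_absorb1)
  finally have "(\<Sum>c\<in>circles D s. w_degree (labelling_of D s xs c)) = 4 * int (length xs) - 2 * int (card (circles D s))"
    by (simp only: card_I)
  moreover have "int (num_A D s) = int n_crossings - int (card s)"
  proof -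
    have "card s \<le> n_crossings" using card_mono[OF finite_lessThan assms(1)] by simp
    then show ?thesis
      using assms(1) by (simp add: num_A_def card_Diff_subset finite_subset)
  qed
  ultimately show ?thesis by (simp add: degree_of_def num_B_def)
qed

lemma keys_mono_generators:
  assumes "s \<subseteq> {..<n_crossings}" "set xs \<subseteq> arcs D" "[card s + card (circles D state_A) = i] (mod 2)"
    and "4 * int (length xs) - 2 * int (card (circles D s)) + int n_crossings - 2 * int (card s) = j"
  shows "Poly_Mapping.keys (arc_monomial D s xs) \<subseteq> generators D i j"
  using assms degree_labelling_of[OF assms(1,2)] labelling_of_in[of D s xs]
  by (simp add: arc_monomial_def keys_frag_of generators_def states_def num_B_def)

lemma keys_edge_generators:
  assumes k: "k < n_crossings" "k \<notin> s" and g: "(s, v) \<in> generators D i j" and i: "[i + 1 = i'] (mod 2)"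
  shows "Poly_Mapping.keys (edge_map D k (s, v)) \<subseteq> generators D i' j"
proof -
  have s: "s \<subseteq> {..<n_crossings}" "v \<in> labellings D s" "[card s + card (circles D state_A) = i] (mod 2)"
    "degree_of D (s, v) = j"
    using g by (simp_all add: generators_def states_def num_B_def)
  obtain xs where xs: "set xs \<subseteq> arcs D" "distinct (map (circ D s) xs)" "v = labelling_of D s xs"
    using s(2) by (rule labelling_obtain)
  have deg: "4 * int (length xs) - 2 * int (card (circles D s)) + int n_crossings - 2 * int (card s) = j"
    using degree_labelling_of[OF s(1) xs(1,2)] s(4) xs(3) by simp
  have fin: "finite s" using s(1) finite_subset by blast
  have t: "insert k s \<subseteq> {..<n_crossings}" using s(1) k(1) by simp
  have cs: "card (insert k s) = card s + 1" using fin k(2) by simp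
  have "card (insert k s) + card (circles D state_A) = card s + card (circles D state_A) + 1"
    using cs by simp
  moreover have "[card s + card (circles D state_A) + 1 = i + 1] (mod 2)"
    using s(3) cong_refl by (rule cong_add)
  ultimately have par: "[card (insert k s) + card (circles D state_A) = i'] (mod 2)"
    using i cong_trans by simp
  have eq: "edge_map D k (s, v) = edge k (arc_monomial D s xs)" using xs by (simp add: edge_def arc_monomial_def)
  show ?thesis
  proof (cases "(end_arc D k 0, end_arc D k 2) \<in> sim D s")
    case True
    have "Poly_Mapping.keys (arc_monomial D (insert k s) (z # xs)) \<subseteq> generators D i' j" if "z \<in> arcs D" for z
      using deg card_circles_split[OF k True] cs that xs(1)
      by (intro keys_mono_generators[OF t _ par]) simp_all
    note keys = this[OF end_arc_mem[OF k(1)]]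
    show ?thesis
      unfolding eq edge_mono_split[OF k True xs(1)]
      by (rule subset_trans[OF keys_add Un_least[OF keys keys]]) simp_all
  next
    case False
    show ?thesis
      unfolding eq edge_mono_merge[OF k False xs(1)]
      using deg card_circles_merge[OF k False] cs
      by (intro keys_mono_generators[OF t xs(1) par]) simp
  qed
qed

lemma bracket_diff_hom:
  assumes "[i + 1 = i'] (mod 2)"
  shows "bracket_diff D \<in> hom (free_Abelian_group (generators D i j)) (free_Abelian_group (generators D i' j))"
proof (rule homI)
  fix z assume "z \<in> carrier (free_Abelian_group (generators D i j))"
  then have z: "Poly_Mapping.keys z \<subseteq> generators D i j" by simp
  have "Poly_Mapping.keys (\<Sum>k\<in>{..<n_crossings} - s. frag_cmul (edge_sign k s) (edge_map D k (s, v))) \<subseteq> generators D i' j"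
    if "(s, v) \<in> generators D i j" for s v
  proof -
    have "Poly_Mapping.keys (frag_cmul (edge_sign k s) (edge_map D k (s, v))) \<subseteq> generators D i' j"
      if "k \<in> {..<n_crossings} - s" for k
    proof -
      have "Poly_Mapping.keys (edge_map D k (s, v)) \<subseteq> generators D i' j"
        by (rule keys_edge_generators[OF _ _ \<open>(s, v) \<in> generators D i j\<close> assms]) (use that in simp_all)
      then show ?thesis using keys_cmul by (rule subset_trans[rotated])
    qed
    then have "(\<Sum>k\<in>{..<n_crossings} - s. frag_cmul (edge_sign k s) (edge_map D k (s, v)))
      \<in> carrier (free_Abelian_group (generators D i' j))"
      by (intro sum_closed_free_Abelian_group) (simp only: carrier_free_Abelian_group_iff)
    then show ?thesis by simp
  qed
  then have "(\<Union>x\<in>Poly_Mapping.keys z. Poly_Mapping.keys (case x of (s, v) \<Rightarrow>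
      \<Sum>k\<in>{..<n_crossings} - s. frag_cmul (edge_sign k s) (edge_map D k (s, v)))) \<subseteq> generators D i' j"
    using subsetD[OF z] by (intro UN_least) (simp only: split: prod.splits, blast)
  then have "Poly_Mapping.keys (bracket_diff D z) \<subseteq> generators D i' j"
    unfolding bracket_diff_def by (rule subset_trans[OF keys_frag_extend])
  then show "bracket_diff D z \<in> carrier (free_Abelian_group (generators D i' j))" by simp
qed (simp add: bracket_diff_def frag_extend_add)

lemma bracket_diff_squared:
  assumes "Poly_Mapping.keys z \<subseteq> generators D i j"
  shows "bracket_diff D (bracket_diff D z) = 0"
proof -
  have gen: "bracket_diff D (bracket_diff D (frag_of x)) = 0" if x: "x \<in> generators D i j" for x
  proof -
    obtain s v where sv: "x = (s, v)" "s \<subseteq> {..<n_crossings}" "v \<in> labellings D s"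
      using x by (auto simp: generators_def states_def)
    obtain xs where xs: "set xs \<subseteq> arcs D" "distinct (map (circ D s) xs)" "v = labelling_of D s xs"
      using sv(3) by (rule labelling_obtain)
    have "frag_of x = arc_monomial D s xs" using xs sv by (simp add: arc_monomial_def)
    then show ?thesis using bracket_diff_squared_mono[OF sv(2) xs(1)] by simp
  qed
  show ?thesis
    using assms
  proof (induction z rule: frag_induction)
    case zero
    show ?case by (simp add: bracket_diff_def)
  next
    case (one x)
    then show ?case by (rule gen)
  next
    case (diff a b)
    then show ?case by (simp add: bracket_diff_def frag_extend_diff)
  qed
qed

end

section \<open>The Euler characteristic\<close>

lemma A_pow_add: "A_pow (a + b) = A_pow a * A_pow b"
  by (simp add: A_pow_def mult_single)

lemma A_pow_0: "A_pow 0 = 1"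
  by (simp add: A_pow_def)

lemma A_pow_sum: "A_pow (\<Sum>i\<in>I. f i) = (\<Prod>i\<in>I. A_pow (f i))"
  by (induction I rule: infinite_finite_induct) (simp_all add: A_pow_0 A_pow_add)

text \<open>The sign is the one by which the reflexion for odd writhe changes the Euler
  characteristic, and the exponent is that of the degree shift.\<close>

lemma minus_A_cubed_pow_eq:
  "minus_A_cubed_pow n = (if even n then A_pow (3 * n) else - A_pow (3 * n))"
proof -
  have *: "(- A_pow c) ^ m = (if even m then A_pow (c * int m) else - A_pow (c * int m))" for c m
    by (induction m) (simp_all add: A_pow_0 algebra_simps flip: A_pow_add)
  show ?thesis
    unfolding minus_A_cubed_pow_def * by (auto simp: even_nat_iff)
qed

lemma qdim_eq_sum:
  assumes "finite J" "\<And>j. j \<notin> J \<Longrightarrow> rk (G j) = 0"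
  shows "qdim G = (\<Sum>j\<in>J. A_pow j * of_nat (rk (G j)))"
proof -
  have "{j. rk (G j) \<noteq> 0} \<subseteq> J"
  proof
    fix j assume "j \<in> {j. rk (G j) \<noteq> 0}"
    then show "j \<in> J" using assms(2)[of j] by (cases "j \<in> J") simp_all
  qed
  then show ?thesis unfolding qdim_def using assms(1) by (intro sum.mono_neutral_left) simp_all
qed

lemma qdim_shift: "qdim (shift_group l G) = A_pow l * qdim G"
proof -
  have "qdim (shift_group l G) = (\<Sum>j\<in>{j. rk (G (j - l)) \<noteq> 0}. A_pow j * of_nat (rk (G (j - l))))"
    by (simp add: qdim_def shift_group_def)
  also have "\<dots> = (\<Sum>j\<in>{j. rk (G j) \<noteq> 0}. A_pow (j + l) * of_nat (rk (G j)))"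
    by (rule sum.reindex_bij_witness[of _ "\<lambda>j. j + l" "\<lambda>j. j - l"]) auto
  also have "\<dots> = A_pow l * qdim G"
    by (simp add: qdim_def sum_distrib_left A_pow_add mult.commute mult.left_commute)
  finally show ?thesis .
qed

lemma homology_shift:
  "homology (shift l C) = (shift_group l (fst (homology C)), shift_group l (snd (homology C)))"
  by (simp add: homology_def shift_def shift_group_def)

lemma homology_reflex: "homology (reflex C) = (snd (homology C), fst (homology C))"
  by (simp add: homology_def reflex_def)

lemma euler_char_shift: "euler_char (homology (shift l C)) = A_pow l * euler_char (homology C)"
  by (simp add: homology_shift euler_char_def qdim_shift algebra_simps)

lemma euler_char_reflex_pow:
  "euler_char (homology (reflex_pow n C)) = (if even n then euler_char (homology C) else - euler_char (homology C))"
  by (simp add: reflex_pow_def homology_reflex euler_char_def)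

lemma UNIV_w_basis: "(UNIV :: w_basis set) = {W_plus, W_minus}"
  using w_basis.exhaust by auto

section \<open>The Euler characteristic as a state sum\<close>

context link_diagram begin

lemma finite_circles: "finite (circles D s)"
  unfolding circles_eq_quotient using finite_arcs by (rule finite_quotient) (auto simp: sim_def)

text \<open>Every edge changes the number of circles by exactly one. So the index of the group
  containing a state is the parity of its number of circles, which is the sign that the negative
  factors of the bracket produce.\<close>

lemma circles_parity:
  assumes "s \<subseteq> {..<n_crossings}"
  shows "even (card s + card (circles D state_A)) \<longleftrightarrow> even (card (circles D s))"
proof -
  have "finite s" using assms by (rule finite_subset) simp
  then show ?thesis
    using assms
  proof (induction s)
    case empty
    show ?case by (simp add: state_A_def)
  next
    case (insert k s)
    then show ?case
      using card_circles_merge[of k s] card_circles_split[of k s]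
      by (cases "(end_arc D k 0, end_arc D k 2) \<in> sim D s") auto
  qed
qed

definition all_generators :: "'a generator set" where
  "all_generators = Sigma (states D) (labellings D)"

lemma finite_all_generators: "finite all_generators"
  unfolding all_generators_def states_def labellings_def
  by (intro finite_SigmaI finite_PiE finite_circles) (simp_all add: UNIV_w_basis)

lemma generators_eq: "generators D i j =
    {x \<in> all_generators. degree_of D x = j \<and> [num_B D (fst x) + card (circles D state_A) = i] (mod 2)}"
  by (auto simp: generators_def all_generators_def)

text \<open>The inequalities confine the homology to the finitely many degrees of generators; the
  difference of the ranks alone would leave open whether the sums in \<open>qdim\<close> are
  finite.\<close>

lemma rk_homology_bracket:
  fixes j :: int
  defines "H \<equiv> homology (bracket_complex D)"
  shows "rk (fst H j) \<le> card (generators D 0 j)" "rk (snd H j) \<le> card (generators D 1 j)"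
    and "int (rk (fst H j)) - int (rk (snd H j)) = int (card (generators D 0 j)) - int (card (generators D 1 j))"
proof -
  have fin: "finite (generators D i j)" for i
    unfolding generators_eq using finite_all_generators by simp
  let ?G = "\<lambda>i. free_Abelian_group (generators D i j)"
  have hom: "bracket_diff D \<in> hom (?G 0) (?G 1)" "bracket_diff D \<in> hom (?G 1) (?G 0)"
    by (rule bracket_diff_hom, simp add: cong_def)+
  have sq: "bracket_diff D (bracket_diff D x) = \<one>\<^bsub>?G i'\<^esub>" if "x \<in> carrier (?G i)" for x i i'
    using bracket_diff_squared[of x i j] that by simp
  note rk = rk_homology[OF abelian_free_Abelian_group abelian_free_Abelian_group hom sq sq
      has_rank_free_Abelian_group[OF fin] has_rank_free_Abelian_group[OF fin]]
  show "rk (fst H j) \<le> card (generators D 0 j)" "rk (snd H j) \<le> card (generators D 1 j)"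
    "int (rk (fst H j)) - int (rk (snd H j)) = int (card (generators D 0 j)) - int (card (generators D 1 j))"
    using rk by (simp_all add: H_def homology_def bracket_complex_def bracket_group_def)
qed

lemma euler_char_bracket_complex:
  "euler_char (homology (bracket_complex D))
    = (\<Sum>x\<in>all_generators. (-1) ^ card (circles D (fst x)) * A_pow (degree_of D x))"
proof -
  let ?H = "homology (bracket_complex D)" and ?J = "degree_of D ` all_generators"
  let ?h = "\<lambda>x. (-1) ^ card (circles D (fst x)) * A_pow (degree_of D x)"
  have J: "finite ?J" using finite_all_generators by simp
  have "generators D i j = {}" if "j \<notin> ?J" for i j using that by (auto simp: generators_eq)
  then have zero: "rk (fst ?H j) = 0 \<and> rk (snd ?H j) = 0" if "j \<notin> ?J" for j
    using rk_homology_bracket(1,2)[of j] that by simp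
  \<comment> \<open>Degrees outside \<open>?J\<close> contribute to neither group, so both graded
    dimensions become sums over one finite set and can be subtracted termwise.\<close>
  have "euler_char ?H = (\<Sum>j\<in>?J. A_pow j * of_nat (rk (fst ?H j))) - (\<Sum>j\<in>?J. A_pow j * of_nat (rk (snd ?H j)))"
    unfolding euler_char_def using qdim_eq_sum[OF J, of "fst ?H"] qdim_eq_sum[OF J, of "snd ?H"] zero by simp
  also have "\<dots> = (\<Sum>j\<in>?J. A_pow j * of_int (int (rk (fst ?H j)) - int (rk (snd ?H j))))"
    by (simp add: sum_subtractf right_diff_distrib)
  also have "\<dots> = (\<Sum>j\<in>?J. \<Sum>x\<in>{x \<in> all_generators. degree_of D x = j}. ?h x)"
  proof (rule sum.cong[OF refl])
    fix j
    let ?S = "{x \<in> all_generators. degree_of D x = j}"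
    have sign: "?h x = A_pow j" if "x \<in> generators D 0 j" for x
      using that circles_parity[of "fst x"]
      by (auto simp: generators_eq all_generators_def states_def num_B_def cong_0_iff)
    have sign': "?h x = - A_pow j" if "x \<in> generators D 1 j" for x
      using that circles_parity[of "fst x"]
      by (auto simp: generators_eq all_generators_def states_def num_B_def cong_def mod_2_eq_odd)
    have fin: "finite (generators D i j)" for i
      unfolding generators_eq using finite_all_generators by simp
    have "?S = generators D 0 j \<union> generators D 1 j" "generators D 0 j \<inter> generators D 1 j = {}"
      by (auto simp: generators_eq cong_def)
    then have "(\<Sum>x\<in>?S. ?h x) = (\<Sum>x\<in>generators D 0 j. ?h x) + (\<Sum>x\<in>generators D 1 j. ?h x)"
      using fin by (simp add: sum.union_disjoint)
    also have "\<dots> = (\<Sum>x\<in>generators D 0 j. A_pow j) + (\<Sum>x\<in>generators D 1 j. - A_pow j)"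
      using sign sign' by (intro arg_cong2[of _ _ _ _ "(+)"] sum.cong refl) simp_all
    also have "\<dots> = A_pow j * of_int (int (card (generators D 0 j)) - int (card (generators D 1 j)))"
      by (simp add: algebra_simps)
    finally show "A_pow j * of_int (int (rk (fst ?H j)) - int (rk (snd ?H j))) = (\<Sum>x\<in>?S. ?h x)"
      by (simp only: rk_homology_bracket(3))
  qed
  also have "\<dots> = (\<Sum>x\<in>all_generators. ?h x)"
    by (rule sum.image_gen[OF finite_all_generators, symmetric])
  finally show ?thesis .
qed

text \<open>The graded dimension is multiplicative on tensor products: each circle contributes the
  factor of \<open>W\<close>, and expanding the product runs through the labellings.\<close>

lemma sum_labellings:
  "(\<Sum>v\<in>labellings D s. A_pow (degree_of D (s, v)))
    = A_pow (int (num_A D s) - int (num_B D s)) * (A_pow 2 + A_pow (-2)) ^ card (circles D s)"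
proof -
  have "(\<Prod>c\<in>circles D s. \<Sum>w\<in>(UNIV :: w_basis set). A_pow (w_degree w))
    = (\<Sum>v\<in>labellings D s. \<Prod>c\<in>circles D s. A_pow (w_degree (v c)))"
    unfolding labellings_def by (rule prod_sum_PiE) (simp_all add: finite_circles UNIV_w_basis)
  moreover have "(\<Prod>c\<in>circles D s. \<Sum>w\<in>(UNIV :: w_basis set). A_pow (w_degree w))
    = (A_pow 2 + A_pow (-2)) ^ card (circles D s)"
    by (simp add: UNIV_w_basis)
  moreover have "(\<Sum>v\<in>labellings D s. A_pow (degree_of D (s, v)))
    = (\<Sum>v\<in>labellings D s. A_pow (int (num_A D s) - int (num_B D s)) * (\<Prod>c\<in>circles D s. A_pow (w_degree (v c))))"
    by (simp only: degree_of_def prod.case A_pow_add A_pow_sum mult.commute)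
  ultimately show ?thesis by (simp only: flip: sum_distrib_left)
qed

lemma euler_char_eq_bracket:
  assumes "arcs D \<noteq> {}"
  shows "euler_char (homology (bracket_complex D)) = (- A_pow 2 - A_pow (-2)) * bracket D"
proof -
  let ?d = "- A_pow 2 - A_pow (-2)"
  have "euler_char (homology (bracket_complex D))
    = (\<Sum>s\<in>states D. \<Sum>v\<in>labellings D s. (-1) ^ card (circles D s) * A_pow (degree_of D (s, v)))"
  proof -
    have "finite (labellings D s)" for s
      unfolding labellings_def by (intro finite_PiE finite_circles) (simp add: UNIV_w_basis)
    moreover have "finite (states D)" by (simp add: states_def)
    ultimately show ?thesis
      unfolding euler_char_bracket_complex all_generators_def by (subst sum.Sigma) (auto simp: split_def)
  qed
  also have "\<dots> = (\<Sum>s\<in>states D. ?d * (A_pow (int (num_A D s) - int (num_B D s)) * ?d ^ (card (circles D s) - 1)))"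
  proof (rule sum.cong[OF refl])
    fix s
    \<comment> \<open>A nonempty diagram has a circle in every state, so the truncated exponent in
      the bracket is exact and one factor \<open>?d\<close> can be split off.\<close>
    have "circles D s \<noteq> {}" using assms by (simp add: circles_eq_quotient quotient_is_empty)
    then have pos: "0 < card (circles D s)" using finite_circles by (simp add: card_gt_0_iff)
    have "?d = (-1) * (A_pow 2 + A_pow (-2))" by simp
    then have "?d ^ card (circles D s) = (-1) ^ card (circles D s) * (A_pow 2 + A_pow (-2)) ^ card (circles D s)"
      by (simp only: power_mult_distrib)
    then have "(\<Sum>v\<in>labellings D s. (-1) ^ card (circles D s) * A_pow (degree_of D (s, v)))
      = A_pow (int (num_A D s) - int (num_B D s)) * ?d ^ card (circles D s)"
      by (simp add: sum_labellings flip: sum_distrib_left)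
    also have "?d ^ card (circles D s) = ?d * ?d ^ (card (circles D s) - 1)"
      using pos by (metis power_minus_mult mult.commute)
    finally show "(\<Sum>v\<in>labellings D s. (-1) ^ card (circles D s) * A_pow (degree_of D (s, v)))
      = ?d * (A_pow (int (num_A D s) - int (num_B D s)) * ?d ^ (card (circles D s) - 1))"
      by (simp only: mult.left_commute)
  qed
  finally show ?thesis by (simp only: bracket_def sum_distrib_left)
qed

end

theorem theorem6p2:
  fixes D :: "'a diagram"
  assumes "oriented_link_diagram D"
    and "arcs D \<noteq> {}"
  shows "euler_char (H_ddot D) = f_hat D"
proof -
  interpret link_diagram D using assms(1) by unfold_locales
  have "euler_char (H_ddot D) = A_pow (- 3 * writhe D) *
      (if even (writhe D) then euler_char (homology (bracket_complex D)) else - euler_char (homology (bracket_complex D)))"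
    unfolding H_ddot_def C_ddot_def euler_char_shift euler_char_reflex_pow ..
  also have "\<dots> = minus_A_cubed_pow (- writhe D) * euler_char (homology (bracket_complex D))"
    by (simp add: minus_A_cubed_pow_eq)
  finally show ?thesis
    unfolding euler_char_eq_bracket[OF assms(2)] f_hat_def by (simp only: mult.assoc)
qed

end
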